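(* Let $\mathcal{X},\mathcal{Y},\mathcal{Z}$ be finite sets, $p_{XY}$ a probability mass function on $\mathcal{X}\times\mathcal{Y}$ and $p_{Z|XY}$ a conditional distribution on $\mathcal{Z}$, such that $p_X,p_Y,p_Z$ have full support. For secure computation of $(p_{XY},p_{Z|XY})$ with privacy against Alice only, the following hold for the rates $R^{\mathrm{PS}_2}$ and $R_n^{\mathrm{PS}_2}$ of perfectly secure protocols (for one and for $n\ge1$ instances, respectively) and for the rate $R^{\mathrm{AS}_2}$ achievable with asymptotic security: $$H_{\mathcal{X}}(G,X)\le R^{\mathrm{PS}_2}<H_{\mathcal{X}}(G,X)+1,$$ $$\tfrac1n H_{\mathcal{X}}(G^n,X^n)\le R_n^{\mathrm{PS}_2}\le\tfrac1n\left(H_{\mathcal{X}}(G^n,X^n)+1\right),$$ $$R^{\mathrm{AS}_2}=H_G(X|Y).$$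
   Context: $n$-fold problem. $(X_i,Y_i)$, $i=1,\dots,n$, are i.i.d. with law $p_{XY}$, Alice has $X^n$, Bob has $Y^n$, and $p_{Z^n|X^nY^n}(z^n|x^n,y^n)=\prod_{i=1}^n p_{Z|XY}(z_i|x_i,y_i)$; $n=1$ is the single-instance problem $(p_{XY},p_{Z|XY})$. Entropies are in bits. Protocols. Each user has private randomness (the two users' private randomness and the inputs are mutually independent). They communicate over a noiseless private link over multiple rounds; in each round one user sends a message (a finite binary string), which is a function of that user's input, private randomness and all messages exchanged so far. The messages of each round $t$ belong to a prefix-free code determined by the messages exchanged before. The transcript $M$ is the concatenation of all messages and $|M|$ its length in bits. At the end Bob produces his output as a function of his input, his private randomness and the transcript. Perfect security with privacy against Alice only. A protocol for $(p_{X^nY^n},p_{Z^n|X^nY^n})$ is perfectly secure if Bob's output $Z^n$ has conditional law $p_{Z^n|X^nY^n}$ given $(X^n,Y^n)$ and the Markov chain $M-X^n-(Y^n,Z^n)$ holds. For any perfectly secure protocol for the single-instance problem, its rate is $R^{\mathrm{PS}_2}:=\mathbb{E}[|M|]$; for any perfectly secure protocol for the $n$-fold problem, its rate is $R_n^{\mathrm{PS}_2}:=\frac1n\mathbb{E}[|M|]$. Asymptotic security with privacy against Alice only. The rate of a protocol for the $n$-fold problem is $\frac1n\mathbb{E}[|M|]$. The rate $R^{\mathrm{AS}_2}$ is achievable if there exists a sequence of protocols $\Pi_n$ with rate $R^{\mathrm{AS}_2}$, with Bob's output $\hat Z^n$ taking values in $\mathcal{Z}^n$, such that for every $\epsilon>0$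 there is a large enough $n$ for which $\mathbb{E}_{X^nY^n}\|p_{\hat Z^n|X^nY^n}-p_{Z^n|X^nY^n}\|_1\le\epsilon$ and $I(M;Y^n,\hat Z^n|X^n)\le n\epsilon$. Graphs. $G=(V,E)$ has $V=\mathcal{X}$, and $x,x'$ are adjacent iff there exists $(y,z)\in\mathcal{Y}\times\mathcal{Z}$ with $p_{XY}(x,y)>0$, $p_{XY}(x',y)>0$ and $p_{Z|XY}(z|x,y)\neq p_{Z|XY}(z|x',y)$. $G^n$ has vertex set $\mathcal{X}^n$, and $x^n,x'^n$ are adjacent iff there exists $(y^n,z^n)\in\mathcal{Y}^n\times\mathcal{Z}^n$ with $p_{X^nY^n}(x^n,y^n)>0$, $p_{X^nY^n}(x'^n,y^n)>0$ and $p_{Z^n|X^nY^n}(z^n|x^n,y^n)\ne p_{Z^n|X^nY^n}(z^n|x'^n,y^n)$. Chromatic entropy. For a graph $G=(V,E)$ and a random variable $X$ on $V$, $H_{\mathcal{X}}(G,X):=\min\{H(c(X)) : c:V\to\mathbb{N}\text{ a proper coloring of }G\}$, where a coloring is proper if the endpoints of each edge receive distinct colors. Conditional graph entropy. Let $\varGamma(G)$ be the set of all independent sets of $G$ (sets of vertices no two of which are adjacent). Then $H_G(X|Y):=\min I(W;X|Y)$, the minimum being over conditional distributions $p_{W|X}$ of a random variable $W\in\varGamma(G)$ such that $W-X-Y$ is a Markov chain and $p(w|x)>0$ only if $x\in w$.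
   Formalization: Upper bounds on the perfectly secure rates are for some protocol (padding breaks them for all); in "achievable", a sequence "with rate R" means rates converging to R with arbitrarily large good n, since exact rate R is impossible when 0<nR<1; the asymptotic rate is the infimum. *)

theory Defs
  imports "HOL-Probability.Probability" "HOL-Library.Sublist"
begin

section \<open>Interactive protocols\<close>

text \<open>
  A history is the list of messages exchanged so far; it determines who speaks next, the code
  from which the next message is drawn, and whether the interaction is over. The number of rounds
  is thus allowed to depend on the messages; a fixed number \<open>T\<close> of rounds is the special case
  \<open>halted h = (length h \<ge> T)\<close>. The private randomness of each user is a seed drawn from an
  arbitrary probability space carried by a set of reals.
\<close>

type_synonym msg = "bool list"
type_synonym history = "msg list"

record ('a, 'b, 'c) protocol =
  seed_A :: "real measure"
  seed_B :: "real measure"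
  alice_turn :: "history \<Rightarrow> bool"
  halted :: "history \<Rightarrow> bool"
  codebook :: "history \<Rightarrow> msg set"
  alice_msg :: "'a \<Rightarrow> real \<Rightarrow> history \<Rightarrow> msg"
  bob_msg :: "'b \<Rightarrow> real \<Rightarrow> history \<Rightarrow> msg"
  bob_output :: "'b \<Rightarrow> real \<Rightarrow> msg \<Rightarrow> 'c"

definition prefix_free :: "'s list set \<Rightarrow> bool" where
  "prefix_free C \<longleftrightarrow> (\<forall>u\<in>C. \<forall>v\<in>C. prefix u v \<longrightarrow> u = v)"

primrec history_upto ::
    "('a, 'b, 'c) protocol \<Rightarrow> 'a \<Rightarrow> 'b \<Rightarrow> real \<Rightarrow> real \<Rightarrow> nat \<Rightarrow> history" where
  "history_upto \<pi> x y r s 0 = []"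
| "history_upto \<pi> x y r s (Suc t) =
     (let h = history_upto \<pi> x y r s t
      in h @ [if alice_turn \<pi> h then alice_msg \<pi> x r h else bob_msg \<pi> y s h])"

text \<open>On the null set of runs that never halt (see \<open>protocol_for\<close>) the value is irrelevant.\<close>

definition transcript ::
    "('a, 'b, 'c) protocol \<Rightarrow> 'a \<Rightarrow> 'b \<Rightarrow> real \<Rightarrow> real \<Rightarrow> msg" where
  "transcript \<pi> x y r s =
     concat (history_upto \<pi> x y r s (LEAST t. halted \<pi> (history_upto \<pi> x y r s t)))"

text \<open>
  Outcomes have the form \<open>((x, y), (r, s))\<close>; the product measure makes the inputs and the two
  seeds mutually independent.
\<close>

type_synonym ('a, 'b) outcome = "('a \<times> 'b) \<times> (real \<times> real)"

definition run ::
    "('a \<times> 'b) pmf \<Rightarrow> ('a, 'b, 'c) protocol \<Rightarrow> ('a, 'b) outcome measure" where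
  "run p \<pi> = measure_pmf p \<Otimes>\<^sub>M (seed_A \<pi> \<Otimes>\<^sub>M seed_B \<pi>)"

definition inp_A :: "('a, 'b) outcome \<Rightarrow> 'a" where
  "inp_A \<omega> = fst (fst \<omega>)"

definition inp_B :: "('a, 'b) outcome \<Rightarrow> 'b" where
  "inp_B \<omega> = snd (fst \<omega>)"

definition rv_M :: "('a, 'b, 'c) protocol \<Rightarrow> ('a, 'b) outcome \<Rightarrow> msg" where
  "rv_M \<pi> = (\<lambda>((x, y), (r, s)). transcript \<pi> x y r s)"

definition rv_Z :: "('a, 'b, 'c) protocol \<Rightarrow> ('a, 'b) outcome \<Rightarrow> 'c" where
  "rv_Z \<pi> = (\<lambda>((x, y), (r, s)). bob_output \<pi> y s (transcript \<pi> x y r s))"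

definition protocol_for :: "('a \<times> 'b) pmf \<Rightarrow> ('a, 'b, 'c) protocol \<Rightarrow> bool" where
  "protocol_for p \<pi> \<longleftrightarrow>
     prob_space (seed_A \<pi>) \<and> prob_space (seed_B \<pi>) \<and>
     (\<forall>x h. (\<lambda>r. alice_msg \<pi> x r h) \<in> measurable (seed_A \<pi>) (count_space UNIV)) \<and>
     (\<forall>y h. (\<lambda>s. bob_msg \<pi> y s h) \<in> measurable (seed_B \<pi>) (count_space UNIV)) \<and>
     (\<forall>y m. (\<lambda>s. bob_output \<pi> y s m) \<in> measurable (seed_B \<pi>) (count_space UNIV)) \<and>
     (\<forall>h. prefix_free (codebook \<pi> h)) \<and>
     (\<forall>h x. \<forall>r\<in>space (seed_A \<pi>). alice_turn \<pi> h \<longrightarrow> alice_msg \<pi> x r h \<in> codebook \<pi> h) \<and>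
     (\<forall>h y. \<forall>s\<in>space (seed_B \<pi>). \<not> alice_turn \<pi> h \<longrightarrow> bob_msg \<pi> y s h \<in> codebook \<pi> h) \<and>
     (AE ((x, y), (r, s)) in run p \<pi>. \<exists>t. halted \<pi> (history_upto \<pi> x y r s t))"

text \<open>The expected number of bits exchanged may be infinite.\<close>

definition expected_length :: "('a \<times> 'b) pmf \<Rightarrow> ('a, 'b, 'c) protocol \<Rightarrow> ennreal" where
  "expected_length p \<pi> = (\<integral>\<^sup>+ \<omega>. of_nat (length (rv_M \<pi> \<omega>)) \<partial>run p \<pi>)"

section \<open>Perfect security\<close>

definition markov_chain ::
    "'o measure \<Rightarrow> ('o \<Rightarrow> 'u) \<Rightarrow> ('o \<Rightarrow> 'v) \<Rightarrow> ('o \<Rightarrow> 'w) \<Rightarrow> bool" where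
  "markov_chain S U V W \<longleftrightarrow>
     (\<forall>u v w. \<P>(\<omega> in S. V \<omega> = v) > 0 \<longrightarrow>
        \<P>(\<omega> in S. U \<omega> = u \<and> W \<omega> = w \<bar> V \<omega> = v) =
        \<P>(\<omega> in S. U \<omega> = u \<bar> V \<omega> = v) * \<P>(\<omega> in S. W \<omega> = w \<bar> V \<omega> = v))"

definition output_prob ::
    "('a \<times> 'b) pmf \<Rightarrow> ('a, 'b, 'c) protocol \<Rightarrow> 'a \<Rightarrow> 'b \<Rightarrow> 'c \<Rightarrow> real" where
  "output_prob p \<pi> x y z =
     \<P>(\<omega> in run p \<pi>. rv_Z \<pi> \<omega> = z \<bar> inp_A \<omega> = x \<and> inp_B \<omega> = y)"

definition perfectly_secure ::
    "('a \<times> 'b) pmf \<Rightarrow> ('a \<Rightarrow> 'b \<Rightarrow> 'c pmf) \<Rightarrow> ('a, 'b, 'c) protocol \<Rightarrow> bool" where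
  "perfectly_secure p K \<pi> \<longleftrightarrow>
     protocol_for p \<pi> \<and>
     (\<forall>(x, y)\<in>set_pmf p. \<forall>z. output_prob p \<pi> x y z = pmf (K x y) z) \<and>
     markov_chain (run p \<pi>) (rv_M \<pi>) inp_A (\<lambda>\<omega>. (inp_B \<omega>, rv_Z \<pi> \<omega>))"

section \<open>The n-fold problem\<close>

text \<open>Sequences of length \<open>n\<close> are lists of length \<open>n\<close>.\<close>

definition iid :: "nat \<Rightarrow> ('x \<times> 'y) pmf \<Rightarrow> ('x list \<times> 'y list) pmf" where
  "iid n p = map_pmf (\<lambda>ps. (map fst ps, map snd ps)) (replicate_pmf n p)"

primrec prod_list_pmf :: "'z pmf list \<Rightarrow> 'z list pmf" where
  "prod_list_pmf [] = return_pmf []"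
| "prod_list_pmf (q # qs) =
     bind_pmf q (\<lambda>z. bind_pmf (prod_list_pmf qs) (\<lambda>zs. return_pmf (z # zs)))"

definition memoryless :: "('x \<Rightarrow> 'y \<Rightarrow> 'z pmf) \<Rightarrow> 'x list \<Rightarrow> 'y list \<Rightarrow> 'z list pmf" where
  "memoryless K xs ys = prod_list_pmf (map2 K xs ys)"

lemma pmf_map_inj_Cons:
  "pmf (bind_pmf q (\<lambda>z. bind_pmf Q (\<lambda>zs. return_pmf (z # zs)))) (w # ws) = pmf q w * pmf Q ws"
proof -
  have "bind_pmf q (\<lambda>z. bind_pmf Q (\<lambda>zs. return_pmf (z # zs)))
      = map_pmf (\<lambda>(z, zs). z # zs) (pair_pmf q Q)"
    by (simp add: pair_pmf_def map_pmf_def bind_assoc_pmf bind_return_pmf)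
  moreover have "pmf (map_pmf (\<lambda>(z, zs). z # zs) (pair_pmf q Q)) ((\<lambda>(z, zs). z # zs) (w, ws))
      = pmf (pair_pmf q Q) (w, ws)"
    by (rule pmf_map_inj') (auto simp: inj_on_def)
  ultimately show ?thesis
    by (simp add: pmf_pair)
qed

lemma pmf_prod_list_pmf:
  "length zs = length qs \<Longrightarrow> pmf (prod_list_pmf qs) zs = (\<Prod>i<length qs. pmf (qs ! i) (zs ! i))"
proof (induction qs arbitrary: zs)
  case Nil
  then show ?case by simp
next
  case (Cons q qs)
  then obtain w ws where zs: "zs = w # ws" "length ws = length qs"
    by (cases zs) auto
  then show ?case
    using Cons.IH[of ws] by (simp add: pmf_map_inj_Cons prod.lessThan_Suc_shift del: prod.lessThan_Suc)
qed

lemma pmf_memoryless: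
  assumes "length xs = n" "length ys = n" "length zs = n"
  shows "pmf (memoryless K xs ys) zs = (\<Prod>i<n. pmf (K (xs ! i) (ys ! i)) (zs ! i))"
  using assms by (simp add: memoryless_def pmf_prod_list_pmf)

lemma replicate_pmf_eq_prod_list_pmf: "replicate_pmf n p = prod_list_pmf (replicate n p)"
  by (induction n) auto

lemma pmf_iid:
  assumes "length xs = n" "length ys = n"
  shows "pmf (iid n p) (xs, ys) = (\<Prod>i<n. pmf p (xs ! i, ys ! i))"
proof -
  let ?f = "\<lambda>ps. (map fst ps, map snd ps)"
  have inj: "inj ?f"
    by (rule injI) (metis prod.inject zip_map_fst_snd)
  have "(xs, ys) = ?f (zip xs ys)"
    using assms by simp
  then have "pmf (iid n p) (xs, ys) = pmf (replicate_pmf n p) (zip xs ys)"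
    unfolding iid_def using pmf_map_inj'[OF inj] by metis
  also have "\<dots> = (\<Prod>i<n. pmf p (xs ! i, ys ! i))"
    using assms by (simp add: replicate_pmf_eq_prod_list_pmf pmf_prod_list_pmf)
  finally show ?thesis .
qed

definition rate_n :: "nat \<Rightarrow> ('x \<times> 'y) pmf \<Rightarrow> ('x list, 'y list, 'z list) protocol \<Rightarrow> ennreal" where
  "rate_n n p \<pi> = expected_length (iid n p) \<pi> / of_nat n"

section \<open>Asymptotic security\<close>

definition avg_L1_error ::
    "nat \<Rightarrow> ('x \<times> 'y) pmf \<Rightarrow> ('x \<Rightarrow> 'y \<Rightarrow> 'z pmf) \<Rightarrow> ('x list, 'y list, 'z list) protocol \<Rightarrow> real" where
  "avg_L1_error n p K \<pi> =
     measure_pmf.expectation (iid n p) (\<lambda>(xs, ys).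
       \<Sum>zs\<in>{zs. length zs = n}. \<bar>output_prob (iid n p) \<pi> xs ys zs - pmf (memoryless K xs ys) zs\<bar>)"

definition leakage :: "('a \<times> 'b) pmf \<Rightarrow> ('a, 'b, 'c) protocol \<Rightarrow> real" where
  "leakage p \<pi> =
     prob_space.conditional_mutual_information (run p \<pi>) 2
       (count_space UNIV) (count_space UNIV) (count_space UNIV)
       (rv_M \<pi>) (\<lambda>\<omega>. (inp_B \<omega>, rv_Z \<pi> \<omega>)) inp_A"

text \<open>
  The rates are required to converge to \<open>R\<close> rather than to equal \<open>R\<close> for each \<open>n\<close>: since the
  messages are prefix-free codewords, the expected length is \<open>0\<close> or at least \<open>1\<close>, so a rate
  strictly between \<open>0\<close> and \<open>1 / n\<close> is never attained exactly. Correspondingly, ``there is a large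
  enough \<open>n\<close>'' means that \<open>n\<close> can be found beyond any bound.
\<close>

definition achievable ::
    "('x \<times> 'y) pmf \<Rightarrow> ('x \<Rightarrow> 'y \<Rightarrow> 'z pmf) \<Rightarrow> ennreal \<Rightarrow> bool" where
  "achievable p K R \<longleftrightarrow>
     (\<exists>\<pi> :: nat \<Rightarrow> ('x list, 'y list, 'z list) protocol.
        (\<forall>n\<ge>1. protocol_for (iid n p) (\<pi> n) \<and>
                (\<forall>ys s m. length (bob_output (\<pi> n) ys s m) = n)) \<and>
        (\<lambda>n. rate_n n p (\<pi> n)) \<longlonglongrightarrow> R \<and>
        (\<forall>\<epsilon>>0. \<forall>N. \<exists>n\<ge>N. n \<ge> 1 \<and> avg_L1_error n p K (\<pi> n) \<le> \<epsilon> \<and>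
                leakage (iid n p) (\<pi> n) \<le> real n * \<epsilon>))"

definition AS2_rate :: "('x \<times> 'y) pmf \<Rightarrow> ('x \<Rightarrow> 'y \<Rightarrow> 'z pmf) \<Rightarrow> ennreal" where
  "AS2_rate p K = Inf {R. achievable p K R}"

section \<open>The graph and its entropies\<close>

text \<open>
  \<open>adj p K\<close> is the edge relation of \<open>G\<close>, and \<open>adj (iid n p) (memoryless K)\<close> that of \<open>G\<^sup>n\<close>, whose
  vertices are the lists of length \<open>n\<close>.
\<close>

definition adj :: "('a \<times> 'b) pmf \<Rightarrow> ('a \<Rightarrow> 'b \<Rightarrow> 'c pmf) \<Rightarrow> 'a \<Rightarrow> 'a \<Rightarrow> bool" where
  "adj p K x x' \<longleftrightarrow>
     (\<exists>y z. pmf p (x, y) > 0 \<and> pmf p (x', y) > 0 \<and> pmf (K x y) z \<noteq> pmf (K x' y) z)"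

definition proper_coloring :: "'v set \<Rightarrow> ('v \<Rightarrow> 'v \<Rightarrow> bool) \<Rightarrow> ('v \<Rightarrow> nat) \<Rightarrow> bool" where
  "proper_coloring V E c \<longleftrightarrow> (\<forall>u\<in>V. \<forall>v\<in>V. E u v \<longrightarrow> c u \<noteq> c v)"

text \<open>
  On a finite vertex set \<open>H(c(X))\<close> takes finitely many values, so the infimum is attained. The
  same holds for \<open>cond_graph_entropy\<close> by compactness.
\<close>

definition chromatic_entropy :: "'v set \<Rightarrow> ('v \<Rightarrow> 'v \<Rightarrow> bool) \<Rightarrow> 'v pmf \<Rightarrow> real" where
  "chromatic_entropy V E q =
     Inf {prob_space.entropy (measure_pmf q) 2 (count_space UNIV) c | c. proper_coloring V E c}"

definition independent_sets :: "'v set \<Rightarrow> ('v \<Rightarrow> 'v \<Rightarrow> bool) \<Rightarrow> 'v set set" where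
  "independent_sets V E = {w. w \<subseteq> V \<and> (\<forall>u\<in>w. \<forall>v\<in>w. \<not> E u v)}"

text \<open>
  The joint law of \<open>(W, X, Y)\<close> for \<open>(X, Y)\<close> with law \<open>p\<close> and \<open>W\<close> drawn from \<open>X\<close> through the
  kernel \<open>q\<close>; \<open>W - X - Y\<close> is a Markov chain by construction.
\<close>

definition extend_by :: "('x \<times> 'y) pmf \<Rightarrow> ('x \<Rightarrow> 'w pmf) \<Rightarrow> ('w \<times> 'x \<times> 'y) pmf" where
  "extend_by p q = bind_pmf p (\<lambda>(x, y). map_pmf (\<lambda>w. (w, x, y)) (q x))"

definition cond_graph_entropy ::
    "'x set \<Rightarrow> ('x \<Rightarrow> 'x \<Rightarrow> bool) \<Rightarrow> ('x \<times> 'y) pmf \<Rightarrow> real" where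
  "cond_graph_entropy V E p =
     Inf {prob_space.conditional_mutual_information (measure_pmf (extend_by p q)) 2
            (count_space UNIV) (count_space UNIV) (count_space UNIV)
            fst (\<lambda>(w, x, y). x) (\<lambda>(w, x, y). y)
          | q :: 'x \<Rightarrow> 'x set pmf.
            \<forall>x\<in>V. set_pmf (q x) \<subseteq> {w \<in> independent_sets V E. x \<in> w}}"

end

theory Submission
  imports Defs "HOL-Real_Asymp.Real_Asymp"
begin

text \<open>
  The law of the inputs, transcript and output factors as \<open>p x y * weight_A x m * weight_B y m z\<close>, and the
  possible transcripts form a prefix-free set.

  Under perfect security, adjacent \<open>x\<close> and \<open>x'\<close> have no transcript in common, since Bob's output depends on
  the transcript and \<open>y\<close> only. Hence mapping each \<open>x\<close> to a shortest transcript it can produce is a proper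
  colouring by prefix-free words. Conversely, Alice sends a Shannon code word for the colour of her input.

  For the asymptotic rate, let \<open>u\<close> consist of the transcript, the past of \<open>x\<close> and the future of \<open>y\<close>, and let
  \<open>S u\<close> be the set of letters \<open>x\<close> whose posterior probability exceeds a threshold. If the posterior of
  \<open>(x, y, z)\<close> is close to the channel law in total variation, then \<open>S u\<close> is independent. Testing against the sign of
  the difference turns that distance into an expectation, and Gibbs' inequality bounds it by the leakage up to
  the output error; it also bounds the length of the transcript from below by the sum of the informations
  \<open>I(S u; x | y)\<close>. For achievability, Alice selects a word of independent sets by Poisson matching and sends
  its bin, from which Bob recovers the word with high probability.
\<close>

section \<open>The law of a protocol\<close>

text \<open>Under asymptotic security no argument about supports survives: adjacent letters may
  share a transcript. Their posterior probabilities cannot both be large, which is why a threshold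
  enters. The auxiliary \<open>u\<close> has to meet three demands. Given \<open>u\<close>, the law
  of a letter must factor as \<open>\<alpha> u x y * \<beta> u y z\<close>; fixing the past of
  \<open>x\<close> and the future of \<open>y\<close> leaves the past of \<open>y\<close> to Bob's
  factor and the future of \<open>x\<close> to Alice's. The product of the laws of \<open>x\<close>
  given \<open>u\<close> and \<open>y\<close> must be normalised letter by letter, which works from
  the last \<open>x\<close> to the first for fixed \<open>ys\<close>. And \<open>u\<close> must be a
  function of what the leakage bound conditions on, namely \<open>m\<close>, all of
  \<open>xs\<close> and the later pairs \<open>(y, z)\<close>. Leakage controls the deviation from
  the channel through an exponential tilt of size \<tau> that costs \<tau>^2 per letter; leakage of
  at most \<open>n * \<tau>^2\<close> thus contributes a deviation of order \<tau> per letter. For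
  achievability, the users share no randomness, so the random clocks of the matching have to be
  fixed in advance.\<close>

definition complete :: "('a, 'b, 'c) protocol \<Rightarrow> history \<Rightarrow> bool" where
  "complete \<pi> h \<longleftrightarrow> halted \<pi> h \<and> (\<forall>t<length h. \<not> halted \<pi> (take t h) \<and> h ! t \<in> codebook \<pi> (take t h))"

definition follows_A :: "('a, 'b, 'c) protocol \<Rightarrow> 'a \<Rightarrow> real \<Rightarrow> history \<Rightarrow> bool" where
  "follows_A \<pi> x r h \<longleftrightarrow>
     (\<forall>t<length h. alice_turn \<pi> (take t h) \<longrightarrow> alice_msg \<pi> x r (take t h) = h ! t)"

definition follows_B :: "('a, 'b, 'c) protocol \<Rightarrow> 'b \<Rightarrow> real \<Rightarrow> history \<Rightarrow> bool" where
  "follows_B \<pi> y s h \<longleftrightarrow>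
     (\<forall>t<length h. \<not> alice_turn \<pi> (take t h) \<longrightarrow> bob_msg \<pi> y s (take t h) = h ! t)"

definition words :: "('a, 'b, 'c) protocol \<Rightarrow> msg set" where
  "words \<pi> = concat ` {h. complete \<pi> h}"

lemma length_history_upto [simp]: "length (history_upto \<pi> x y r s t) = t"
  by (induction t) (auto simp: Let_def)

lemma take_history_upto: "t \<le> T \<Longrightarrow> take t (history_upto \<pi> x y r s T) = history_upto \<pi> x y r s t"
proof (induction T)
  case (Suc T)
  then show ?case by (cases "t = Suc T") (auto simp: Let_def)
qed auto

text \<open>The rectangle property of interaction: for a fixed history, the condition that a run
  passes through it splits into one on \<open>(x, r)\<close> and one on
  \<open>(y, s)\<close>.\<close>

lemma history_upto_eq_iff:
  "history_upto \<pi> x y r s (length h) = h \<longleftrightarrow> follows_A \<pi> x r h \<and> follows_B \<pi> y s h"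
proof (induction h rule: rev_induct)
  case Nil
  then show ?case by (simp add: follows_A_def follows_B_def)
next
  case (snoc m h)
  have "follows_A \<pi> x r (h @ [m]) \<longleftrightarrow> follows_A \<pi> x r h \<and> (alice_turn \<pi> h \<longrightarrow> alice_msg \<pi> x r h = m)"
    by (auto simp: follows_A_def less_Suc_eq nth_append)
  moreover have "follows_B \<pi> y s (h @ [m]) \<longleftrightarrow> follows_B \<pi> y s h \<and> (\<not> alice_turn \<pi> h \<longrightarrow> bob_msg \<pi> y s h = m)"
    by (auto simp: follows_B_def less_Suc_eq nth_append)
  ultimately show ?case using snoc by (auto simp: Let_def)
qed

text \<open>At the first message where two complete histories differ, neither message is a prefix of the
  other.\<close>

lemma complete_prefix:
  assumes pf: "\<And>h. prefix_free (codebook \<pi> h)"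
    and h: "complete \<pi> h" and h': "complete \<pi> h'" and pre: "prefix (concat h) (concat h')"
  shows "h = h'"
proof (rule ccontr)
  assume ne: "h \<noteq> h'"
  have npre: "\<not> prefix h h'" if "complete \<pi> h" "complete \<pi> h'" "h \<noteq> h'" for h h'
  proof
    assume "prefix h h'"
    then have "take (length h) h' = h" "length h < length h'"
      using that(3) by (auto simp: prefix_def)
    then show False using that unfolding complete_def by metis
  qed
  have "h \<parallel> h'"
    using npre[OF h h' ne] npre[OF h' h] ne by auto
  then obtain as b bs c cs where *: "b \<noteq> c" "h = as @ b # bs" "h' = as @ c # cs"
    using parallel_decomp by blast
  have "take (length as) h = as" "take (length as) h' = as" "h ! length as = b" "h' ! length as = c"
    "length as < length h" "length as < length h'"
    using * by auto
  then have "b \<in> codebook \<pi> as" "c \<in> codebook \<pi> as"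
    using h h' unfolding complete_def by metis+
  moreover have "prefix b c \<or> prefix c b"
  proof -
    have "prefix (b @ concat bs) (c @ concat cs)"
      using pre * by simp
    then have "prefix b (c @ concat cs)" by (rule append_prefixD)
    moreover have "prefix c (c @ concat cs)" by simp
    ultimately show ?thesis using prefix_same_cases by blast
  qed
  ultimately show False using pf[of as] \<open>b \<noteq> c\<close> unfolding prefix_free_def by metis
qed

lemma prefix_free_words:
  assumes "protocol_for p \<pi>"
  shows "prefix_free (words \<pi>)"
  using assms complete_prefix[of \<pi>] unfolding prefix_free_def words_def protocol_for_def by auto

lemma inj_on_concat_complete:
  assumes "protocol_for p \<pi>"
  shows "inj_on concat {h. complete \<pi> h}"
  using assms complete_prefix[of \<pi>] unfolding inj_on_def protocol_for_def by auto

text \<open>Meaningful on \<open>words \<pi>\<close>, where prefix-freeness makes the history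
  recoverable from the concatenated bits.\<close>

definition split_word :: "('a, 'b, 'c) protocol \<Rightarrow> msg \<Rightarrow> history" where
  "split_word \<pi> m = the_inv_into {h. complete \<pi> h} concat m"

text \<open>A word stems from a single complete history, so the event that it is the transcript is
  again a rectangle in the two seeds. This is the source of the product form of the joint
  law.\<close>

lemma transcript_eq_iff:
  assumes \<pi>: "protocol_for p \<pi>" and r: "r \<in> space (seed_A \<pi>)" and s: "s \<in> space (seed_B \<pi>)"
    and halt: "\<exists>t. halted \<pi> (history_upto \<pi> x y r s t)"
  shows "transcript \<pi> x y r s = m \<longleftrightarrow>
    m \<in> words \<pi> \<and> follows_A \<pi> x r (split_word \<pi> m) \<and> follows_B \<pi> y s (split_word \<pi> m)"
proof -
  define T where "T = (LEAST t. halted \<pi> (history_upto \<pi> x y r s t))"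
  define h where "h = history_upto \<pi> x y r s T"
  have T: "halted \<pi> h" "\<And>t. t < T \<Longrightarrow> \<not> halted \<pi> (history_upto \<pi> x y r s t)"
    using halt unfolding h_def T_def by (auto intro: LeastI_ex dest: not_less_Least)
  have len: "length h = T" by (simp add: h_def)
  have nth: "h ! t = (let g = history_upto \<pi> x y r s t in
      if alice_turn \<pi> g then alice_msg \<pi> x r g else bob_msg \<pi> y s g)" if "t < T" for t
  proof -
    have "h ! t = take (Suc t) h ! t" using that len by simp
    also have "take (Suc t) h = history_upto \<pi> x y r s (Suc t)"
      unfolding h_def using that by (intro take_history_upto) simp
    finally show ?thesis by (simp add: Let_def nth_append)
  qed
  have "complete \<pi> h"
    unfolding complete_def
  proof (intro conjI allI impI)
    fix t assume "t < length h"
    then have "t < T" by (simp add: len)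
    then have tk: "take t h = history_upto \<pi> x y r s t" by (simp add: h_def take_history_upto)
    show "\<not> halted \<pi> (take t h)" using T(2) \<open>t < T\<close> by (simp add: tk)
    show "h ! t \<in> codebook \<pi> (take t h)"
      using \<pi> r s unfolding nth[OF \<open>t < T\<close>] tk protocol_for_def by (auto simp: Let_def)
  qed (use T in auto)
  then have w: "concat h \<in> words \<pi>" "split_word \<pi> (concat h) = h"
    using inj_on_concat_complete[OF \<pi>] by (auto simp: words_def split_word_def the_inv_into_f_f)
  have tr: "transcript \<pi> x y r s = concat h"
    by (simp add: transcript_def h_def T_def)
  have AB: "follows_A \<pi> x r h" "follows_B \<pi> y s h"
    using history_upto_eq_iff[of \<pi> x y r s h] len h_def by auto
  show ?thesis
  proof
    assume "transcript \<pi> x y r s = m"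
    then show "m \<in> words \<pi> \<and> follows_A \<pi> x r (split_word \<pi> m) \<and> follows_B \<pi> y s (split_word \<pi> m)"
      using w tr AB by auto
  next
    assume *: "m \<in> words \<pi> \<and> follows_A \<pi> x r (split_word \<pi> m) \<and> follows_B \<pi> y s (split_word \<pi> m)"
    then obtain h' where h': "complete \<pi> h'" "m = concat h'" by (auto simp: words_def)
    then have "split_word \<pi> m = h'"
      using inj_on_concat_complete[OF \<pi>] by (auto simp: split_word_def the_inv_into_f_f)
    then have eq: "history_upto \<pi> x y r s (length h') = h'"
      using * history_upto_eq_iff[of \<pi> x y r s h'] by auto
    \<comment> \<open>\<open>h'\<close> is the run after \<open>length h'\<close> rounds. If it were
      longer than \<open>T\<close>, it would pass through the halted \<open>h\<close>; if it were
      shorter, the run would halt before its first halting time.\<close>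
    have "length h' = T"
    proof (rule antisym)
      show "length h' \<le> T"
      proof (rule ccontr)
        assume "\<not> length h' \<le> T"
        then have "take T h' = h"
          using take_history_upto[of T "length h'" \<pi> x y r s] eq by (simp add: h_def)
        then show False using h' T(1) \<open>\<not> length h' \<le> T\<close> by (auto simp: complete_def)
      qed
      show "T \<le> length h'"
        using T(2)[of "length h'"] h' eq by (cases "T \<le> length h'") (auto simp: complete_def)
    qed
    then show "transcript \<pi> x y r s = m" using tr h' eq h_def by simp
  qed
qed

section \<open>The joint law as a mass function\<close>

lemma measure_pmf_Abs_pmf:
  fixes N :: "'a::countable measure"
  assumes "prob_space N" "sets N = UNIV"
  shows "measure_pmf (Abs_pmf N) = N"
proof (rule Abs_pmf_inverse, safe)
  interpret prob_space N by fact
  have sp: "space N = UNIV" using sets_eq_imp_space_eq[of N "count_space UNIV"] assms by simp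
  \<comment> \<open>The atoms of mass zero are countably many, so together they form a null
    set.\<close>
  have "AE x in N. \<forall>y\<in>UNIV. measure N {y} = 0 \<longrightarrow> x \<noteq> y"
  proof (subst AE_ball_countable, safe)
    fix y
    show "AE x in N. measure N {y} = 0 \<longrightarrow> x \<noteq> y"
    proof (cases "measure N {y} = 0")
      case True
      then have "{y} \<in> null_sets N"
        using assms by (intro null_setsI) (auto simp: emeasure_eq_measure)
      then have "AE x in N. x \<notin> {y}" by (rule AE_not_in)
      then show ?thesis by simp
    qed simp
  qed simp
  then show "AE x in N. measure N {x} \<noteq> 0" by (rule eventually_mono) auto
qed (use assms in auto)

text \<open>The seeds live on arbitrary spaces, but inputs, transcript and output are discrete;
  their joint mass function reduces the later arguments to discrete probability.\<close>

definition law :: "('a \<times> 'b) pmf \<Rightarrow> ('a, 'b, 'c) protocol \<Rightarrow> ('a \<times> 'b \<times> msg \<times> 'c) pmf" where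
  "law p \<pi> = Abs_pmf (distr (run p \<pi>) (count_space UNIV)
     (\<lambda>\<omega>. (inp_A \<omega>, inp_B \<omega>, rv_M \<pi> \<omega>, rv_Z \<pi> \<omega>)))"

text \<open>The probability over her seed that Alice plays her part in producing \<open>m\<close>.
  Carrying the case \<open>m \<notin> words \<pi>\<close> here lets the product formula
  \<open>pmf_law\<close> hold for every \<open>m\<close>.\<close>

definition weight_A :: "('a, 'b, 'c) protocol \<Rightarrow> 'a \<Rightarrow> msg \<Rightarrow> real" where
  "weight_A \<pi> x m = (if m \<in> words \<pi>
     then \<P>(r in seed_A \<pi>. follows_A \<pi> x r (split_word \<pi> m)) else 0)"

definition weight_B :: "('a, 'b, 'c) protocol \<Rightarrow> 'b \<Rightarrow> msg \<Rightarrow> 'c \<Rightarrow> real" where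
  "weight_B \<pi> y m z =
     \<P>(s in seed_B \<pi>. follows_B \<pi> y s (split_word \<pi> m) \<and> bob_output \<pi> y s m = z)"

lemma weight_nonneg: "0 \<le> weight_A \<pi> x m" "0 \<le> weight_B \<pi> y m z"
  by (auto simp: weight_A_def weight_B_def)

context
  fixes p :: "('a::countable \<times> 'b::countable) pmf" and \<pi> :: "('a, 'b, 'c::countable) protocol"
  assumes \<pi>: "protocol_for p \<pi>"
begin

lemma prob_space_seeds: "prob_space (seed_A \<pi>)" "prob_space (seed_B \<pi>)"
  using \<pi> by (auto simp: protocol_for_def)

lemma prob_space_run: "prob_space (run p \<pi>)"
proof -
  interpret A: prob_space "seed_A \<pi>" by (rule prob_space_seeds)
  interpret B: prob_space "seed_B \<pi>" by (rule prob_space_seeds)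
  interpret AB: pair_prob_space "seed_A \<pi>" "seed_B \<pi>" ..
  interpret P: prob_space "measure_pmf p" by (rule prob_space_measure_pmf)
  interpret R: pair_prob_space "measure_pmf p" "seed_A \<pi> \<Otimes>\<^sub>M seed_B \<pi>" ..
  show ?thesis unfolding run_def by unfold_locales
qed

lemma measurable_alice_msg: "(\<lambda>r. alice_msg \<pi> x r h) \<in> measurable (seed_A \<pi>) (count_space UNIV)"
  and measurable_bob_msg: "(\<lambda>s. bob_msg \<pi> y s h) \<in> measurable (seed_B \<pi>) (count_space UNIV)"
  and measurable_bob_output: "(\<lambda>s. bob_output \<pi> y s m) \<in> measurable (seed_B \<pi>) (count_space UNIV)"
  using \<pi> by (auto simp: protocol_for_def)

text \<open>A message is measurable in the seed for each fixed history, so the inductive step splits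
  over the countably many histories.\<close>

lemma measurable_history_upto:
  "(\<lambda>(r, s). history_upto \<pi> x y r s t) \<in> measurable (seed_A \<pi> \<Otimes>\<^sub>M seed_B \<pi>) (count_space UNIV)"
proof (induction t)
  case (Suc t)
  let ?S = "seed_A \<pi> \<Otimes>\<^sub>M seed_B \<pi>"
  define H where "H = (\<lambda>\<omega>. history_upto \<pi> x y (fst \<omega>) (snd \<omega>) t)"
  define F where "F = (\<lambda>h \<omega>. h @ [if alice_turn \<pi> h then alice_msg \<pi> x (fst \<omega>) h
    else bob_msg \<pi> y (snd \<omega>) h])"
  have H: "H \<in> measurable ?S (count_space UNIV)"
    using Suc.IH by (simp add: H_def case_prod_beta')
  have A: "(\<lambda>\<omega>. h @ [alice_msg \<pi> x (fst \<omega>) h]) \<in> measurable ?S (count_space UNIV)" for h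
    by (rule measurable_compose[OF measurable_compose[OF measurable_fst measurable_alice_msg[of x h]],
          of "\<lambda>m. h @ [m]" "count_space UNIV"]) simp
  have B: "(\<lambda>\<omega>. h @ [bob_msg \<pi> y (snd \<omega>) h]) \<in> measurable ?S (count_space UNIV)" for h
    by (rule measurable_compose[OF measurable_compose[OF measurable_snd measurable_bob_msg[of y h]],
          of "\<lambda>m. h @ [m]" "count_space UNIV"]) simp
  have F: "F h \<in> measurable ?S (count_space UNIV)" for h
    unfolding F_def using A[of h] B[of h] by (cases "alice_turn \<pi> h") simp_all
  have "(\<lambda>\<omega>. F (H \<omega>) \<omega>) \<in> measurable ?S (count_space UNIV)"
    by (rule measurable_compose_countable[OF F H])
  moreover have "(\<lambda>\<omega>. F (H \<omega>) \<omega>) = (\<lambda>(r, s). history_upto \<pi> x y r s (Suc t))"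
    by (auto simp: F_def H_def Let_def fun_eq_iff)
  ultimately show ?case by simp
next
  case 0
  have "(\<lambda>(r, s). history_upto \<pi> x y r s 0) = (\<lambda>_. [])" by auto
  then show ?case by simp
qed

lemma measurable_transcript:
  "(\<lambda>(r, s). transcript \<pi> x y r s) \<in> measurable (seed_A \<pi> \<Otimes>\<^sub>M seed_B \<pi>) (count_space UNIV)"
proof -
  let ?S = "seed_A \<pi> \<Otimes>\<^sub>M seed_B \<pi>"
  define H where "H = (\<lambda>t \<omega>. history_upto \<pi> x y (fst \<omega>) (snd \<omega>) t)"
  have H: "H t \<in> measurable ?S (count_space UNIV)" for t
    using measurable_history_upto[of x y t] by (simp add: H_def case_prod_beta')
  have L: "(\<lambda>\<omega>. LEAST t. halted \<pi> (H t \<omega>)) \<in> measurable ?S (count_space UNIV)"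
    by (rule measurable_Least) (rule measurable_compose[OF H], simp)
  have C: "(\<lambda>\<omega>. concat (H t \<omega>)) \<in> measurable ?S (count_space UNIV)" for t
    by (rule measurable_compose[OF H]) simp
  have "(\<lambda>\<omega>. concat (H (LEAST t. halted \<pi> (H t \<omega>)) \<omega>)) \<in> measurable ?S (count_space UNIV)"
    by (rule measurable_compose_countable[OF C L])
  moreover have "(\<lambda>\<omega>. concat (H (LEAST t. halted \<pi> (H t \<omega>)) \<omega>)) = (\<lambda>(r, s). transcript \<pi> x y r s)"
    by (auto simp: H_def transcript_def fun_eq_iff)
  ultimately show ?thesis by simp
qed

lemma measurable_inp: "(\<lambda>\<omega>. (inp_A \<omega>, inp_B \<omega>)) \<in> measurable (run p \<pi>) (count_space UNIV)"
  unfolding inp_A_def inp_B_def run_def by (rule measurable_compose[OF measurable_fst]) simp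

lemma measurable_rv_M: "rv_M \<pi> \<in> measurable (run p \<pi>) (count_space UNIV)"
proof -
  define F where "F = (\<lambda>xy (\<omega> :: ('a, 'b) outcome). transcript \<pi> (fst xy) (snd xy) (fst (snd \<omega>)) (snd (snd \<omega>)))"
  have F: "F xy \<in> measurable (run p \<pi>) (count_space UNIV)" for xy
    using measurable_compose[OF measurable_snd measurable_transcript[of "fst xy" "snd xy"]]
    by (simp add: F_def run_def case_prod_beta')
  have H: "fst \<in> measurable (run p \<pi>) (count_space UNIV)"
    unfolding run_def by (rule measurable_compose[OF measurable_fst]) simp
  have "(\<lambda>\<omega>. F (fst \<omega>) \<omega>) \<in> measurable (run p \<pi>) (count_space UNIV)"
    by (rule measurable_compose_countable[OF F H])
  then show ?thesis by (simp add: F_def rv_M_def case_prod_beta')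
qed

lemma measurable_snd_fst: "(\<lambda>\<omega>. snd (fst \<omega>)) \<in> measurable (run p \<pi>) (count_space UNIV)"
  unfolding run_def by (rule measurable_compose[OF measurable_fst]) simp

lemma measurable_rv_Z: "rv_Z \<pi> \<in> measurable (run p \<pi>) (count_space UNIV)"
proof -
  define F where "F = (\<lambda>m y (\<omega> :: ('a, 'b) outcome). bob_output \<pi> y (snd (snd \<omega>)) m)"
  have "F m y \<in> measurable (run p \<pi>) (count_space UNIV)" for y m
    unfolding run_def F_def
    by (rule measurable_compose[OF measurable_snd measurable_compose[OF measurable_snd measurable_bob_output]])
  then have "(\<lambda>\<omega>. F m (snd (fst \<omega>)) \<omega>) \<in> measurable (run p \<pi>) (count_space UNIV)" for m
    by (rule measurable_compose_countable[OF _ measurable_snd_fst])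
  then have "(\<lambda>\<omega>. F (rv_M \<pi> \<omega>) (snd (fst \<omega>)) \<omega>) \<in> measurable (run p \<pi>) (count_space UNIV)"
    by (rule measurable_compose_countable[OF _ measurable_rv_M])
  then show ?thesis by (simp add: F_def rv_Z_def rv_M_def case_prod_beta')
qed

lemma measurable_all:
  "(\<lambda>\<omega>. (inp_A \<omega>, inp_B \<omega>, rv_M \<pi> \<omega>, rv_Z \<pi> \<omega>)) \<in> measurable (run p \<pi>) (count_space UNIV)"
proof -
  define F where "F = (\<lambda>m z \<omega>. (inp_A \<omega> :: 'a, inp_B \<omega> :: 'b, m :: msg, z :: 'c))"
  have "F m z \<in> measurable (run p \<pi>) (count_space UNIV)" for m z
    using measurable_compose[OF measurable_inp, of "\<lambda>(x, y). (x, y, m, z)" "count_space UNIV"]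
    by (simp add: F_def)
  then have "(\<lambda>\<omega>. F m (rv_Z \<pi> \<omega>) \<omega>) \<in> measurable (run p \<pi>) (count_space UNIV)" for m
    by (rule measurable_compose_countable[OF _ measurable_rv_Z])
  then have "(\<lambda>\<omega>. F (rv_M \<pi> \<omega>) (rv_Z \<pi> \<omega>) \<omega>) \<in> measurable (run p \<pi>) (count_space UNIV)"
    by (rule measurable_compose_countable[OF _ measurable_rv_M])
  then show ?thesis by (simp add: F_def)
qed

lemma measure_pmf_law:
  "measure_pmf (law p \<pi>) = distr (run p \<pi>) (count_space UNIV)
     (\<lambda>\<omega>. (inp_A \<omega>, inp_B \<omega>, rv_M \<pi> \<omega>, rv_Z \<pi> \<omega>))"
  unfolding law_def
  by (rule measure_pmf_Abs_pmf[OF prob_space.prob_space_distr[OF prob_space_run measurable_all]]) simp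

lemma prob_run:
  "\<P>(\<omega> in run p \<pi>. P (inp_A \<omega>) (inp_B \<omega>) (rv_M \<pi> \<omega>) (rv_Z \<pi> \<omega>))
    = measure_pmf.prob (law p \<pi>) {(x, y, m, z). P x y m z}"
proof -
  have "measure_pmf.prob (law p \<pi>) {(x, y, m, z). P x y m z} =
    measure (run p \<pi>) ((\<lambda>\<omega>. (inp_A \<omega>, inp_B \<omega>, rv_M \<pi> \<omega>, rv_Z \<pi> \<omega>)) -` {(x, y, m, z). P x y m z} \<inter> space (run p \<pi>))"
    unfolding measure_pmf_law by (rule measure_distr[OF measurable_all]) simp
  also have "(\<lambda>\<omega>. (inp_A \<omega>, inp_B \<omega>, rv_M \<pi> \<omega>, rv_Z \<pi> \<omega>)) -` {(x, y, m, z). P x y m z} \<inter> space (run p \<pi>)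
    = {\<omega> \<in> space (run p \<pi>). P (inp_A \<omega>) (inp_B \<omega>) (rv_M \<pi> \<omega>) (rv_Z \<pi> \<omega>)}"
    by blast
  finally show ?thesis by (rule sym)
qed

lemma expected_length_eq:
  "expected_length p \<pi> = (\<integral>\<^sup>+ (x, y, m, z). of_nat (length m) \<partial>law p \<pi>)"
proof -
  have "(\<integral>\<^sup>+ \<omega>. (\<lambda>(x, y, m, z). of_nat (length m)) \<omega> \<partial>law p \<pi>) =
      (\<integral>\<^sup>+ \<omega>. (\<lambda>(x, y, m, z). of_nat (length m)) (inp_A \<omega>, inp_B \<omega>, rv_M \<pi> \<omega>, rv_Z \<pi> \<omega>) \<partial>run p \<pi>)"
    unfolding measure_pmf_law by (rule nn_integral_distr[OF measurable_all]) simp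
  then show ?thesis unfolding expected_length_def prod.case by (rule sym)
qed

lemma sets_Collect_eq_const:
  assumes "f \<in> measurable M (count_space UNIV)"
  shows "{r \<in> space M. f r = c} \<in> sets M"
proof -
  have "f -` {c} \<inter> space M \<in> sets M" by (rule measurable_sets[OF assms]) simp
  also have "f -` {c} \<inter> space M = {r \<in> space M. f r = c}" by auto
  finally show ?thesis .
qed

lemma sets_follows:
  "{r \<in> space (seed_A \<pi>). follows_A \<pi> x r h} \<in> sets (seed_A \<pi>)"
  "{s \<in> space (seed_B \<pi>). follows_B \<pi> y s h \<and> bob_output \<pi> y s m = z} \<in> sets (seed_B \<pi>)"
proof -
  have "{r \<in> space (seed_A \<pi>). \<forall>t. t < length h \<longrightarrow> alice_turn \<pi> (take t h) \<longrightarrow>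
      alice_msg \<pi> x r (take t h) = h ! t} \<in> sets (seed_A \<pi>)"
    by (rule sets.sets_Collect_countable_All, rule sets.sets_Collect_imp, rule sets.sets_Collect_imp,
      rule sets_Collect_eq_const, rule measurable_alice_msg) simp_all
  then show "{r \<in> space (seed_A \<pi>). follows_A \<pi> x r h} \<in> sets (seed_A \<pi>)"
    by (simp only: follows_A_def)
  have "{s \<in> space (seed_B \<pi>). \<forall>t. t < length h \<longrightarrow> \<not> alice_turn \<pi> (take t h) \<longrightarrow>
      bob_msg \<pi> y s (take t h) = h ! t} \<in> sets (seed_B \<pi>)"
    by (rule sets.sets_Collect_countable_All, rule sets.sets_Collect_imp, rule sets.sets_Collect_imp,
      rule sets_Collect_eq_const, rule measurable_bob_msg) simp_all
  then have "{s \<in> space (seed_B \<pi>). follows_B \<pi> y s h} \<in> sets (seed_B \<pi>)"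
    by (simp only: follows_B_def)
  then show "{s \<in> space (seed_B \<pi>). follows_B \<pi> y s h \<and> bob_output \<pi> y s m = z} \<in> sets (seed_B \<pi>)"
    by (intro sets.sets_Collect_conj sets_Collect_eq_const measurable_bob_output)
qed

lemma pmf_law:
  "pmf (law p \<pi>) (x, y, m, z) = pmf p (x, y) * weight_A \<pi> x m * weight_B \<pi> y m z"
proof -
  interpret A: prob_space "seed_A \<pi>" by (rule prob_space_seeds)
  interpret B: prob_space "seed_B \<pi>" by (rule prob_space_seeds)
  interpret AB: pair_prob_space "seed_A \<pi>" "seed_B \<pi>" ..
  interpret P: prob_space "measure_pmf p" by (rule prob_space_measure_pmf)
  interpret R: pair_prob_space "measure_pmf p" "seed_A \<pi> \<Otimes>\<^sub>M seed_B \<pi>" ..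
  interpret run: prob_space "run p \<pi>" by (rule prob_space_run)
  define SA where "SA = {r \<in> space (seed_A \<pi>). m \<in> words \<pi> \<and> follows_A \<pi> x r (split_word \<pi> m)}"
  define SB where "SB = {s \<in> space (seed_B \<pi>). follows_B \<pi> y s (split_word \<pi> m) \<and> bob_output \<pi> y s m = z}"
  have SA: "SA \<in> sets (seed_A \<pi>)"
  proof (cases "m \<in> words \<pi>")
    case True
    then have "SA = {r \<in> space (seed_A \<pi>). follows_A \<pi> x r (split_word \<pi> m)}"
      by (auto simp: SA_def)
    then show ?thesis using sets_follows(1) by metis
  next
    case False
    then have "SA = {}" by (auto simp: SA_def)
    then show ?thesis by simp
  qed
  have SB: "SB \<in> sets (seed_B \<pi>)"
    unfolding SB_def by (rule sets_follows(2))
  have "AE ((x, y), (r, s)) in run p \<pi>. \<exists>t. halted \<pi> (history_upto \<pi> x y r s t)"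
    using \<pi> unfolding protocol_for_def by (elim conjE)
  \<comment> \<open>Runs that never halt form a null set. Off it the event is a rectangle, whose
    measure is a product because the inputs and the two seeds are independent.\<close>
  then have ae: "AE \<omega> in run p \<pi>. (inp_A \<omega> = x \<and> inp_B \<omega> = y \<and> rv_M \<pi> \<omega> = m \<and> rv_Z \<pi> \<omega> = z)
      \<longleftrightarrow> \<omega> \<in> {(x, y)} \<times> (SA \<times> SB)"
    using AE_space
  proof eventually_elim
    case (elim \<omega>)
    obtain x' y' r s where \<omega>: "\<omega> = ((x', y'), (r, s))" by (metis surj_pair)
    have sp: "r \<in> space (seed_A \<pi>)" "s \<in> space (seed_B \<pi>)"
      using elim(2) by (auto simp: \<omega> run_def space_pair_measure)
    have "\<exists>t. halted \<pi> (history_upto \<pi> x' y' r s t)" using elim(1) by (simp add: \<omega>)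
    from transcript_eq_iff[OF \<pi> sp this, of m] show ?case
      using sp by (auto simp: \<omega> inp_A_def inp_B_def rv_M_def rv_Z_def SA_def SB_def)
  qed
  have "pmf (law p \<pi>) (x, y, m, z) = \<P>(\<omega> in run p \<pi>. inp_A \<omega> = x \<and> inp_B \<omega> = y \<and> rv_M \<pi> \<omega> = m \<and> rv_Z \<pi> \<omega> = z)"
    by (subst prob_run) (auto simp: measure_pmf_single[symmetric] intro!: arg_cong[where f="measure _"])
  also have "\<dots> = measure (run p \<pi>) ({(x, y)} \<times> (SA \<times> SB))"
  proof (rule run.finite_measure_eq_AE)
    show "AE \<omega> in run p \<pi>. \<omega> \<in> {\<omega> \<in> space (run p \<pi>). inp_A \<omega> = x \<and> inp_B \<omega> = y \<and> rv_M \<pi> \<omega> = m \<and> rv_Z \<pi> \<omega> = z}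
        \<longleftrightarrow> \<omega> \<in> {(x, y)} \<times> (SA \<times> SB)"
      using ae AE_space by eventually_elim auto
    show "{\<omega> \<in> space (run p \<pi>). inp_A \<omega> = x \<and> inp_B \<omega> = y \<and> rv_M \<pi> \<omega> = m \<and> rv_Z \<pi> \<omega> = z} \<in> sets (run p \<pi>)"
      using measurable_sets[OF measurable_all, of "{(x, y, m, z)}"] by (auto simp: vimage_def Int_def conj_commute)
    show "{(x, y)} \<times> (SA \<times> SB) \<in> sets (run p \<pi>)"
      unfolding run_def using SA SB by (intro pair_measureI) auto
  qed
  also have "\<dots> = pmf p (x, y) * (measure (seed_A \<pi>) SA * measure (seed_B \<pi>) SB)"
    unfolding run_def measure_def using SA SB
    by (simp add: sigma_finite_measure.emeasure_pair_measure_Times[OF prob_space_imp_sigma_finite[OF prob_space_pair[OF prob_space_seeds]]]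
      sigma_finite_measure.emeasure_pair_measure_Times[OF prob_space_imp_sigma_finite[OF prob_space_seeds(2)]]
      enn2real_mult emeasure_pmf_single)
  finally show ?thesis
    by (simp add: weight_A_def weight_B_def SA_def SB_def)
qed

end

section \<open>Prefix-free codes\<close>

text \<open>Induction on the maximal length: removing the first bit splits a code without the empty
  word into two codes of shorter words, each counted with weight one half.\<close>

lemma kraft_finite:
  fixes C :: "msg set"
  assumes "prefix_free C" "finite C"
  shows "(\<Sum>c\<in>C. (1 / 2) ^ length c) \<le> (1 :: real)"
proof -
  have "\<forall>C :: msg set. prefix_free C \<longrightarrow> finite C \<longrightarrow> (\<forall>c\<in>C. length c \<le> N) \<longrightarrow>
      (\<Sum>c\<in>C. (1 / 2) ^ length c) \<le> (1 :: real)" for N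
  proof (induction N)
    case 0
    show ?case
    proof (intro allI impI)
      fix C :: "msg set" assume "\<forall>c\<in>C. length c \<le> 0" "finite C"
      then have "C \<subseteq> {[]}" by auto
      then have "C = {} \<or> C = {[]}" by (simp add: subset_singleton_iff)
      then show "(\<Sum>c\<in>C. (1 / 2) ^ length c) \<le> (1 :: real)" by auto
    qed
  next
    case (Suc N)
    show ?case
    proof (intro allI impI)
      fix C :: "msg set" assume C: "prefix_free C" "finite C" "\<forall>c\<in>C. length c \<le> Suc N"
      show "(\<Sum>c\<in>C. (1 / 2) ^ length c) \<le> (1 :: real)"
      proof (cases "[] \<in> C")
        case True
        have "c = []" if "c \<in> C" for c
          using C(1) True that Nil_prefix[of c] unfolding prefix_free_def by metis
        then have "C = {[]}" using True by blast
        then show ?thesis by simp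
      next
        case False
        define D where "D b = {c. b # c \<in> C}" for b
        have Ceq: "C = (#) True ` D True \<union> (#) False ` D False"
        proof (rule set_eqI)
          fix c show "c \<in> C \<longleftrightarrow> c \<in> (#) True ` D True \<union> (#) False ` D False"
            using False by (cases c; cases "hd c") (auto simp: D_def)
        qed
        have fin: "finite (D b)" for b
          using finite_vimageI[OF C(2), of "(#) b"] by (simp add: D_def vimage_def inj_on_def)
        have "(\<Sum>c\<in>D b. (1 / 2) ^ length c) \<le> (1 :: real)" for b
        proof -
          have "prefix_free (D b)"
            unfolding prefix_free_def
          proof (intro ballI impI)
            fix u v assume "u \<in> D b" "v \<in> D b" "prefix u v"
            then have "b # u \<in> C" "b # v \<in> C" "prefix (b # u) (b # v)" by (auto simp: D_def)
            then show "u = v" using C(1) unfolding prefix_free_def by (metis list.inject)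
          qed
          moreover have "\<forall>c\<in>D b. length c \<le> N" using C(3) by (auto simp: D_def)
          ultimately show ?thesis using Suc.IH fin by blast
        qed
        note le = this[of True] this[of False]
        have "(\<Sum>c\<in>C. (1 / 2) ^ length c) =
            (\<Sum>c\<in>(#) True ` D True. (1 / 2) ^ length c) + (\<Sum>c\<in>(#) False ` D False. (1 / 2) ^ length c :: real)"
          unfolding Ceq using fin by (intro sum.union_disjoint) auto
        also have "\<dots> = 1 / 2 * (\<Sum>c\<in>D True. (1 / 2) ^ length c) + 1 / 2 * (\<Sum>c\<in>D False. (1 / 2) ^ length c)"
          by (simp add: sum.reindex sum_distrib_left)
        finally show ?thesis using le by simp
      qed
    qed
  qed
  moreover have "\<forall>c\<in>C. length c \<le> Max (length ` C)" using assms(2) by simp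
  ultimately show ?thesis using assms by blast
qed

lemma card_msgs: "card {w :: msg. length w = n} = 2 ^ n"
  using card_lists_length_eq[of "UNIV :: bool set" n] by simp

lemma finite_msgs: "finite {w :: msg. length w = n}"
  using finite_lists_length_eq[of "UNIV :: bool set" n] by simp

text \<open>Greedy construction: in order of increasing length, the words that extend an already chosen
  codeword never exhaust all words of the required length.\<close>

lemma kraft_converse:
  fixes l :: "'i \<Rightarrow> nat"
  assumes "finite I" "(\<Sum>i\<in>I. (1 / 2) ^ l i) \<le> (1 :: real)"
  shows "\<exists>f :: 'i \<Rightarrow> msg. inj_on f I \<and> prefix_free (f ` I) \<and> (\<forall>i\<in>I. length (f i) = l i)"
  using assms
proof (induction "card I" arbitrary: I)
  case 0
  then show ?case by (auto simp: prefix_free_def)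
next
  case (Suc n)
  then have "I \<noteq> {}" by auto
  then have "Max (l ` I) \<in> l ` I" using Suc.prems(1) by (intro Max_in) simp_all
  then obtain i where "i \<in> I" "Max (l ` I) = l i" by (rule imageE) metis
  \<comment> \<open>An index of maximal length receives its word last: that word could extend an
    older one but cannot be a proper prefix of it.\<close>
  then have i: "i \<in> I" "\<And>j. j \<in> I \<Longrightarrow> l j \<le> l i"
    using Suc.prems(1) by (metis Max_ge finite_imageI imageI)+
  define J where "J = I - {i}"
  have J: "finite J" "I = insert i J" "i \<notin> J" using i Suc.prems(1) by (auto simp: J_def)
  have S: "(\<Sum>j\<in>J. (1 / 2) ^ l j) + (1 / 2) ^ l i \<le> (1 :: real)"
    using Suc.prems(2) J by (simp add: add.commute)
  have "(\<Sum>j\<in>J. (1 / 2) ^ l j) \<le> (1 :: real)"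
    using S zero_le_power[of "1/2 :: real" "l i"] by linarith
  moreover have "n = card J" using Suc.hyps(2) J by simp
  ultimately obtain f :: "'i \<Rightarrow> msg"
    where f: "inj_on f J" "prefix_free (f ` J)" "\<And>j. j \<in> J \<Longrightarrow> length (f j) = l j"
    using Suc.hyps(1) J(1) by blast
  \<comment> \<open>The words of the new length that are blocked by an older codeword. The Kraft sum
    over \<open>J\<close> leaves room for one more, so they are fewer than all words of that
    length.\<close>
  define B where "B = (\<Union>j\<in>J. (\<lambda>w. f j @ w) ` {w. length w = l i - l j})"
  have "card B \<le> (\<Sum>j\<in>J. card ((\<lambda>w. f j @ w) ` {w. length w = l i - l j}))"
    unfolding B_def by (rule card_UN_le[OF J(1)])
  also have "\<dots> = (\<Sum>j\<in>J. 2 ^ (l i - l j))"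
    by (intro sum.cong refl) (subst card_image, auto simp: card_msgs inj_on_def)
  finally have "real (card B) \<le> (\<Sum>j\<in>J. 2 ^ (l i - l j))"
    by (metis (mono_tags, lifting) of_nat_le_iff of_nat_numeral of_nat_power of_nat_sum sum.cong)
  also have "\<dots> = 2 ^ l i * (\<Sum>j\<in>J. (1 / 2) ^ l j)"
    unfolding sum_distrib_left
    by (intro sum.cong refl) (use i J in \<open>auto simp: power_diff power_one_over field_simps\<close>)
  also have "\<dots> \<le> 2 ^ l i * (1 - (1 / 2) ^ l i)"
    using S by (intro mult_left_mono) auto
  also have "\<dots> < 2 ^ l i" by (simp add: right_diff_distrib power_one_over)
  finally have "card B < card {w :: msg. length w = l i}"
    by (simp add: card_msgs)
  then have "\<not> {w :: msg. length w = l i} \<subseteq> B"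
    using card_mono[of B "{w. length w = l i}"] J(1) finite_msgs by (auto simp: B_def)
  then obtain w where w: "length w = l i" "w \<notin> B" by auto
  have np: "\<not> prefix (f j) w \<and> \<not> prefix w (f j)" if "j \<in> J" for j
  proof -
    have 1: "\<not> prefix (f j) w"
    proof
      assume "prefix (f j) w"
      then obtain v where v: "w = f j @ v" by (auto simp: prefix_def)
      then have "v \<in> {w. length w = l i - l j}" using w(1) f(3)[OF that] by auto
      then have "w \<in> B" using that unfolding B_def v by blast
      then show False using w by simp
    qed
    have "\<not> prefix w (f j)"
    proof
      assume *: "prefix w (f j)"
      then have "length w \<le> length (f j)" by (rule prefix_length_le)
      then have "length w = length (f j)" using w f(3)[OF that] i(2)[of j] that J by auto
      then have "w = f j" using * by (auto simp: prefix_def)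
      then show False using 1 by simp
    qed
    then show ?thesis using 1 by simp
  qed
  define g where "g = f(i := w)"
  have g: "g i = w" "\<And>j. j \<in> J \<Longrightarrow> g j = f j" using J by (auto simp: g_def)
  have "inj_on g I"
    unfolding J(2) using f(1) np J(3) by (auto simp: inj_on_def g)
  moreover have "prefix_free (g ` I)"
    using f(2) np unfolding J(2) prefix_free_def by (auto simp: g)
  moreover have "\<forall>j\<in>I. length (g j) = l j"
    unfolding J(2) using f(3) w(1) by (auto simp: g)
  ultimately show ?case by blast
qed

section \<open>Entropy of finitely supported random variables\<close>

lemma information_space_pmf: "information_space (measure_pmf q) 2"
  unfolding information_space_def information_space_axioms_def
  by (simp add: prob_space_measure_pmf)

lemma gibbs:
  assumes int: "integrable (measure_pmf q) g"
    and le: "(\<integral>\<^sup>+ x. ennreal (exp (g x)) \<partial>measure_pmf q) \<le> 1"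
  shows "measure_pmf.expectation q g \<le> 0"
proof -
  have int_e: "integrable (measure_pmf q) (\<lambda>x. exp (g x))"
    by (rule integrableI_bounded) (use le in \<open>auto simp: le_less_trans\<close>)
  have "ennreal (measure_pmf.expectation q (\<lambda>x. exp (g x))) \<le> 1"
    using le int_e by (subst nn_integral_eq_integral[symmetric]) auto
  then have e1: "measure_pmf.expectation q (\<lambda>x. exp (g x)) \<le> 1"
    by simp
  have "measure_pmf.expectation q g \<le> measure_pmf.expectation q (\<lambda>x. exp (g x) - 1)"
    using int int_e by (intro integral_mono) (auto simp: exp_ge_add_one_self le_diff_eq add.commute)
  also have "\<dots> \<le> 0" using int_e e1 by simp
  finally show ?thesis .
qed

lemma entropy_pmf:
  fixes c :: "'v \<Rightarrow> 'w::countable"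
  assumes "finite (set_pmf q)"
  shows "prob_space.entropy (measure_pmf q) 2 (count_space UNIV) c =
    (\<Sum>k\<in>c ` set_pmf q. - (pmf (map_pmf c q) k * log 2 (pmf (map_pmf c q) k)))"
proof -
  interpret information_space "measure_pmf q" 2 by (rule information_space_pmf)
  have "distributed (measure_pmf q) (count_space UNIV) c (\<lambda>k. ennreal (pmf (map_pmf c q) k))"
    unfolding distributed_def
  proof (intro conjI)
    show "distr (measure_pmf q) (count_space UNIV) c = density (count_space UNIV) (\<lambda>k. ennreal (pmf (map_pmf c q) k))"
      using measure_pmf_eq_density[of "map_pmf c q"] by (simp add: map_pmf_rep_eq)
  qed auto
  then have "prob_space.entropy (measure_pmf q) 2 (count_space UNIV) c =
      - (\<integral>k. pmf (map_pmf c q) k * log 2 (pmf (map_pmf c q) k) \<partial>count_space UNIV)"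
    by (rule entropy_distr) simp
  also have "(\<integral>k. pmf (map_pmf c q) k * log 2 (pmf (map_pmf c q) k) \<partial>count_space UNIV) =
      (\<Sum>k\<in>c ` set_pmf q. pmf (map_pmf c q) k * log 2 (pmf (map_pmf c q) k))"
    using assms by (subst lebesgue_integral_count_space_finite_support)
      (auto simp: pmf_eq_0_set_pmf intro!: sum.mono_neutral_left elim: finite_subset[rotated])
  finally show ?thesis by (simp add: sum_negf)
qed

lemma expectation_finite:
  assumes "finite (set_pmf q)"
  shows "measure_pmf.expectation q h = (\<Sum>v\<in>set_pmf q. pmf q v * (h v :: real))"
  using assms by (subst integral_measure_pmf_real[of "set_pmf q"]) (auto simp: mult.commute)

lemma entropy_pmf':
  fixes c :: "'v \<Rightarrow> 'w::countable"
  assumes "finite (set_pmf q)"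
  shows "prob_space.entropy (measure_pmf q) 2 (count_space UNIV) c =
    (\<Sum>v\<in>set_pmf q. pmf q v * - log 2 (pmf (map_pmf c q) (c v)))"
proof -
  let ?h = "\<lambda>k. - log 2 (pmf (map_pmf c q) k)"
  have "(\<Sum>v\<in>set_pmf q. pmf q v * ?h (c v)) = measure_pmf.expectation (map_pmf c q) ?h"
    using assms by (simp add: expectation_finite sum_negf)
  also have "\<dots> = (\<Sum>k\<in>c ` set_pmf q. pmf (map_pmf c q) k * ?h k)"
    using assms by (subst expectation_finite) auto
  finally show ?thesis using assms by (simp add: entropy_pmf sum_negf)
qed

text \<open>Expected length minus entropy is the relative entropy of the law of the word with
  respect to the sub-probability \<open>(1 / 2) ^ length w\<close>; it is nonnegative by
  \<open>ln t \<le> t - 1\<close> and Kraft's inequality. The numbering by \<open>to_nat\<close>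
  only makes the words colours.\<close>

lemma kraft_entropy_le:
  fixes f :: "'v \<Rightarrow> msg"
  assumes fin: "finite (set_pmf q)" and pf: "prefix_free (f ` set_pmf q)"
  shows "prob_space.entropy (measure_pmf q) 2 (count_space UNIV) (\<lambda>v. to_nat (f v))
    \<le> (\<Sum>v\<in>set_pmf q. pmf q v * real (length (f v)))"
proof -
  define P where "P = map_pmf f q"
  have finP: "finite (set_pmf P)" using fin by (simp add: P_def)
  have eq: "pmf (map_pmf (\<lambda>v. to_nat (f v)) q) (to_nat (f v)) = pmf P (f v)" for v
    using pmf_map_inj'[of to_nat P "f v"] by (simp add: P_def pmf.map_comp o_def)
  have pt: "pmf P w * (- log 2 (pmf P w) - real (length w)) \<le> ((1 / 2) ^ length w - pmf P w) / ln 2"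
    if "w \<in> set_pmf P" for w
  proof -
    have pos: "pmf P w > 0" using that by (simp add: pmf_positive)
    have "- log 2 (pmf P w) - real (length w) = ln ((1 / 2) ^ length w / pmf P w) / ln 2"
      using pos by (simp add: log_def ln_div ln_mult ln_realpow field_simps)
    also have "\<dots> \<le> ((1 / 2) ^ length w / pmf P w - 1) / ln 2"
      using pos by (intro divide_right_mono ln_le_minus_one) auto
    finally show ?thesis using pos by (simp add: field_simps)
  qed
  have "(\<Sum>v\<in>set_pmf q. pmf q v * - log 2 (pmf P (f v))) - (\<Sum>v\<in>set_pmf q. pmf q v * real (length (f v)))
      = measure_pmf.expectation q (\<lambda>v. - log 2 (pmf P (f v)) - real (length (f v)))"
    using fin by (simp add: expectation_finite sum_subtractf[symmetric] algebra_simps)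
  also have "\<dots> = measure_pmf.expectation P (\<lambda>w. - log 2 (pmf P w) - real (length w))"
    by (simp add: P_def)
  also have "\<dots> = (\<Sum>w\<in>set_pmf P. pmf P w * (- log 2 (pmf P w) - real (length w)))"
    using finP by (rule expectation_finite)
  also have "\<dots> \<le> (\<Sum>w\<in>set_pmf P. ((1 / 2) ^ length w - pmf P w) / ln 2)"
    by (intro sum_mono pt)
  also have "\<dots> = ((\<Sum>w\<in>set_pmf P. (1 / 2) ^ length w) - 1) / ln 2"
    using finP by (simp add: sum_divide_distrib[symmetric] sum_subtractf sum_pmf_eq_1)
  also have "\<dots> \<le> 0"
    using kraft_finite[OF pf] fin by (intro divide_nonpos_pos) (auto simp: P_def)
  finally show ?thesis
    using fin by (simp add: entropy_pmf' eq)
qed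

lemma shannon_code:
  fixes c :: "'v \<Rightarrow> nat"
  assumes fin: "finite (set_pmf q)"
  shows "\<exists>f :: nat \<Rightarrow> msg. inj_on f (c ` set_pmf q) \<and> prefix_free (f ` c ` set_pmf q) \<and>
    (\<Sum>v\<in>set_pmf q. pmf q v * real (length (f (c v))))
      < prob_space.entropy (measure_pmf q) 2 (count_space UNIV) c + 1"
proof -
  define P where "P = map_pmf c q"
  have finP: "finite (set_pmf P)" and setP: "set_pmf P = c ` set_pmf q" using fin by (auto simp: P_def)
  \<comment> \<open>Shannon's lengths: rounding up satisfies Kraft's inequality and costs strictly
    less than one bit for each symbol, whence the strict inequality.\<close>
  define l where "l k = nat \<lceil>- log 2 (pmf P k)\<rceil>" for k
  have l: "(1 / 2) ^ l k \<le> pmf P k" "real (l k) < - log 2 (pmf P k) + 1" if "k \<in> set_pmf P" for k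
  proof -
    have pos: "pmf P k > 0" using that by (simp add: pmf_positive)
    have nn: "- log 2 (pmf P k) \<ge> 0" using pos pmf_le_1[of P k] by simp
    have lk: "real (l k) = of_int \<lceil>- log 2 (pmf P k)\<rceil>" using nn by (simp add: l_def)
    have "(1 / 2) ^ l k = 2 powr (- real (l k))"
      by (simp add: powr_minus powr_realpow power_one_over inverse_eq_divide)
    also have "\<dots> \<le> 2 powr (log 2 (pmf P k))"
      using lk by (intro powr_mono) (auto, linarith)
    finally show "(1 / 2) ^ l k \<le> pmf P k" using pos by simp
    show "real (l k) < - log 2 (pmf P k) + 1" unfolding lk by linarith
  qed
  have "(\<Sum>k\<in>set_pmf P. (1 / 2) ^ l k) \<le> (\<Sum>k\<in>set_pmf P. pmf P k)"
    by (intro sum_mono l)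
  also have "\<dots> = 1" using finP by (simp add: sum_pmf_eq_1)
  finally obtain f :: "nat \<Rightarrow> msg" where f: "inj_on f (set_pmf P)" "prefix_free (f ` set_pmf P)"
      "\<forall>k\<in>set_pmf P. length (f k) = l k"
    using kraft_converse[OF finP] by blast
  have "(\<Sum>v\<in>set_pmf q. pmf q v * real (length (f (c v)))) < (\<Sum>v\<in>set_pmf q. pmf q v * (- log 2 (pmf P (c v)) + 1))"
  proof (rule sum_strict_mono[OF fin set_pmf_not_empty])
    fix v assume v: "v \<in> set_pmf q"
    then have "c v \<in> set_pmf P" by (simp add: setP)
    then show "pmf q v * real (length (f (c v))) < pmf q v * (- log 2 (pmf P (c v)) + 1)"
      using l(2)[of "c v"] f(3) v by (intro mult_strict_left_mono) (auto simp: pmf_positive)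
  qed
  also have "\<dots> = prob_space.entropy (measure_pmf q) 2 (count_space UNIV) c + 1"
    using fin by (simp add: entropy_pmf' distrib_left right_diff_distrib sum.distrib sum_subtractf sum_negf sum_pmf_eq_1 P_def)
  finally show ?thesis using f setP by metis
qed

lemma chromatic_entropy_attained:
  assumes fin: "finite (set_pmf q)" and irr: "\<And>v. \<not> E v v" and V: "finite V"
  shows "\<exists>c. proper_coloring V E c \<and>
      chromatic_entropy V E q = prob_space.entropy (measure_pmf q) 2 (count_space UNIV) c"
    and "proper_coloring V E c \<Longrightarrow>
      chromatic_entropy V E q \<le> prob_space.entropy (measure_pmf q) 2 (count_space UNIV) c"
proof -
  let ?S = "set_pmf q"
  let ?H = "prob_space.entropy (measure_pmf q) 2 (count_space UNIV)"
  \<comment> \<open>The entropy of a colouring depends only on which pairs in the support share a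
    colour. There are finitely many such relations, so the infimum is a minimum.\<close>
  define F where "F R = (\<Sum>v\<in>?S. pmf q v * - log 2 (measure_pmf.prob q {u. (u, v) \<in> R}))" for R
  have "?H c = F {(u, v) \<in> ?S \<times> ?S. c u = c v}" for c :: "'a \<Rightarrow> nat"
  proof -
    have "pmf (map_pmf c q) (c v) = measure_pmf.prob q {u. (u, v) \<in> {(u, v) \<in> ?S \<times> ?S. c u = c v}}"
      if "v \<in> ?S" for v
    proof -
      have "pmf (map_pmf c q) (c v) = measure_pmf.prob q ({u. c u = c v} \<inter> ?S)"
        by (simp add: pmf_map measure_Int_set_pmf vimage_def)
      also have "{u. c u = c v} \<inter> ?S = {u. (u, v) \<in> {(u, v) \<in> ?S \<times> ?S. c u = c v}}"
        using that by auto
      finally show ?thesis .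
    qed
    then show ?thesis unfolding entropy_pmf'[OF fin] F_def by (intro sum.cong) auto
  qed
  then have "{?H c | c. proper_coloring V E c} \<subseteq> F ` Pow (?S \<times> ?S)" by auto
  then have finH: "finite {?H c | c. proper_coloring V E c}"
    by (rule finite_subset) (use fin in auto)
  obtain g :: "'a \<Rightarrow> nat" where "inj_on g V"
    using finite_imp_inj_to_nat_seg[OF V] by blast
  then have "proper_coloring V E g"
    using irr by (auto simp: proper_coloring_def inj_on_def)
  then have ne: "{?H c | c. proper_coloring V E c} \<noteq> {}" by auto
  have "chromatic_entropy V E q = Min {?H c | c. proper_coloring V E c}"
    unfolding chromatic_entropy_def using finH ne by (simp add: cInf_eq_Min)
  with Min_in[OF finH ne] show "\<exists>c. proper_coloring V E c \<and> chromatic_entropy V E q = ?H c"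
    by auto
  show "chromatic_entropy V E q \<le> ?H c" if "proper_coloring V E c" for c
    unfolding chromatic_entropy_def using finH that
    by (intro cInf_lower bdd_below_finite) auto
qed

section \<open>One-message protocols\<close>

text \<open>Bob's seed has to be a real number, yet his output must have law \<open>Q y m\<close>
  for every pair \<open>(y, m)\<close> that can occur. The seed therefore encodes a whole table of
  independent samples, of which he reads one entry.\<close>

lemma ex_one_shot:
  fixes p :: "('a::countable \<times> 'b::countable) pmf" and f :: "'a \<Rightarrow> msg" and Q :: "'b \<Rightarrow> msg \<Rightarrow> 'c::countable pmf"
  assumes pf: "prefix_free C" and finC: "finite C" and fC: "\<And>x. f x \<in> C" and finp: "finite (set_pmf p)"
  shows "\<exists>\<pi>. protocol_for p \<pi> \<and> (\<forall>y s m. bob_output \<pi> y s m \<in> insert d (set_pmf (Q y m))) \<and>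
    law p \<pi> = bind_pmf p (\<lambda>(x, y). map_pmf (\<lambda>z. (x, y, f x, z)) (Q y (f x)))"
proof -
  \<comment> \<open>Only the \<open>y\<close> in the support are tabulated, which keeps the index
    set finite; elsewhere the table has the default \<open>d\<close>.\<close>
  define I where "I = snd ` set_pmf p \<times> C"
  have finI: "finite I" using finp finC by (simp add: I_def)
  define D where "D = Pi_pmf I d (\<lambda>(y, m). Q y m)"
  \<comment> \<open>\<open>from_nat_into\<close> returns an element of the support for every real
    seed, so that the claim about the outputs holds surely and not just almost surely.\<close>
  define e where "e n = from_nat_into (set_pmf D) (nat \<lfloor>n :: real\<rfloor>)" for n
  have cD: "countable (set_pmf D)" by simp
  have e: "e (real (to_nat_on (set_pmf D) g)) = g" if "g \<in> set_pmf D" for g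
    using that cD by (simp add: e_def)
  define S where "S = map_pmf (\<lambda>g. real (to_nat_on (set_pmf D) g)) D"
  have eS: "map_pmf e S = D"
  proof -
    have "map_pmf e S = map_pmf (\<lambda>g. e (real (to_nat_on (set_pmf D) g))) D"
      by (simp add: S_def pmf.map_comp o_def)
    also have "\<dots> = map_pmf (\<lambda>g. g) D" by (intro map_pmf_cong refl e)
    finally show ?thesis by simp
  qed
  define \<pi> :: "('a, 'b, 'c) protocol" where
    "\<pi> = \<lparr>seed_A = measure_pmf (return_pmf 0), seed_B = measure_pmf S, alice_turn = (\<lambda>_. True),
      halted = (\<lambda>h. h \<noteq> []), codebook = (\<lambda>_. C), alice_msg = (\<lambda>x r h. f x),
      bob_msg = (\<lambda>y s h. []), bob_output = (\<lambda>y s m. e s (y, m))\<rparr>"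
  have halt: "halted \<pi> (history_upto \<pi> x y r s (Suc 0))" for x y r s
    by (simp add: \<pi>_def Let_def)
  have ae: "AE ((x, y), (r, s)) in run p \<pi>. \<exists>t. halted \<pi> (history_upto \<pi> x y r s t)"
    by (intro AE_I2) (auto split: prod.splits intro!: exI[of _ "Suc 0"] halt)
  have prot: "protocol_for p \<pi>"
    unfolding protocol_for_def using pf fC
    by (intro conjI ae) (auto simp: \<pi>_def prob_space_measure_pmf)
  have out: "bob_output \<pi> y s m \<in> insert d (set_pmf (Q y m))" for y s m
  proof -
    have "e s \<in> set_pmf D" unfolding e_def by (rule from_nat_into) (rule set_pmf_not_empty)
    then have es: "e s \<in> PiE_dflt I d (set_pmf \<circ> (\<lambda>(y, m). Q y m))"
      by (simp only: D_def set_Pi_pmf[OF finI])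
    have "e s (y, m) \<in> insert d (set_pmf (Q y m))"
    proof (cases "(y, m) \<in> I")
      case True
      then show ?thesis using es unfolding PiE_dflt_def by fastforce
    next
      case False
      then show ?thesis using es unfolding PiE_dflt_def by simp
    qed
    then show ?thesis by (simp add: \<pi>_def)
  qed
  have complete: "complete \<pi> h \<longleftrightarrow> (\<exists>m\<in>C. h = [m])" for h
  proof
    assume h: "complete \<pi> h"
    then have "h \<noteq> []" by (simp add: complete_def \<pi>_def)
    then obtain m h' where hm: "h = m # h'" by (cases h) auto
    have "h' = []"
    proof (rule ccontr)
      assume "h' \<noteq> []"
      then have "\<not> halted \<pi> (take 1 h)" using h unfolding complete_def hm by force
      then show False by (simp add: \<pi>_def hm)
    qed
    moreover have "m \<in> C" using h unfolding complete_def hm by (auto simp: \<pi>_def)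
    ultimately show "\<exists>m\<in>C. h = [m]" using hm by simp
  next
    assume "\<exists>m\<in>C. h = [m]"
    then show "complete \<pi> h" by (auto simp: complete_def \<pi>_def)
  qed
  have "{h. complete \<pi> h} = (\<lambda>m. [m]) ` C" using complete by auto
  then have words: "words \<pi> = C" by (simp add: words_def image_image)
  have split: "split_word \<pi> m = [m]" if "m \<in> C" for m
    using the_inv_into_f_f[OF inj_on_concat_complete[OF prot], of "[m]"] that complete[of "[m]"]
    by (simp add: split_word_def)
  have wA: "weight_A \<pi> x m = of_bool (m = f x)" for x m
  proof -
    have "seed_A \<pi> = measure_pmf (return_pmf 0)" "follows_A \<pi> x r [m] \<longleftrightarrow> f x = m" for r
      by (simp_all add: follows_A_def \<pi>_def)
    then show ?thesis using fC[of x] split[of m] by (auto simp: weight_A_def words)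
  qed
  have wB: "weight_B \<pi> y m z = pmf (Q y m) z" if "(y, m) \<in> I" for y m z
  proof -
    have "m \<in> C" using that by (simp add: I_def)
    then have "weight_B \<pi> y m z = measure_pmf.prob S {s. e s (y, m) = z}"
      unfolding weight_B_def split[OF \<open>m \<in> C\<close>] by (simp add: \<pi>_def follows_B_def)
    also have "\<dots> = pmf (map_pmf (\<lambda>s. e s (y, m)) S) z"
      by (simp add: pmf_map vimage_def)
    also have "map_pmf (\<lambda>s. e s (y, m)) S = map_pmf (\<lambda>g. g (y, m)) (map_pmf e S)"
      by (simp add: pmf.map_comp o_def)
    also have "\<dots> = Q y m"
      using Pi_pmf_component[OF finI, of "(y, m)" d "\<lambda>(y, m). Q y m"] that by (simp add: eS D_def)
    finally show ?thesis .
  qed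
  have "pmf (law p \<pi>) (x, y, m, z) =
      pmf (bind_pmf p (\<lambda>(x, y). map_pmf (\<lambda>z. (x, y, f x, z)) (Q y (f x)))) (x, y, m, z)" for x y m z
  proof -
    have inner: "pmf (map_pmf (\<lambda>z. (x', y', f x', z)) (Q y' (f x'))) (x, y, m, z) =
      indicator {(x, y)} (x', y') * (of_bool (m = f x) * pmf (Q y (f x)) z)" for x' y'
    proof (cases "x' = x \<and> y' = y \<and> m = f x")
      case True
      have "inj (\<lambda>z. (x, y, f x, z))" by (simp add: inj_def)
      from pmf_map_inj'[OF this, of "Q y (f x)" z] show ?thesis using True by simp
    next
      case False
      then have "(x, y, m, z) \<notin> (\<lambda>z. (x', y', f x', z)) ` set_pmf (Q y' (f x'))" by auto
      then have "pmf (map_pmf (\<lambda>z. (x', y', f x', z)) (Q y' (f x'))) (x, y, m, z) = 0"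
        by (simp add: pmf_eq_0_set_pmf)
      then show ?thesis using False by (auto simp: indicator_def)
    qed
    have "pmf (bind_pmf p (\<lambda>(x, y). map_pmf (\<lambda>z. (x, y, f x, z)) (Q y (f x)))) (x, y, m, z)
      = pmf p (x, y) * (of_bool (m = f x) * pmf (Q y (f x)) z)"
      unfolding pmf_bind by (simp add: case_prod_beta inner measure_pmf_single)
    moreover have "pmf p (x, y) * weight_A \<pi> x m * weight_B \<pi> y m z
      = pmf p (x, y) * (of_bool (m = f x) * pmf (Q y (f x)) z)"
    proof (cases "(x, y) \<in> set_pmf p")
      case True
      then have "(y, f x) \<in> I" using fC[of x] imageI[OF True, of snd] by (simp add: I_def)
      then show ?thesis using wB[of y "f x" z] by (simp add: wA)
    qed (simp add: pmf_eq_0_set_pmf)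
    ultimately show ?thesis by (simp add: pmf_law[OF prot])
  qed
  then have "law p \<pi> = bind_pmf p (\<lambda>(x, y). map_pmf (\<lambda>z. (x, y, f x, z)) (Q y (f x)))"
    by (intro pmf_eqI) (simp only: split_paired_all)
  then show ?thesis using prot out by (intro exI[of _ \<pi>] conjI allI)
qed

lemma prob_one_shot:
  assumes law: "L = bind_pmf p (\<lambda>(x, y). map_pmf (\<lambda>z. (x, y, f x, z)) (Q y (f x)))"
  shows "measure_pmf.prob L {(x, y, m, z). P x y m z} = measure_pmf.prob L {(x, y, m, z). P x y (f x) z}"
proof -
  have sub: "m = f x" if "(x, y, m, z) \<in> set_pmf L" for x y m z using that by (auto simp: law)
  have eq: "{(x, y, m, z). P x y m z} \<inter> set_pmf L = {(x, y, m, z). P x y (f x) z} \<inter> set_pmf L"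
    (is "?A \<inter> _ = ?B \<inter> _")
  proof (rule set_eqI, unfold split_paired_all)
    fix x y m z
    show "(x, y, m, z) \<in> ?A \<inter> set_pmf L \<longleftrightarrow> (x, y, m, z) \<in> ?B \<inter> set_pmf L"
      using sub[of x y m z] by (cases "(x, y, m, z) \<in> set_pmf L") simp_all
  qed
  show ?thesis
    using measure_Int_set_pmf[of L ?A] measure_Int_set_pmf[of L ?B] unfolding eq by simp
qed

section \<open>Security conditions in terms of the joint law\<close>

lemma measure_inputs:
  assumes "map_pmf (\<lambda>(x, y, m, z). (x, y)) L = p"
  shows "measure_pmf.prob L {(x, y, m, z). x = a \<and> y = b} = pmf p (a, b)"
proof -
  have "(\<lambda>(x, y, m, z). (x, y)) -` {(a, b)} = {(x, y, m, z). x = a \<and> y = b}" by auto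
  note eq = this
  show ?thesis using pmf_map[of "\<lambda>(x, y, m, z). (x, y)" L "(a, b)", unfolded eq assms] by (rule sym)
qed

lemma map_law_inputs:
  fixes p :: "('a::countable \<times> 'b::countable) pmf" and \<pi> :: "('a, 'b, 'c::countable) protocol"
  assumes \<pi>: "protocol_for p \<pi>"
  shows "map_pmf (\<lambda>(x, y, m, z). (x, y)) (law p \<pi>) = p"
proof -
  interpret A: prob_space "seed_A \<pi>" by (rule prob_space_seeds[OF \<pi>])
  interpret B: prob_space "seed_B \<pi>" by (rule prob_space_seeds[OF \<pi>])
  interpret AB: prob_space "seed_A \<pi> \<Otimes>\<^sub>M seed_B \<pi>"
    by (rule prob_space_pair[OF prob_space_seeds[OF \<pi>]])
  have "measure_pmf (map_pmf (\<lambda>(x, y, m, z). (x, y)) (law p \<pi>)) =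
      distr (run p \<pi>) (count_space UNIV) (\<lambda>\<omega>. (inp_A \<omega>, inp_B \<omega>))"
    unfolding map_pmf_rep_eq measure_pmf_law[OF \<pi>]
    by (subst distr_distr[OF _ measurable_all[OF \<pi>]]) (auto simp: o_def)
  also have "\<dots> = distr (run p \<pi>) (measure_pmf p) fst"
    by (intro distr_cong) (auto simp: inp_A_def inp_B_def)
  also have "\<dots> = measure_pmf p"
  proof (rule measure_eqI)
    fix A assume "A \<in> sets (distr (run p \<pi>) (measure_pmf p) fst)"
    have "emeasure (distr (run p \<pi>) (measure_pmf p) fst) A
        = emeasure (run p \<pi>) (A \<times> space (seed_A \<pi> \<Otimes>\<^sub>M seed_B \<pi>))"
      unfolding run_def
      by (subst emeasure_distr) (auto simp: space_pair_measure intro!: arg_cong[where f="emeasure _"])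
    also have "\<dots> = emeasure (measure_pmf p) A"
      unfolding run_def by (subst AB.emeasure_pair_measure_Times) (auto simp: AB.emeasure_space_1)
    finally show "emeasure (distr (run p \<pi>) (measure_pmf p) fst) A = emeasure (measure_pmf p) A" .
  qed simp
  finally show ?thesis by (simp add: measure_pmf_inject)
qed

context
  fixes p :: "('a::countable \<times> 'b::countable) pmf" and \<pi> :: "('a, 'b, 'c::countable) protocol"
  assumes \<pi>: "protocol_for p \<pi>"
begin

lemma output_prob_eq:
  "output_prob p \<pi> x y z = measure_pmf.prob (law p \<pi>) {(x', y', m, z'). x' = x \<and> y' = y \<and> z' = z} / pmf p (x, y)"
proof -
  have "\<P>(\<omega> in run p \<pi>. rv_Z \<pi> \<omega> = z \<and> inp_A \<omega> = x \<and> inp_B \<omega> = y) =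
      measure_pmf.prob (law p \<pi>) {(x', y', m, z'). x' = x \<and> y' = y \<and> z' = z}"
    using prob_run[OF \<pi>, of "\<lambda>x' y' m z'. z' = z \<and> x' = x \<and> y' = y"] by (simp add: conj_ac)
  moreover have "\<P>(\<omega> in run p \<pi>. inp_A \<omega> = x \<and> inp_B \<omega> = y) = pmf p (x, y)"
    using prob_run[OF \<pi>, of "\<lambda>x' y' m z'. x' = x \<and> y' = y"]
      measure_inputs[OF map_law_inputs[OF \<pi>], of x y] by simp
  ultimately show ?thesis unfolding output_prob_def cond_prob_def by simp
qed

lemma markov_chain_iff:
  "markov_chain (run p \<pi>) (rv_M \<pi>) inp_A (\<lambda>\<omega>. (inp_B \<omega>, rv_Z \<pi> \<omega>)) \<longleftrightarrow>
    (\<forall>m x y z. measure_pmf.prob (law p \<pi>) {(x', y', m', z'). x' = x} > 0 \<longrightarrow>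
      measure_pmf.prob (law p \<pi>) {(x', y', m', z'). x' = x \<and> y' = y \<and> m' = m \<and> z' = z} *
        measure_pmf.prob (law p \<pi>) {(x', y', m', z'). x' = x} =
      measure_pmf.prob (law p \<pi>) {(x', y', m', z'). x' = x \<and> m' = m} *
        measure_pmf.prob (law p \<pi>) {(x', y', m', z'). x' = x \<and> y' = y \<and> z' = z})"
proof -
  have eq: "\<P>(\<omega> in run p \<pi>. inp_A \<omega> = x) = measure_pmf.prob (law p \<pi>) {(x', y', m', z'). x' = x}"
    "\<P>(\<omega> in run p \<pi>. (rv_M \<pi> \<omega> = m \<and> (inp_B \<omega>, rv_Z \<pi> \<omega>) = (y, z)) \<and> inp_A \<omega> = x) =
      measure_pmf.prob (law p \<pi>) {(x', y', m', z'). x' = x \<and> y' = y \<and> m' = m \<and> z' = z}"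
    "\<P>(\<omega> in run p \<pi>. rv_M \<pi> \<omega> = m \<and> inp_A \<omega> = x) =
      measure_pmf.prob (law p \<pi>) {(x', y', m', z'). x' = x \<and> m' = m}"
    "\<P>(\<omega> in run p \<pi>. (inp_B \<omega>, rv_Z \<pi> \<omega>) = (y, z) \<and> inp_A \<omega> = x) =
      measure_pmf.prob (law p \<pi>) {(x', y', m', z'). x' = x \<and> y' = y \<and> z' = z}" for x m y z
    using prob_run[OF \<pi>, of "\<lambda>x' y' m' z'. x' = x"]
      prob_run[OF \<pi>, of "\<lambda>x' y' m' z'. (m' = m \<and> (y', z') = (y, z)) \<and> x' = x"]
      prob_run[OF \<pi>, of "\<lambda>x' y' m' z'. m' = m \<and> x' = x"]
      prob_run[OF \<pi>, of "\<lambda>x' y' m' z'. (y', z') = (y, z) \<and> x' = x"]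
    by (simp_all add: conj_ac)
  show ?thesis
    unfolding markov_chain_def cond_prob_def split_paired_All eq
    by (auto simp: field_simps)
qed

end

lemma measure_one_shot:
  assumes law: "L = bind_pmf p (\<lambda>(x, y). map_pmf (\<lambda>z. (x, y, f x, z)) (Q y (f x)))"
  shows "measure_pmf.prob L {(x', y', m, z'). x' = x \<and> y' = y \<and> z' = z} = pmf p (x, y) * pmf (Q y (f x)) z"
proof -
  have "measure_pmf.prob L {(x', y', m, z'). x' = x \<and> y' = y \<and> z' = z} =
      pmf (map_pmf (\<lambda>(x, y, m, z). (x, y, z)) L) (x, y, z)"
    unfolding pmf_map by (intro arg_cong[where f="measure _"]) auto
  also have "map_pmf (\<lambda>(x, y, m, z). (x, y, z)) L = bind_pmf p (\<lambda>(x, y). map_pmf (\<lambda>z. (x, y, z)) (Q y (f x)))"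
    unfolding law map_bind_pmf by (intro bind_pmf_cong refl) (auto simp: pmf.map_comp o_def)
  also have "pmf \<dots> (x, y, z) = pmf p (x, y) * pmf (Q y (f x)) z"
  proof -
    have "pmf (map_pmf (\<lambda>z. (x', y', z)) (Q y' (f x'))) (x, y, z) =
      indicator {(x, y)} (x', y') * pmf (Q y (f x)) z" for x' y'
    proof (cases "x' = x \<and> y' = y")
      case True
      have "inj (\<lambda>z. (x, y, z))" by (simp add: inj_def)
      from pmf_map_inj'[OF this, of "Q y (f x)" z] show ?thesis using True by simp
    next
      case False
      then have "(x, y, z) \<notin> (\<lambda>z. (x', y', z)) ` set_pmf (Q y' (f x'))" by auto
      then have "pmf (map_pmf (\<lambda>z. (x', y', z)) (Q y' (f x'))) (x, y, z) = 0"
        by (simp add: pmf_eq_0_set_pmf)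
      then show ?thesis using False by (auto simp: indicator_def)
    qed
    then show ?thesis unfolding pmf_bind by (simp add: case_prod_beta measure_pmf_single)
  qed
  finally show ?thesis .
qed

section \<open>Perfect security\<close>

lemma not_adj_pmf_eq:
  assumes "\<not> adj p K x x'" "(x, y) \<in> set_pmf p" "(x', y) \<in> set_pmf p"
  shows "K x y = K x' y"
  using assms by (intro pmf_eqI) (auto simp: adj_def pmf_positive)

lemma perfectly_secure_lower:
  fixes p :: "('a::countable \<times> 'b::countable) pmf" and \<pi> :: "('a, 'b, 'c::countable) protocol"
  assumes sec: "perfectly_secure p K \<pi>" and fin: "finite (set_pmf p)"
  shows "ennreal (chromatic_entropy (fst ` set_pmf p) (adj p K) (map_pmf fst p)) \<le> expected_length p \<pi>"
proof -
  let ?L = "law p \<pi>"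
  have \<pi>: "protocol_for p \<pi>" and out: "\<And>x y z. (x, y) \<in> set_pmf p \<Longrightarrow> output_prob p \<pi> x y z = pmf (K x y) z"
    and mk: "markov_chain (run p \<pi>) (rv_M \<pi>) inp_A (\<lambda>\<omega>. (inp_B \<omega>, rv_Z \<pi> \<omega>))"
    using sec by (auto simp: perfectly_secure_def)
  define S where "S = fst ` set_pmf p"
  have finS: "finite S" using fin by (simp add: S_def)
  have mapL: "map_pmf (\<lambda>(x, y, m, z). (x, y)) ?L = p" by (rule map_law_inputs[OF \<pi>])
  define R where "R x = {m. \<exists>y z. (x, y, m, z) \<in> set_pmf ?L}" for x
  have Rne: "R x \<noteq> {}" if xS: "x \<in> S" for x
  proof -
    obtain y where "(x, y) \<in> set_pmf p" using xS by (force simp: S_def)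
    then have "(x, y) \<in> set_pmf (map_pmf (\<lambda>(x, y, m, z). (x, y)) ?L)"
      by (simp only: mapL)
    then show ?thesis by (auto simp: R_def)
  qed
  have Rw: "R x \<subseteq> words \<pi>" for x
  proof
    fix m assume "m \<in> R x"
    then obtain y z where "pmf ?L (x, y, m, z) \<noteq> 0" by (auto simp: R_def set_pmf_iff)
    then show "m \<in> words \<pi>" by (auto simp: pmf_law[OF \<pi>] weight_A_def split: if_splits)
  qed
  have disj: "R x \<inter> R x' = {}" if adj: "adj p K x x'" for x x'
  proof (rule ccontr)
    assume "R x \<inter> R x' \<noteq> {}"
    then obtain m where m: "m \<in> R x" "m \<in> R x'" by auto
    from adj obtain y z where yz: "(x, y) \<in> set_pmf p" "(x', y) \<in> set_pmf p" "pmf (K x y) z \<noteq> pmf (K x' y) z"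
      by (auto simp: adj_def pmf_positive_iff)
    \<comment> \<open>Given \<open>x\<close>, the transcript says nothing about
      \<open>(y, z)\<close>. Comparing this with the product form of the joint law, the channel law
      of \<open>z\<close> is proportional to Bob's weight, with a factor that does not involve
      \<open>z\<close>.\<close>
    have *: "\<exists>c>0. \<forall>z. pmf (K x y) z = c * weight_B \<pi> y m z"
      if m: "m \<in> R x" and xy: "(x, y) \<in> set_pmf p" for x
    proof -
      let ?P = "measure_pmf.prob ?L"
      define Pm where "Pm = ?P {(x', y', m', z'). x' = x \<and> m' = m}"
      define Px where "Px = ?P {(x', y', m', z'). x' = x}"
      obtain y0 z0 where 0: "(x, y0, m, z0) \<in> set_pmf ?L" using m by (auto simp: R_def)
      have "0 < Pm" "0 < Px" unfolding Pm_def Px_def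
        using 0 by (auto intro!: measure_pmf_posI)
      have pxy: "pmf p (x, y) > 0" using xy by (simp add: pmf_positive)
      have eq: "weight_A \<pi> x m * weight_B \<pi> y m z * Px = Pm * pmf (K x y) z" for z
      proof -
        have "?P {(x', y', m', z'). x' = x \<and> y' = y \<and> m' = m \<and> z' = z} * Px =
            Pm * ?P {(x', y', m', z'). x' = x \<and> y' = y \<and> z' = z}"
          unfolding Px_def Pm_def
          by (rule mk[unfolded markov_chain_iff[OF \<pi>], rule_format]) (rule \<open>0 < Px\<close>[unfolded Px_def])
        moreover have "{(x', y', m', z'). x' = x \<and> y' = y \<and> m' = m \<and> z' = z} = {(x, y, m, z)}" by auto
        moreover have "?P {(x', y', m', z'). x' = x \<and> y' = y \<and> z' = z} = pmf p (x, y) * pmf (K x y) z"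
          unfolding out[OF xy, of z, symmetric] output_prob_eq[OF \<pi>] using pxy by simp
        ultimately show ?thesis using pxy by (simp add: measure_pmf_single pmf_law[OF \<pi>])
      qed
      obtain z1 where "z1 \<in> set_pmf (K x y)" using set_pmf_not_empty[of "K x y"] by blast
      then have "weight_A \<pi> x m * weight_B \<pi> y m z1 * Px > 0"
        unfolding eq using \<open>0 < Pm\<close> by (simp add: pmf_positive)
      then have "weight_A \<pi> x m > 0"
        using weight_nonneg(1)[of \<pi> x m] by (cases "weight_A \<pi> x m = 0") auto
      then have "weight_A \<pi> x m * Px / Pm > 0" using \<open>0 < Pm\<close> \<open>0 < Px\<close> by simp
      moreover have "pmf (K x y) z = weight_A \<pi> x m * Px / Pm * weight_B \<pi> y m z" for z
        using eq[of z] \<open>0 < Pm\<close> by (simp add: field_simps)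
      ultimately show ?thesis by blast
    qed
    obtain c where c: "c > 0" "\<And>z. pmf (K x y) z = c * weight_B \<pi> y m z" using *[OF m(1) yz(1)] by blast
    obtain c' where c': "c' > 0" "\<And>z. pmf (K x' y) z = c' * weight_B \<pi> y m z" using *[OF m(2) yz(2)] by blast
    have "pmf (K x y) z = c / c' * pmf (K x' y) z" for z using c c' by simp
    \<comment> \<open>Two probability laws proportional to the same weight coincide: summing over
      \<open>z\<close> shows that the two factors agree.\<close>
    then have "(\<integral>\<^sup>+ z. ennreal (pmf (K x y) z) \<partial>count_space UNIV) =
        (\<integral>\<^sup>+ z. ennreal (c / c') * ennreal (pmf (K x' y) z) \<partial>count_space UNIV)"
      using c(1) c'(1) by (intro nn_integral_cong) (simp add: ennreal_mult[symmetric])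
    also have "\<dots> = ennreal (c / c') * (\<integral>\<^sup>+ z. ennreal (pmf (K x' y) z) \<partial>count_space UNIV)"
      by (rule nn_integral_cmult) simp
    finally have "1 = ennreal (c / c')"
      by (simp add: nn_integral_pmf)
    then have "c = c'" using c(1) c'(1) by (simp add: ennreal_eq_1)
    then show False using c c' yz(3) by simp
  qed
  \<comment> \<open>Any choice from \<open>R x\<close> would separate adjacent letters; a shortest
    word is in addition never longer than the actual transcript.\<close>
  define mst where "mst x = arg_min length (\<lambda>m. m \<in> R x)" for x
  have mst: "mst x \<in> R x" if xS: "x \<in> S" for x
  proof -
    obtain m where "m \<in> R x" using Rne[OF xS] by blast
    then show ?thesis unfolding mst_def by (rule arg_min_natI)
  qed
  have mst_le: "length (mst x) \<le> length m" if "m \<in> R x" for x m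
    unfolding mst_def using that by (rule arg_min_nat_le)
  have "proper_coloring S (adj p K) (\<lambda>x. to_nat (mst x))"
    unfolding proper_coloring_def
  proof (intro ballI impI)
    fix u v assume uv: "u \<in> S" "v \<in> S" "adj p K u v"
    then have "mst u \<noteq> mst v" using mst[OF uv(1)] mst[OF uv(2)] disj[OF uv(3)] by auto
    then show "to_nat (mst u) \<noteq> to_nat (mst v)" by simp
  qed
  then have "chromatic_entropy S (adj p K) (map_pmf fst p) \<le>
      prob_space.entropy (measure_pmf (map_pmf fst p)) 2 (count_space UNIV) (\<lambda>x. to_nat (mst x))"
    using fin finS by (intro chromatic_entropy_attained(2)) (auto simp: adj_def)
  also have "\<dots> \<le> (\<Sum>x\<in>S. pmf (map_pmf fst p) x * real (length (mst x)))"
  proof -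
    have "prefix_free (mst ` S)"
      unfolding prefix_free_def
    proof (safe)
      fix u v assume uv: "u \<in> S" "v \<in> S" "prefix (mst u) (mst v)"
      have "mst u \<in> words \<pi>" "mst v \<in> words \<pi>"
        using mst[OF uv(1)] mst[OF uv(2)] Rw by (auto simp: subset_iff)
      then show "mst u = mst v"
        using prefix_free_words[OF \<pi>] uv(3) unfolding prefix_free_def by simp
    qed
    then show ?thesis
      using kraft_entropy_le[of "map_pmf fst p" mst] fin by (simp add: S_def)
  qed
  also have "\<dots> = measure_pmf.expectation (map_pmf fst p) (\<lambda>x. real (length (mst x)))"
    using fin by (subst expectation_finite) (auto simp: S_def)
  finally have "ennreal (chromatic_entropy S (adj p K) (map_pmf fst p)) \<le>
      ennreal (measure_pmf.expectation (map_pmf fst p) (\<lambda>x. real (length (mst x))))"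
    by (rule ennreal_leI)
  also have "\<dots> = (\<integral>\<^sup>+ x. of_nat (length (mst x)) \<partial>map_pmf fst p)"
    using fin by (subst nn_integral_eq_integral[symmetric])
      (auto simp: ennreal_of_nat_eq_real_of_nat intro: integrable_measure_pmf_finite)
  also have "\<dots> = (\<integral>\<^sup>+ (x, y, m, z). of_nat (length (mst x)) \<partial>?L)"
  proof -
    have "map_pmf fst (map_pmf (\<lambda>(x, y, m, z). (x, y)) ?L) = map_pmf (\<lambda>(x, y, m, z). x) ?L"
      by (simp add: pmf.map_comp o_def case_prod_unfold)
    then have mp: "map_pmf fst p = map_pmf (\<lambda>(x, y, m, z). x) ?L" by (simp only: mapL)
    show ?thesis unfolding mp by (simp add: case_prod_unfold)
  qed
  also have "\<dots> \<le> (\<integral>\<^sup>+ (x, y, m, z). of_nat (length m) \<partial>?L)"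
  proof (rule nn_integral_mono_AE, rule AE_pmfI)
    fix \<omega> assume \<omega>: "\<omega> \<in> set_pmf ?L"
    obtain x y m z where eq: "\<omega> = (x, y, m, z)" by (metis surj_pair)
    have "m \<in> R x" using \<omega> unfolding eq R_def by blast
    then show "(\<lambda>(x, y, m, z). of_nat (length (mst x)) :: ennreal) \<omega> \<le> (\<lambda>(x, y, m, z). of_nat (length m)) \<omega>"
      using mst_le[of m x] by (simp add: eq)
  qed
  also have "\<dots> = expected_length p \<pi>" by (rule expected_length_eq[OF \<pi>, symmetric])
  finally show ?thesis by (simp add: S_def)
qed

lemma expected_length_one_shot:
  fixes p :: "('a::countable \<times> 'b::countable) pmf" and \<pi> :: "('a, 'b, 'c::countable) protocol"
  assumes \<pi>: "protocol_for p \<pi>" and fin: "finite (set_pmf p)"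
    and law: "law p \<pi> = bind_pmf p (\<lambda>(x, y). map_pmf (\<lambda>z. (x, y, f x, z)) (Q y (f x)))"
  shows "expected_length p \<pi> = ennreal (\<Sum>x\<in>fst ` set_pmf p. pmf (map_pmf fst p) x * real (length (f x)))"
proof -
  have "expected_length p \<pi> = (\<integral>\<^sup>+ xy. ennreal (real (length (f (fst xy)))) \<partial>p)"
    unfolding expected_length_eq[OF \<pi>] law
    by (simp add: case_prod_beta ennreal_of_nat_eq_real_of_nat)
  also have "\<dots> = (\<integral>\<^sup>+ x. ennreal (real (length (f x))) \<partial>map_pmf fst p)" by simp
  also have "\<dots> = ennreal (measure_pmf.expectation (map_pmf fst p) (\<lambda>x. real (length (f x))))"
    using fin by (intro nn_integral_eq_integral integrable_measure_pmf_finite) auto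
  finally show ?thesis by (subst (asm) expectation_finite) (use fin in auto)
qed

lemma perfectly_secure_upper:
  fixes p :: "('a::countable \<times> 'b::countable) pmf" and K :: "'a \<Rightarrow> 'b \<Rightarrow> 'c::countable pmf"
  assumes fin: "finite (set_pmf p)"
  shows "\<exists>\<pi>. perfectly_secure p K \<pi> \<and>
    expected_length p \<pi> < ennreal (chromatic_entropy (fst ` set_pmf p) (adj p K) (map_pmf fst p) + 1)"
proof -
  define S where "S = fst ` set_pmf p"
  have finS: "finite S" using fin by (simp add: S_def)
  obtain c where c: "proper_coloring S (adj p K) c"
      "chromatic_entropy S (adj p K) (map_pmf fst p) = prob_space.entropy (measure_pmf (map_pmf fst p)) 2 (count_space UNIV) c"
    using chromatic_entropy_attained(1)[of "map_pmf fst p" "adj p K" S] fin finS by (auto simp: adj_def)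
  obtain g :: "nat \<Rightarrow> msg" where g: "inj_on g (c ` S)" "prefix_free (g ` c ` S)"
      "(\<Sum>v\<in>S. pmf (map_pmf fst p) v * real (length (g (c v)))) < chromatic_entropy S (adj p K) (map_pmf fst p) + 1"
    using shannon_code[of "map_pmf fst p" c] fin unfolding c(2) by (auto simp: S_def)
  \<comment> \<open>Inputs outside the support borrow the word of \<open>x0\<close>, so that every
    message lies in the finite codebook.\<close>
  obtain x0 where x0: "x0 \<in> S" using set_pmf_not_empty[of p] by (auto simp: S_def)
  define f where "f x = g (c (if x \<in> S then x else x0))" for x
  \<comment> \<open>Bob picks any input compatible with \<open>y\<close> and with the received
    colour. It has the colour of Alice's input and shares \<open>y\<close> with it, so the two are
    not adjacent and induce the same law of \<open>z\<close>.\<close>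
  define w where "w y m = (SOME x. (x, y) \<in> set_pmf p \<and> f x = m)" for y m
  define Q where "Q y m = K (w y m) y" for y m
  have Q: "Q y (f x) = K x y" if xy: "(x, y) \<in> set_pmf p" for x y
  proof -
    have w: "(w y (f x), y) \<in> set_pmf p" "f (w y (f x)) = f x"
      using someI[of "\<lambda>x'. (x', y) \<in> set_pmf p \<and> f x' = f x" x] xy by (auto simp: w_def)
    have S: "x \<in> S" "w y (f x) \<in> S" using xy w(1) by (force simp: S_def)+
    then have "c (w y (f x)) = c x" using w(2) g(1) by (auto simp: f_def inj_on_def)
    then have "\<not> adj p K (w y (f x)) x" using c(1) S by (auto simp: proper_coloring_def)
    then show ?thesis unfolding Q_def using w(1) xy by (rule not_adj_pmf_eq)
  qed
  obtain d :: 'c where True by simp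
  obtain \<pi> :: "('a, 'b, 'c) protocol" where \<pi>: "protocol_for p \<pi>"
      and law: "law p \<pi> = bind_pmf p (\<lambda>(x, y). map_pmf (\<lambda>z. (x, y, f x, z)) (Q y (f x)))"
    using ex_one_shot[OF g(2) _ _ fin, of f d Q] finS x0 by (auto simp: f_def)
  have "perfectly_secure p K \<pi>"
    unfolding perfectly_secure_def
  proof (intro conjI \<pi> ballI allI, safe)
    fix x y z assume xy: "(x, y) \<in> set_pmf p"
    then show "output_prob p \<pi> x y z = pmf (K x y) z"
      unfolding output_prob_eq[OF \<pi>] measure_one_shot[OF law] by (simp add: Q set_pmf_iff)
  next
    \<comment> \<open>The transcript is the function \<open>f\<close> of \<open>x\<close>, hence
      conditionally independent of everything else given \<open>x\<close>.\<close>
    show "markov_chain (run p \<pi>) (rv_M \<pi>) inp_A (\<lambda>\<omega>. (inp_B \<omega>, rv_Z \<pi> \<omega>))"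
      unfolding markov_chain_iff[OF \<pi>]
    proof (intro allI impI)
      fix m x y z
      let ?P = "measure_pmf.prob (law p \<pi>)"
      have 1: "?P {(x', y', m', z'). x' = x \<and> y' = y \<and> m' = m \<and> z' = z} =
          (if f x = m then ?P {(x', y', m', z'). x' = x \<and> y' = y \<and> z' = z} else 0)"
      proof -
        have "{(x', y', m', z'). x' = x \<and> y' = y \<and> f x' = m \<and> z' = z} =
            (if f x = m then {(x', y', m', z'). x' = x \<and> y' = y \<and> z' = z} else {})" by auto
        note eq = this
        show ?thesis by (subst prob_one_shot[OF law], subst eq) simp
      qed
      have 2: "?P {(x', y', m', z'). x' = x \<and> m' = m} = (if f x = m then ?P {(x', y', m', z'). x' = x} else 0)"
      proof -
        have "{(x', y', m', z' :: 'c). x' = x \<and> f x' = m} =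
            (if f x = m then {(x', y', m', z'). x' = x} else {})" by auto
        note eq = this
        show ?thesis by (subst prob_one_shot[OF law], subst eq) simp
      qed
      show "?P {(x', y', m', z'). x' = x \<and> y' = y \<and> m' = m \<and> z' = z} * ?P {(x', y', m', z'). x' = x} =
        ?P {(x', y', m', z'). x' = x \<and> m' = m} * ?P {(x', y', m', z'). x' = x \<and> y' = y \<and> z' = z}"
        unfolding 1 2 by simp
    qed
  qed
  moreover have "expected_length p \<pi> < ennreal (chromatic_entropy S (adj p K) (map_pmf fst p) + 1)"
  proof -
    have "(\<Sum>x\<in>S. pmf (map_pmf fst p) x * real (length (f x))) = (\<Sum>x\<in>S. pmf (map_pmf fst p) x * real (length (g (c x))))"
      by (simp add: f_def)
    moreover have "0 \<le> (\<Sum>x\<in>S. pmf (map_pmf fst p) x * real (length (g (c x))))"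
      by (intro sum_nonneg) auto
    ultimately show ?thesis
      unfolding expected_length_one_shot[OF \<pi> fin law] S_def[symmetric] using g(3)
      by (simp add: ennreal_less_iff)
  qed
  ultimately show ?thesis by (auto simp: S_def)
qed

section \<open>Exponential races\<close>

abbreviation expo :: "real measure" where
  "expo \<equiv> density lborel (\<lambda>x. ennreal (exponential_density 1 x))"

lemma prob_space_expo: "prob_space expo"
  by (rule prob_space_exponential_density) simp

lemma emeasure_expo_greater: "0 \<le> u \<Longrightarrow> emeasure expo {u<..} = ennreal (exp (- u))"
proof -
  assume u: "0 \<le> u"
  interpret prob_space expo by (rule prob_space_expo)
  have "distributed expo lborel (\<lambda>x. x) (\<lambda>x. ennreal (exponential_density 1 x))"
    by (simp add: distributed_def distr_id2)
  from exponential_distributedD_gt[OF this u] have "measure expo {x \<in> space expo. u < x} = exp (- u)"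
    by simp
  moreover have "{x \<in> space expo. u < x} = {u<..}" by auto
  ultimately show ?thesis by (simp add: emeasure_eq_measure)
qed

text \<open>Given \<open>T a = t\<close>, every other clock exceeds \<open>t * c b\<close> with
  probability \<open>exp (- (t * c b))\<close>, independently; integrating the product over the
  exponential \<open>t\<close> gives the fraction. The condition \<open>0 \<le> T a\<close> excludes
  a null set and allows coefficients to be compared after multiplication by
  \<open>T a\<close>.\<close>

lemma exponential_race:
  assumes fin: "finite I" and a: "a \<in> I" and c: "\<And>b. b \<in> I \<Longrightarrow> 0 \<le> c b"
  shows "{T \<in> space (PiM I (\<lambda>_. expo)). 0 \<le> T a \<and> (\<forall>b\<in>I - {a}. T a * c b < T b)} \<in> sets (PiM I (\<lambda>_. expo))"
    (is "?A \<in> _")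
    and "measure (PiM I (\<lambda>_. expo)) {T \<in> space (PiM I (\<lambda>_. expo)). 0 \<le> T a \<and> (\<forall>b\<in>I - {a}. T a * c b < T b)}
      = 1 / (1 + (\<Sum>b\<in>I - {a}. c b))"
proof -
  interpret E: prob_space expo by (rule prob_space_expo)
  interpret product_sigma_finite "\<lambda>_. expo" by unfold_locales
  let ?A = "{T \<in> space (PiM I (\<lambda>_. expo)). 0 \<le> T a \<and> (\<forall>b\<in>I - {a}. T a * c b < T b)}"
  define J where "J = I - {a}"
  have J: "finite J" "a \<notin> J" "I = insert a J" using fin a by (auto simp: J_def)
  define C where "C = (\<Sum>b\<in>J. c b)"
  have C: "0 \<le> C" using c by (auto simp: C_def J_def intro!: sum_nonneg)
  have comp: "(\<lambda>T. T b) \<in> borel_measurable (PiM I (\<lambda>_. expo))" if "b \<in> I" for b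
    using measurable_component_singleton[OF that, of "\<lambda>_. expo"] by (simp cong: measurable_cong_sets)
  show A: "?A \<in> sets (PiM I (\<lambda>_. expo))"
  proof -
    have "{T \<in> space (PiM I (\<lambda>_. expo)). T a * c b < T b} \<in> sets (PiM I (\<lambda>_. expo))" if "b \<in> I - {a}" for b
      using comp[OF a] comp[of b] that by (intro borel_measurable_less borel_measurable_times) auto
    moreover have "{T \<in> space (PiM I (\<lambda>_. expo)). 0 \<le> T a} \<in> sets (PiM I (\<lambda>_. expo))"
      using comp[OF a] by (intro borel_measurable_le) auto
    ultimately show ?thesis
      using fin by (intro sets.sets_Collect_conj sets.sets_Collect_finite_All) auto
  qed
  have "emeasure (PiM I (\<lambda>_. expo)) ?A = (\<integral>\<^sup>+ T. indicator ?A T \<partial>PiM (insert a J) (\<lambda>_. expo))"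
    using A by (simp add: J(3))
  also have "\<dots> = (\<integral>\<^sup>+ t. (\<integral>\<^sup>+ T. indicator ?A (T(a := t)) \<partial>PiM J (\<lambda>_. expo)) \<partial>expo)"
    by (rule product_nn_integral_insert_rev[OF J(1,2)]) (use A J(3) in simp)
  also have "\<dots> = (\<integral>\<^sup>+ t. ennreal (exp (- (t * C))) * indicator {0..} t \<partial>expo)"
  proof (rule nn_integral_cong)
    fix t :: real
    show "(\<integral>\<^sup>+ T. indicator ?A (T(a := t)) \<partial>PiM J (\<lambda>_. expo)) = ennreal (exp (- (t * C))) * indicator {0..} t"
    proof (cases "0 \<le> t")
      case True
      have "(\<integral>\<^sup>+ T. indicator ?A (T(a := t)) \<partial>PiM J (\<lambda>_. expo)) =
          (\<integral>\<^sup>+ T. indicator (PiE J (\<lambda>b. {t * c b<..})) T \<partial>PiM J (\<lambda>_. expo))"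
      proof (rule nn_integral_cong)
        fix T assume T: "T \<in> space (PiM J (\<lambda>_. expo))"
        then have ext: "T \<in> extensional J" by (auto simp: space_PiM PiE_def)
        have "T(a := t) \<in> ?A \<longleftrightarrow> T \<in> PiE J (\<lambda>b. {t * c b<..})"
        proof -
          have "T(a := t) \<in> space (PiM I (\<lambda>_. expo))"
            using ext J by (auto simp: space_PiM PiE_def extensional_def)
          moreover have "(\<forall>b\<in>I - {a}. t * c b < (T(a := t)) b) \<longleftrightarrow> (\<forall>b\<in>J. t * c b < T b)"
            using J(2) by (auto simp: J_def)
          ultimately show ?thesis using ext True by (auto simp: PiE_iff)
        qed
        then show "indicator ?A (T(a := t)) = (indicator (PiE J (\<lambda>b. {t * c b<..})) T :: ennreal)"
          by (simp only: indicator_def)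
      qed
      also have "\<dots> = emeasure (PiM J (\<lambda>_. expo)) (PiE J (\<lambda>b. {t * c b<..}))"
        using J(1) by (intro nn_integral_indicator sets_PiM_I_finite) auto
      also have "\<dots> = (\<Prod>b\<in>J. emeasure expo {t * c b<..})"
        using J(1) by (intro emeasure_PiM) auto
      also have "\<dots> = (\<Prod>b\<in>J. ennreal (exp (- (t * c b))))"
        using c True by (intro prod.cong refl emeasure_expo_greater mult_nonneg_nonneg) (auto simp: J_def)
      also have "\<dots> = ennreal (exp (- (t * C)))"
        by (subst prod_ennreal) (auto simp: C_def exp_sum[OF J(1), symmetric] sum_distrib_left sum_negf)
      finally show ?thesis using True by simp
    next
      case False
      then have "T(a := t) \<notin> ?A" for T by auto
      then have "(\<integral>\<^sup>+ T. indicator ?A (T(a := t)) \<partial>PiM J (\<lambda>_. expo)) = (\<integral>\<^sup>+ T. 0 \<partial>PiM J (\<lambda>_. expo))"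
        by (intro nn_integral_cong) (simp only: indicator_def of_bool_def if_False)
      then show ?thesis using False by simp
    qed
  qed
  also have "\<dots> = (\<integral>\<^sup>+ t. ennreal (exponential_density 1 t) * (ennreal (exp (- (t * C))) * indicator {0..} t) \<partial>lborel)"
    by (subst nn_integral_density) auto
  also have "\<dots> = (\<integral>\<^sup>+ t. ennreal (1 / (1 + C)) * ennreal (exponential_density (1 + C) t) \<partial>lborel)"
  proof (rule nn_integral_cong)
    fix t :: real
    show "ennreal (exponential_density 1 t) * (ennreal (exp (- (t * C))) * indicator {0..} t)
      = ennreal (1 / (1 + C)) * ennreal (exponential_density (1 + C) t)"
    proof (cases "0 \<le> t")
      case True
      have "exp (- t) * exp (- (t * C)) = 1 / (1 + C) * ((1 + C) * exp (- t * (1 + C)))"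
        using C by (simp add: exp_add[symmetric]) (simp add: algebra_simps)
      then show ?thesis using True C by (simp add: exponential_density_def ennreal_mult[symmetric])
    qed (simp add: exponential_density_def)
  qed
  also have "\<dots> = ennreal (1 / (1 + C)) * (\<integral>\<^sup>+ t. ennreal (exponential_density (1 + C) t) \<partial>lborel)"
    by (rule nn_integral_cmult) simp
  also have "(\<integral>\<^sup>+ t. ennreal (exponential_density (1 + C) t) \<partial>lborel) = 1"
  proof -
    interpret F: prob_space "density lborel (\<lambda>x. ennreal (exponential_density (1 + C) x))"
      using C by (intro prob_space_exponential_density) simp
    show ?thesis using F.emeasure_space_1 by (simp add: emeasure_density)
  qed
  finally show "measure (PiM I (\<lambda>_. expo)) ?A = 1 / (1 + (\<Sum>b\<in>I - {a}. c b))"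
    using C by (simp add: measure_def C_def J_def)
qed

lemma arg_min_unique:
  assumes "P a" "\<And>b. P b \<Longrightarrow> b \<noteq> a \<Longrightarrow> (h a :: real) < h b"
  shows "arg_min h P = a"
proof -
  have "is_arg_min h P a" using assms by (force simp: is_arg_min_def not_less)
  then have "is_arg_min h P (arg_min h P)" unfolding arg_min_def by (rule someI)
  then show ?thesis using assms unfolding is_arg_min_def by metis
qed

text \<open>The Poisson matching idea: with a common exponential clock \<open>T (w, j)\<close> for every pair of a word
  and a bin, Alice selects the first pair after rescaling the clocks by \<open>1 / q x w\<close> and reveals the
  bin; within that bin Bob selects the first word after rescaling by \<open>1 / r y w\<close>. Both select \<open>(w, j)\<close>
  with probability at least \<open>1 / (L / q x w + 1 / r y w)\<close>, and some fixed outcome of the clocks is at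
  least as good as the average.\<close>

lemma matching_code:
  fixes P :: "('a \<times> 'b) pmf" and q :: "'a \<Rightarrow> 'w pmf" and r :: "'b \<Rightarrow> 'w pmf"
  assumes finP: "finite (set_pmf P)" and finW: "finite W" and L: "0 < L"
  shows "\<exists>(f :: 'a \<Rightarrow> nat) g. (\<forall>x. f x < L) \<and>
    (\<Sum>(x, y)\<in>set_pmf P. pmf P (x, y) *
       (\<Sum>w\<in>W. pmf (q x) w * pmf (r y) w / (pmf (r y) w + pmf (q x) w / real L)))
      \<le> measure_pmf.prob P {(x, y). g y (f x) \<in> set_pmf (q x)}"
proof -
  define I where "I = W \<times> {..<L}"
  have finI: "finite I" using finW by (simp add: I_def)
  let ?M = "PiM I (\<lambda>_. expo)"
  interpret M: prob_space ?M by (intro prob_space_PiM prob_space_expo)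
  \<comment> \<open>The index \<open>a\<close> wins Alice's race if it beats every \<open>b\<close>
    in the scale of \<open>q\<close>, and Bob's if it beats those of its own bin in the scale of
    \<open>r\<close>; the maximum demands both at once.\<close>
  define c where "c x y a b = max (pmf (q x) (fst b) / pmf (q x) (fst a))
      (if snd b = snd a then pmf (r y) (fst b) / pmf (r y) (fst a) else 0)" for x y and a b :: "'w \<times> nat"
  define E where "E x y a = {T \<in> space ?M. 0 \<le> T a \<and> (\<forall>b\<in>I - {a}. T a * c x y a b < T b)}" for x y a
  define G where "G x y = {a \<in> I. 0 < pmf (q x) (fst a) \<and> 0 < pmf (r y) (fst a)}" for x y
  define V where "V = (\<Sum>(x, y)\<in>set_pmf P. pmf P (x, y) * (\<Sum>a\<in>G x y. measure ?M (E x y a)))"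
  define h where "h T = (\<Sum>(x, y)\<in>set_pmf P. pmf P (x, y) * (\<Sum>a\<in>G x y. indicator (E x y a) T))" for T
  have finG: "finite (G x y)" for x y using finI by (auto simp: G_def)
  have c0: "0 \<le> c x y a b" for x y a b by (auto simp: c_def le_max_iff_disj)
  have EM: "E x y a \<in> sets ?M" if "a \<in> I" for x y a
    unfolding E_def using finI that c0 by (rule exponential_race)
  have PE: "measure ?M (E x y a) = 1 / (1 + (\<Sum>b\<in>I - {a}. c x y a b))" if "a \<in> I" for x y a
    unfolding E_def using finI that c0 by (rule exponential_race)
  have intE: "integrable ?M (indicator (E x y a) :: _ \<Rightarrow> real)" if "a \<in> G x y" for x y a
    using EM[of a x y] that
    by (intro integrable_real_indicator) (auto simp: G_def M.emeasure_finite less_top[symmetric])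
  have inth: "integrable ?M (\<lambda>T. pmf P (x, y) * (\<Sum>a\<in>G x y. indicator (E x y a) T))" for x y
    using intE by (intro integrable_mult_right Bochner_Integration.integrable_sum) auto
  have "integrable ?M h"
    unfolding h_def split_beta by (intro Bochner_Integration.integrable_sum inth)
  have hV: "integral\<^sup>L ?M h = V"
  proof -
    have "integral\<^sup>L ?M (\<lambda>T. pmf P (x, y) * (\<Sum>a\<in>G x y. indicator (E x y a) T)) =
        pmf P (x, y) * (\<Sum>a\<in>G x y. measure ?M (E x y a))" for x y
    proof -
      have "integral\<^sup>L ?M (\<lambda>T. \<Sum>a\<in>G x y. indicator (E x y a) T :: real) = (\<Sum>a\<in>G x y. integral\<^sup>L ?M (indicator (E x y a)))"
        using intE by (intro Bochner_Integration.integral_sum) auto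
      also have "\<dots> = (\<Sum>a\<in>G x y. measure ?M (E x y a))"
        using EM by (intro sum.cong refl) (auto simp: G_def)
      finally show ?thesis by simp
    qed
    note int = this
    show ?thesis
      unfolding h_def V_def split_beta
      by (subst Bochner_Integration.integral_sum[OF inth]) (simp only: int)
  qed
  \<comment> \<open>Since the users have no common randomness, the clocks are frozen at an outcome
    that does at least as well as the mean.\<close>
  obtain T where T: "T \<in> space ?M" "V \<le> h T"
  proof (rule ccontr)
    assume "\<not> thesis"
    then have less: "\<And>T. T \<in> space ?M \<Longrightarrow> h T < V" using that by (meson not_le)
    have "integral\<^sup>L ?M h < V"
      using less by (intro M.expectation_less[OF \<open>integrable ?M h\<close>] AE_I2)
    then show False using hV by simp
  qed
  define A where "A x = arg_min (\<lambda>b. T b / pmf (q x) (fst b)) (\<lambda>b. b \<in> I \<and> 0 < pmf (q x) (fst b))" for x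
  \<comment> \<open>The guard is there because \<open>arg_min\<close> is arbitrary when no pair has
    positive weight.\<close>
  define f where "f x = (if snd (A x) < L then snd (A x) else 0)" for x
  define g where "g y j = arg_min (\<lambda>w. T (w, j) / pmf (r y) w) (\<lambda>w. w \<in> W \<and> 0 < pmf (r y) w)" for y j
  have fL: "f x < L" for x using L by (simp add: f_def)
  have sel: "A x = a \<and> g y (f x) = fst a" if a: "a \<in> G x y" and TE: "T \<in> E x y a" for x y a
  proof -
    have T0: "0 \<le> T a" and Tb: "\<And>b. b \<in> I \<Longrightarrow> b \<noteq> a \<Longrightarrow> T a * c x y a b < T b"
      using TE by (auto simp: E_def)
    have a': "a \<in> I" "0 < pmf (q x) (fst a)" "0 < pmf (r y) (fst a)" using a by (auto simp: G_def)
    have A: "A x = a"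
      unfolding A_def
    proof (rule arg_min_unique)
      fix b assume b: "b \<in> I \<and> 0 < pmf (q x) (fst b)" "b \<noteq> a"
      have "T a * (pmf (q x) (fst b) / pmf (q x) (fst a)) \<le> T a * c x y a b"
        using T0 by (intro mult_left_mono) (auto simp: c_def)
      also have "\<dots> < T b" using b Tb by auto
      finally show "T a / pmf (q x) (fst a) < T b / pmf (q x) (fst b)"
        using b a' by (simp add: field_simps)
    qed (use a' in auto)
    have "snd a < L" "fst a \<in> W" using a'(1) by (auto simp: I_def)
    then have fx: "f x = snd a" by (simp add: f_def A)
    have "g y (snd a) = fst a"
      unfolding g_def
    proof (rule arg_min_unique)
      fix w assume w: "w \<in> W \<and> 0 < pmf (r y) w" "w \<noteq> fst a"
      then have wI: "(w, snd a) \<in> I" "(w, snd a) \<noteq> a"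
        using \<open>snd a < L\<close> by (auto simp: I_def prod_eq_iff)
      have "T a * (pmf (r y) w / pmf (r y) (fst a)) \<le> T a * c x y a (w, snd a)"
        using T0 by (intro mult_left_mono) (auto simp: c_def)
      also have "\<dots> < T (w, snd a)" using wI Tb by auto
      finally show "T (fst a, snd a) / pmf (r y) (fst a) < T (w, snd a) / pmf (r y) w"
        using w a' by (simp add: field_simps)
    qed (use a' \<open>fst a \<in> W\<close> in auto)
    then show ?thesis using A fx by simp
  qed
  let ?S = "{(x, y). g y (f x) \<in> set_pmf (q x)}"
  have "h T \<le> (\<Sum>(x, y)\<in>set_pmf P. pmf P (x, y) * indicator ?S (x, y))"
    unfolding h_def
  proof (rule sum_mono, unfold split_paired_all prod.case, rule mult_left_mono)
    fix x y
    show "(\<Sum>a\<in>G x y. indicator (E x y a) T) \<le> (indicator ?S (x, y) :: real)"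
    proof (cases "\<exists>a\<in>G x y. T \<in> E x y a")
      case True
      then obtain a where a: "a \<in> G x y" "T \<in> E x y a" by blast
      \<comment> \<open>The winner is Alice's choice \<open>A x\<close>, so at most one of the
        events contains \<open>T\<close>.\<close>
      have "(\<Sum>b\<in>G x y. indicator (E x y b) T) = (\<Sum>b\<in>G x y. if b = a then 1 else (0::real))"
      proof (rule sum.cong[OF refl])
        fix b assume b: "b \<in> G x y"
        show "indicator (E x y b) T = (if b = a then 1 else (0::real))"
        proof (cases "T \<in> E x y b")
          case True
          then have "b = a" using sel[OF a] sel[OF b True] by simp
          then show ?thesis using True by simp
        next
          case False
          then have "b \<noteq> a" using a(2) by metis
          then show ?thesis using False by simp
        qed
      qed
      also have "\<dots> = 1" using a finG by simp
      also have "g y (f x) \<in> set_pmf (q x)" using sel[OF a] a by (auto simp: G_def set_pmf_iff)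
      then have "(1::real) = indicator ?S (x, y)" by simp
      finally show ?thesis by simp
    next
      case False
      then have "(\<Sum>a\<in>G x y. indicator (E x y a) T) = (0::real)" by (intro sum.neutral) auto
      then show ?thesis by simp
    qed
  qed simp
  also have "\<dots> = measure_pmf.expectation P (indicator ?S)"
    using finP by (subst integral_measure_pmf_real[of "set_pmf P"]) (auto simp: split_beta mult.commute)
  also have "\<dots> = measure_pmf.prob P ?S" by simp
  finally have "V \<le> measure_pmf.prob P ?S" using T(2) by simp
  moreover have "(\<Sum>(x, y)\<in>set_pmf P. pmf P (x, y) *
       (\<Sum>w\<in>W. pmf (q x) w * pmf (r y) w / (pmf (r y) w + pmf (q x) w / real L))) \<le> V"
    unfolding V_def
  proof (rule sum_mono, unfold split_paired_all prod.case, rule mult_left_mono)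
    fix x y
    let ?q = "pmf (q x)" and ?r = "pmf (r y)"
    have one: "1 / (real L / ?q w + 1 / ?r w) \<le> measure ?M (E x y (w, j))"
      if w: "w \<in> W" "0 < ?q w" "0 < ?r w" and j: "j < L" for w j
    proof -
      have wj: "(w, j) \<in> I" using w j by (simp add: I_def)
      have sq: "(\<Sum>v\<in>W. pmf s v) \<le> 1" for s :: "'w pmf"
        using measure_pmf.prob_le_1[of s W] finW by (simp add: measure_measure_pmf_finite)
      have "(\<Sum>b\<in>I - {(w, j)}. c x y (w, j) b) \<le>
          (\<Sum>b\<in>I - {(w, j)}. ?q (fst b) / ?q w + (if snd b = j then ?r (fst b) / ?r w else 0))"
        by (intro sum_mono) (auto simp: c_def)
      \<comment> \<open>The omitted index would contribute one in each of the two scales, hence the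
        \<open>2\<close>.\<close>
      also have "\<dots> = (\<Sum>b\<in>I. ?q (fst b) / ?q w + (if snd b = j then ?r (fst b) / ?r w else 0)) - 2"
        using finI wj w by (subst sum_diff1) auto
      also have "\<dots> = (\<Sum>v\<in>W. \<Sum>i<L. ?q v / ?q w) + (\<Sum>v\<in>W. \<Sum>i<L. if i = j then ?r v / ?r w else 0) - 2"
        unfolding I_def sum.cartesian_product' fst_conv snd_conv sum.distrib ..
      also have "\<dots> = real L / ?q w * (\<Sum>v\<in>W. ?q v) + 1 / ?r w * (\<Sum>v\<in>W. ?r v) - 2"
        using j by (simp add: sum_distrib_left sum_divide_distrib)
      also have "\<dots> \<le> real L / ?q w * 1 + 1 / ?r w * 1 - 2"
        using w by (intro diff_right_mono add_mono mult_left_mono sq) auto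
      finally have "1 + (\<Sum>b\<in>I - {(w, j)}. c x y (w, j) b) \<le> real L / ?q w + 1 / ?r w" by simp
      moreover have "0 < 1 + (\<Sum>b\<in>I - {(w, j)}. c x y (w, j) b)"
        using c0 by (intro add_pos_nonneg sum_nonneg) auto
      ultimately show ?thesis
        unfolding PE[OF wj] by (intro divide_left_mono mult_pos_pos) auto
    qed
    define W' where "W' = {w \<in> W. 0 < ?q w \<and> 0 < ?r w}"
    have "(\<Sum>w\<in>W. ?q w * ?r w / (?r w + ?q w / real L)) = (\<Sum>w\<in>W'. ?q w * ?r w / (?r w + ?q w / real L))"
      using finW by (intro sum.mono_neutral_right) (auto simp: W'_def less_le)
    also have "\<dots> = (\<Sum>w\<in>W'. \<Sum>j<L. 1 / (real L / ?q w + 1 / ?r w))"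
      using L by (intro sum.cong refl) (auto simp: W'_def field_simps)
    also have "\<dots> \<le> (\<Sum>w\<in>W'. \<Sum>j<L. measure ?M (E x y (w, j)))"
      by (intro sum_mono one) (auto simp: W'_def)
    also have "\<dots> = (\<Sum>a\<in>G x y. measure ?M (E x y a))"
    proof -
      have "G x y = W' \<times> {..<L}" by (auto simp: G_def W'_def I_def)
      then show ?thesis by (simp add: sum.cartesian_product split_beta)
    qed
    finally show "(\<Sum>w\<in>W. ?q w * ?r w / (?r w + ?q w / real L)) \<le> (\<Sum>a\<in>G x y. measure ?M (E x y a))" .
  qed simp
  ultimately show ?thesis using fL by (intro exI[of _ f] exI[of _ g]) auto
qed

section \<open>Conditional mutual information of probability mass functions\<close>

definition cmi :: "('u \<times> 'v \<times> 'w) pmf \<Rightarrow> real" where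
  "cmi L = measure_pmf.expectation L (\<lambda>(u, v, w). log 2 (pmf L (u, v, w) * pmf (map_pmf (\<lambda>(u, v, w). w) L) w /
     (pmf (map_pmf (\<lambda>(u, v, w). (u, w)) L) (u, w) * pmf (map_pmf (\<lambda>(u, v, w). (v, w)) L) (v, w))))"

lemma pmf_map_pos: "x \<in> set_pmf L \<Longrightarrow> 0 < pmf (map_pmf f L) (f x)"
  by (rule pmf_positive) simp

lemma pmf_le_pmf_map: "pmf L x \<le> pmf (map_pmf f L) (f x)"
  using measure_pmf.finite_measure_mono[of "{x}" "f -` {f x}" L] by (simp add: pmf_map measure_pmf_single)

lemma integrable_pmf_ratio:
  assumes "\<And>x. x \<in> set_pmf R \<Longrightarrow> 0 < pmf Q x"
  shows "integrable (measure_pmf R) (\<lambda>x. pmf Q x / pmf R x)"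
    and "(\<integral>\<^sup>+ x. ennreal (pmf Q x / pmf R x) \<partial>measure_pmf R) \<le> 1"
proof -
  have "(\<integral>\<^sup>+ x. ennreal (pmf Q x / pmf R x) \<partial>measure_pmf R) =
      (\<integral>\<^sup>+ x. ennreal (pmf R x) * ennreal (pmf Q x / pmf R x) \<partial>count_space UNIV)"
    by (simp add: measure_pmf_eq_density nn_integral_density)
  also have "\<dots> \<le> (\<integral>\<^sup>+ x. ennreal (pmf Q x) \<partial>count_space UNIV)"
    by (intro nn_integral_mono) (auto simp: ennreal_mult[symmetric])
  also have "\<dots> = 1" by (rule nn_integral_pmf_eq_1)
  finally show le: "(\<integral>\<^sup>+ x. ennreal (pmf Q x / pmf R x) \<partial>measure_pmf R) \<le> 1" .
  show "integrable (measure_pmf R) (\<lambda>x. pmf Q x / pmf R x)"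
    by (rule integrableI_bounded) (use le in \<open>auto simp: le_less_trans\<close>)
qed

text \<open>The hypothesis bounds the logarithm from above; from below it is controlled by
  \<open>ln t \<le> t - 1\<close> and the integrability of the inverse ratio.\<close>

lemma integrable_log_ratio:
  assumes T: "\<And>x. x \<in> set_pmf R \<Longrightarrow> pmf R x \<le> T * pmf Q x" "0 < T"
  shows "integrable (measure_pmf R) (\<lambda>x. log 2 (pmf R x / pmf Q x))"
proof (rule Bochner_Integration.integrable_bound)
  have pos: "0 < pmf Q x" "0 < pmf R x" if "x \<in> set_pmf R" for x
  proof -
    show "0 < pmf R x" using that by (rule pmf_positive)
    then have "0 < T * pmf Q x" using T(1)[OF that] by linarith
    then show "0 < pmf Q x" using T(2) by (simp add: zero_less_mult_iff)
  qed
  show "integrable (measure_pmf R) (\<lambda>x. \<bar>log 2 T\<bar> + pmf Q x / pmf R x / ln 2)"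
    using integrable_pmf_ratio(1)[of R Q, OF pos(1)] by (simp del: divide_divide_eq_left)
  show "AE x in measure_pmf R. norm (log 2 (pmf R x / pmf Q x)) \<le> norm (\<bar>log 2 T\<bar> + pmf Q x / pmf R x / ln 2)"
  proof (rule AE_pmfI)
    fix x assume x: "x \<in> set_pmf R"
    note p = pos[OF x]
    have "log 2 (pmf R x / pmf Q x) \<le> log 2 T"
      using p T(1)[OF x] T(2) by (simp add: field_simps)
    moreover have "ln (pmf Q x / pmf R x) \<le> pmf Q x / pmf R x"
      using p ln_le_minus_one[of "pmf Q x / pmf R x"] by simp
    then have "ln (pmf Q x / pmf R x) / ln 2 \<le> pmf Q x / pmf R x / ln 2"
      by (rule divide_right_mono) simp
    moreover have "- log 2 (pmf R x / pmf Q x) = ln (pmf Q x / pmf R x) / ln 2"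
      using p by (simp add: log_def ln_div diff_divide_distrib)
    moreover have "0 \<le> pmf Q x / pmf R x / ln 2" by simp
    ultimately show "norm (log 2 (pmf R x / pmf Q x)) \<le> norm (\<bar>log 2 T\<bar> + pmf Q x / pmf R x / ln 2)"
      unfolding real_norm_def by linarith
  qed
qed simp

lemma distributed_pmf:
  fixes X :: "'a \<Rightarrow> 'b"
  shows "distributed (measure_pmf L) (count_space UNIV) X (\<lambda>x. ennreal (pmf (map_pmf X L) x))"
  unfolding distributed_def using measure_pmf_eq_density[of "map_pmf X L"] by (auto simp: map_pmf_rep_eq)

lemma integrable_count_space_pmf:
  fixes h :: "'a \<Rightarrow> real"
  assumes "integrable (measure_pmf L) h"
  shows "integrable (count_space UNIV) (\<lambda>x. pmf L x * h x)"
  using assms unfolding measure_pmf_eq_density by (subst (asm) integrable_density) auto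

lemma integral_count_space_pmf:
  fixes h :: "'a \<Rightarrow> real"
  shows "(\<integral>x. pmf L x * h x \<partial>count_space UNIV) = measure_pmf.expectation L h"
  unfolding measure_pmf_eq_density by (subst integral_density) auto

text \<open>The transcript, in the role of \<open>u\<close>, may take infinitely many values, so
  integrability is an issue. The masses of the finitely many pairs \<open>(v, w)\<close> are bounded
  below, hence the joint law is at most a constant times the product of its marginals.\<close>

lemma conditional_mutual_information_pmf:
  fixes L :: "('u::countable \<times> 'v::countable \<times> 'w::countable) pmf"
  assumes fin: "finite (snd ` set_pmf L)"
  shows "prob_space.conditional_mutual_information (measure_pmf L) 2
      (count_space UNIV) (count_space UNIV) (count_space UNIV) (\<lambda>(u, v, w). u) (\<lambda>(u, v, w). v) (\<lambda>(u, v, w). w) = cmi L"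
    (is ?eq)
    and "0 \<le> cmi L"
    and "integrable (measure_pmf L) (\<lambda>(u, v, w). log 2 (pmf L (u, v, w) * pmf (map_pmf (\<lambda>(u, v, w). w) L) w /
     (pmf (map_pmf (\<lambda>(u, v, w). (u, w)) L) (u, w) * pmf (map_pmf (\<lambda>(u, v, w). (v, w)) L) (v, w))))"
    (is "integrable _ ?h")
proof -
  interpret information_space "measure_pmf L" 2 by (rule information_space_pmf)
  let ?U = "map_pmf (\<lambda>(u, v, w). u) L" and ?W = "map_pmf (\<lambda>(u, v, w). w) L"
    and ?VW = "map_pmf (\<lambda>(u, v, w). (v, w)) L" and ?UW = "map_pmf (\<lambda>(u, v, w). (u, w)) L"
  have ids: "map_pmf (\<lambda>(u, v, w). (u, v, w)) L = L" "(\<lambda>(u, v, w). (v, w)) = (snd :: 'u \<times> 'v \<times> 'w \<Rightarrow> _)"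
    by (auto simp: fun_eq_iff)
  have pairs: "count_space UNIV \<Otimes>\<^sub>M count_space UNIV = (count_space UNIV :: ('p::countable \<times> 'q::countable) measure)"
    by (simp add: pair_measure_countable)
  have sf: "sigma_finite_measure (count_space UNIV :: 'p::countable measure)"
    by (intro sigma_finite_measure_count_space_countable) simp
  have pos: "0 < pmf L (u, v, w)" "0 < pmf ?U u" "0 < pmf ?W w" "0 < pmf ?VW (v, w)" "0 < pmf ?UW (u, w)"
    if "(u, v, w) \<in> set_pmf L" for u v w
    using pmf_map_pos[OF that, of "\<lambda>(u, v, w). u"] pmf_map_pos[OF that, of "\<lambda>(u, v, w). w"]
      pmf_map_pos[OF that, of "\<lambda>(u, v, w). (v, w)"] pmf_map_pos[OF that, of "\<lambda>(u, v, w). (u, w)"]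
      pmf_positive[OF that] by simp_all
  define S where "S = (\<lambda>(v, w). pmf ?VW (v, w)) ` (snd ` set_pmf L) \<union> (\<lambda>(v, w). pmf ?W w) ` (snd ` set_pmf L)"
  have finS: "finite S" "S \<noteq> {}" using fin set_pmf_not_empty[of L] by (auto simp: S_def)
  define \<mu> where "\<mu> = Min S"
  have "\<mu> \<in> S" unfolding \<mu>_def using finS by (rule Min_in)
  then have mu: "0 < \<mu>" using pos by (auto simp: S_def)
  have mu_le: "\<mu> \<le> pmf ?VW (v, w)" "\<mu> \<le> pmf ?W w" if "(u, v, w) \<in> set_pmf L" for u v w
    unfolding \<mu>_def using that finS(1) by (auto intro!: Min_le simp: S_def image_iff) force+
  define Q1 where "Q1 = pair_pmf ?U ?VW"
  define Q2 where "Q2 = pair_pmf ?U ?W"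
  have Q1: "pmf Q1 (u, v, w) = pmf ?U u * pmf ?VW (v, w)" for u v w by (simp add: Q1_def pmf_pair)
  have Q2: "pmf Q2 (u, w) = pmf ?U u * pmf ?W w" for u w by (simp add: Q2_def pmf_pair)
  have Q1': "pmf Q1 p = pmf ?U (fst p) * pmf ?VW (snd p)" for p by (cases p) (simp add: Q1_def pmf_pair)
  have Q2': "pmf Q2 p = pmf ?U (fst p) * pmf ?W (snd p)" for p by (cases p) (simp add: Q2_def pmf_pair)
  have int1: "integrable (measure_pmf L) (\<lambda>x. log 2 (pmf L x / pmf Q1 x))"
  proof (rule integrable_log_ratio[where T = "1 / \<mu>"])
    fix x assume x: "x \<in> set_pmf L"
    obtain u v w where xe: "x = (u, v, w)" by (metis surj_pair)
    have "pmf L (u, v, w) * \<mu> \<le> pmf ?U u * pmf ?VW (v, w)"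
      using pmf_le_pmf_map[of L "(u, v, w)" "\<lambda>(u, v, w). u"] mu_le(1)[of u v w] x xe mu
      by (intro mult_mono) auto
    then show "pmf L x \<le> 1 / \<mu> * pmf Q1 x" using mu by (simp add: xe Q1 field_simps)
  qed (use mu in simp)
  have int2: "integrable (measure_pmf ?UW) (\<lambda>x. log 2 (pmf ?UW x / pmf Q2 x))"
  proof (rule integrable_log_ratio[where T = "1 / \<mu>"])
    fix x assume x: "x \<in> set_pmf ?UW"
    then obtain u v w where uvw: "(u, v, w) \<in> set_pmf L" "x = (u, w)" by auto
    have "pmf (map_pmf fst ?UW) u = pmf ?U u" by (simp add: pmf.map_comp o_def case_prod_unfold)
    then have "pmf ?UW (u, w) * \<mu> \<le> pmf ?U u * pmf ?W w"
      using pmf_le_pmf_map[of ?UW "(u, w)" fst] mu_le(2)[OF uvw(1)] mu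
      by (intro mult_mono) auto
    then show "pmf ?UW x \<le> 1 / \<mu> * pmf Q2 x" using mu by (simp add: uvw Q2 field_simps)
  qed (use mu in simp)
  have int2': "integrable (measure_pmf L) (\<lambda>(u, v, w). log 2 (pmf ?UW (u, w) / pmf Q2 (u, w)))"
    using int2 by (simp add: case_prod_unfold)
  \<comment> \<open>The chain rule on the level of densities: the information of \<open>u\<close>
    about \<open>(v, w)\<close> minus that about \<open>w\<close>.\<close>
  have hd: "?h (u, v, w) = log 2 (pmf L (u, v, w) / pmf Q1 (u, v, w)) - log 2 (pmf ?UW (u, w) / pmf Q2 (u, w))"
    if "(u, v, w) \<in> set_pmf L" for u v w
    using pos[OF that] by (simp add: Q1 Q2 log_divide log_mult)
  have "integrable (measure_pmf L) (\<lambda>(u, v, w). log 2 (pmf L (u, v, w) / pmf Q1 (u, v, w)) - log 2 (pmf ?UW (u, w) / pmf Q2 (u, w)))"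
    using Bochner_Integration.integrable_diff[OF int1 int2'] by (simp add: case_prod_unfold)
  then show int: "integrable (measure_pmf L) ?h"
  proof (rule Bochner_Integration.integrable_cong_AE[THEN iffD1, rotated -1])
    show "AE x in measure_pmf L. (\<lambda>(u, v, w). log 2 (pmf L (u, v, w) / pmf Q1 (u, v, w)) -
        log 2 (pmf ?UW (u, w) / pmf Q2 (u, w))) x = ?h x"
    proof (rule AE_pmfI)
      fix x assume x: "x \<in> set_pmf L"
      obtain u v w where xe: "x = (u, v, w)" by (metis surj_pair)
      show "(\<lambda>(u, v, w). log 2 (pmf L (u, v, w) / pmf Q1 (u, v, w)) -
        log 2 (pmf ?UW (u, w) / pmf Q2 (u, w))) x = ?h x"
        using hd[OF x[unfolded xe]] by (simp only: xe prod.case)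
    qed
  qed simp_all
  have h_eq: "(\<lambda>(u, v, w). pmf L (u, v, w) * log 2 (pmf L (u, v, w) / (pmf ?UW (u, w) * (pmf ?VW (v, w) / pmf ?W w))))
      = (\<lambda>x. pmf L x * ?h x)"
    by (auto simp: fun_eq_iff)
  have I1: "integrable (count_space UNIV) (\<lambda>(u, v, w). pmf L (u, v, w) * log 2 (pmf L (u, v, w) / (pmf ?U u * pmf ?VW (v, w))))"
    using integrable_count_space_pmf[OF int1] by (simp add: case_prod_unfold Q1')
  have I2: "integrable (count_space UNIV) (\<lambda>(u, v, w). pmf L (u, v, w) * log 2 (pmf ?UW (u, w) / (pmf ?U u * pmf ?W w)))"
    using integrable_count_space_pmf[OF int2'] by (simp add: case_prod_unfold Q2')
  have dU: "distributed (measure_pmf L) (count_space UNIV) (\<lambda>(u, v, w). u) (\<lambda>x. ennreal (pmf ?U x))"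
    and dW: "distributed (measure_pmf L) (count_space UNIV) (\<lambda>(u, v, w). w) (\<lambda>x. ennreal (pmf ?W x))"
    by (rule distributed_pmf)+
  have dVW: "distributed (measure_pmf L) (count_space UNIV \<Otimes>\<^sub>M count_space UNIV)
      (\<lambda>x. ((\<lambda>(u, v, w). v) x, (\<lambda>(u, v, w). w) x)) (\<lambda>x. ennreal (pmf ?VW x))"
    and dUW: "distributed (measure_pmf L) (count_space UNIV \<Otimes>\<^sub>M count_space UNIV)
      (\<lambda>x. ((\<lambda>(u, v, w). u) x, (\<lambda>(u, v, w). w) x)) (\<lambda>x. ennreal (pmf ?UW x))"
    and dUVW: "distributed (measure_pmf L) (count_space UNIV \<Otimes>\<^sub>M count_space UNIV \<Otimes>\<^sub>M count_space UNIV)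
      (\<lambda>x. ((\<lambda>(u, v, w). u) x, (\<lambda>(u, v, w). v) x, (\<lambda>(u, v, w). w) x)) (\<lambda>x. ennreal (pmf L x))"
    using distributed_pmf[of L "\<lambda>(u, v, w). (v, w)"] distributed_pmf[of L "\<lambda>(u, v, w). (u, w)"]
      distributed_pmf[of L "\<lambda>(u, v, w). (u, v, w)"]
    unfolding pairs by (simp_all add: case_prod_unfold)
  note gen = sf sf sf dU pmf_nonneg dW pmf_nonneg dVW pmf_nonneg dUW pmf_nonneg dUVW pmf_nonneg
  show ?eq
  proof -
    have "prob_space.conditional_mutual_information (measure_pmf L) 2 (count_space UNIV) (count_space UNIV) (count_space UNIV)
        (\<lambda>(u, v, w). u) (\<lambda>(u, v, w). v) (\<lambda>(u, v, w). w) =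
      (\<integral>(u, v, w). pmf L (u, v, w) * log 2 (pmf L (u, v, w) / (pmf ?UW (u, w) * (pmf ?VW (v, w) / pmf ?W w)))
        \<partial>(count_space UNIV \<Otimes>\<^sub>M count_space UNIV \<Otimes>\<^sub>M count_space UNIV))"
      by (rule conditional_mutual_information_generic_eq[OF gen]) (use I1 I2 in \<open>simp_all add: pairs\<close>)
    also have "\<dots> = cmi L"
      unfolding pairs h_eq integral_count_space_pmf cmi_def ..
    finally show ?thesis .
  qed
  have "0 \<le> prob_space.conditional_mutual_information (measure_pmf L) 2
      (count_space UNIV) (count_space UNIV) (count_space UNIV) (\<lambda>(u, v, w). u) (\<lambda>(u, v, w). v) (\<lambda>(u, v, w). w)"
    by (rule conditional_mutual_information_generic_nonneg[OF gen])
      (use I1 I2 in \<open>simp_all add: pairs\<close>)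
  then show "0 \<le> cmi L" using \<open>?eq\<close> by simp
qed

lemma leakage_eq:
  fixes p :: "('a::countable \<times> 'b::countable) pmf" and \<pi> :: "('a, 'b, 'c::countable) protocol"
  assumes \<pi>: "protocol_for p \<pi>" and fin: "finite ((\<lambda>(x, y, m, z). (x, y, z)) ` set_pmf (law p \<pi>))"
  shows "leakage p \<pi> = cmi (map_pmf (\<lambda>(x, y, m, z). (m, (y, z), x)) (law p \<pi>))" (is "_ = cmi ?L")
proof -
  note R = prob_space_run[OF \<pi>] and P = prob_space_measure_pmf[of ?L]
  define F where "F = (\<lambda>\<omega>. (rv_M \<pi> \<omega>, (inp_B \<omega>, rv_Z \<pi> \<omega>), inp_A \<omega>))"
  have F: "F \<in> measurable (run p \<pi>) (count_space UNIV)"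
    using measurable_compose[OF measurable_all[OF \<pi>], of "\<lambda>(x, y, m, z). (m, (y, z), x)" "count_space UNIV"]
    by (simp add: F_def)
  have L: "measure_pmf ?L = distr (run p \<pi>) (count_space UNIV) F"
    unfolding map_pmf_rep_eq measure_pmf_law[OF \<pi>]
    by (subst distr_distr[OF _ measurable_all[OF \<pi>]]) (auto simp: o_def F_def)
  have d: "distr (run p \<pi>) N (\<lambda>\<omega>. g (F \<omega>)) = distr (measure_pmf ?L) N g" if "space N = UNIV" for N :: "'n measure" and g
    unfolding L using that by (subst distr_distr[OF _ F]) (auto simp: o_def)
  have sp: "space (count_space UNIV \<Otimes>\<^sub>M count_space UNIV) = UNIV"
    "space (count_space UNIV \<Otimes>\<^sub>M count_space UNIV \<Otimes>\<^sub>M count_space UNIV) = UNIV"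
    by (auto simp: space_pair_measure)
  have "leakage p \<pi> = prob_space.conditional_mutual_information (measure_pmf ?L) 2 (count_space UNIV) (count_space UNIV) (count_space UNIV)
      (\<lambda>(u, v, w). u) (\<lambda>(u, v, w). v) (\<lambda>(u, v, w). w)"
    unfolding leakage_def prob_space.conditional_mutual_information_def[OF R]
      prob_space.conditional_mutual_information_def[OF P]
      prob_space.mutual_information_def[OF R] prob_space.mutual_information_def[OF P]
    using d[of "count_space UNIV" "\<lambda>(u, v, w). u"] d[of "count_space UNIV" "\<lambda>(u, v, w). w"]
      d[OF sp(1), of "\<lambda>(u, v, w). (v, w)"] d[OF sp(1), of "\<lambda>(u, v, w). (u, w)"]
      d[OF sp(2), of "\<lambda>(u, v, w). (u, v, w)"]
    by (simp add: F_def case_prod_unfold)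
  also have "\<dots> = cmi ?L"
  proof (rule conditional_mutual_information_pmf(1))
    have "snd ` set_pmf ?L = (\<lambda>(x, y, z). ((y, z), x)) ` (\<lambda>(x, y, m, z). (x, y, z)) ` set_pmf (law p \<pi>)"
      by (auto simp: image_image case_prod_unfold)
    then show "finite (snd ` set_pmf ?L)" using fin by simp
  qed
  finally show ?thesis .
qed

section \<open>A weak law of large numbers\<close>

lemma replicate_pmf_Suc_pair: "replicate_pmf (Suc n) e = map_pmf (\<lambda>(t, ts). t # ts) (pair_pmf e (replicate_pmf n e))"
  by (simp add: pair_pmf_def map_bind_pmf bind_assoc_pmf bind_return_pmf map_pmf_def)

lemma finite_set_replicate_pmf: "finite (set_pmf e) \<Longrightarrow> finite (set_pmf (replicate_pmf n e))"
  unfolding set_replicate_pmf by (rule finite_subset[OF _ finite_lists_length_eq[of "set_pmf e" n]]) auto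

lemma expectation_pair_pmf_mult:
  fixes f :: "'a \<Rightarrow> real" and g :: "'b \<Rightarrow> real"
  assumes "finite (set_pmf p)" "finite (set_pmf q)"
  shows "measure_pmf.expectation (pair_pmf p q) (\<lambda>(x, y). f x * g y) =
    measure_pmf.expectation p f * measure_pmf.expectation q g"
proof -
  have "measure_pmf.expectation (pair_pmf p q) (\<lambda>(x, y). f x * g y) =
      (\<Sum>(x, y)\<in>set_pmf p \<times> set_pmf q. pmf p x * f x * (pmf q y * g y))"
    using assms by (subst expectation_finite) (auto simp: pmf_pair intro!: sum.cong)
  also have "\<dots> = (\<Sum>x\<in>set_pmf p. \<Sum>y\<in>set_pmf q. pmf p x * f x * (pmf q y * g y))"
    by (rule sum.cartesian_product[symmetric])
  also have "\<dots> = measure_pmf.expectation p f * measure_pmf.expectation q g"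
    using assms by (simp add: expectation_finite sum_product)
  finally show ?thesis .
qed

lemma second_moment_replicate_pmf:
  fixes h :: "'a \<Rightarrow> real"
  assumes fin: "finite (set_pmf e)" and zero: "measure_pmf.expectation e h = 0"
  shows "measure_pmf.expectation (replicate_pmf n e) (\<lambda>ts. (\<Sum>t\<leftarrow>ts. h t)\<^sup>2)
    = real n * measure_pmf.expectation e (\<lambda>t. (h t)\<^sup>2)"
proof (induction n)
  case (Suc n)
  let ?R = "replicate_pmf n e" and ?S = "\<lambda>ts. \<Sum>t\<leftarrow>ts. h t"
  have finR: "finite (set_pmf ?R)" by (rule finite_set_replicate_pmf[OF fin])
  have int: "integrable (measure_pmf (pair_pmf e ?R)) g" for g :: "_ \<Rightarrow> real"
    using fin finR by (intro integrable_measure_pmf_finite) simp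
  have "measure_pmf.expectation (replicate_pmf (Suc n) e) (\<lambda>ts. (?S ts)\<^sup>2) =
      measure_pmf.expectation (pair_pmf e ?R) (\<lambda>(t, ts). (h t)\<^sup>2 * 1 + 2 * (h t * ?S ts) + 1 * (?S ts)\<^sup>2)"
    unfolding replicate_pmf_Suc_pair integral_map_pmf
    by (intro Bochner_Integration.integral_cong) (auto simp: power2_sum)
  also have "\<dots> = measure_pmf.expectation (pair_pmf e ?R) (\<lambda>(t, ts). (h t)\<^sup>2 * 1) +
      2 * measure_pmf.expectation (pair_pmf e ?R) (\<lambda>(t, ts). h t * ?S ts) +
      measure_pmf.expectation (pair_pmf e ?R) (\<lambda>(t, ts). 1 * (?S ts)\<^sup>2)"
    unfolding case_prod_unfold by (simp only: Bochner_Integration.integral_add[OF int int] integral_mult_right_zero)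
  also have "\<dots> = measure_pmf.expectation e (\<lambda>t. (h t)\<^sup>2) + real n * measure_pmf.expectation e (\<lambda>t. (h t)\<^sup>2)"
    unfolding expectation_pair_pmf_mult[OF fin finR] Suc.IH zero by simp
  finally show ?case by (simp add: algebra_simps)
qed simp

text \<open>Chebyshev's inequality; the second moment of the centred sum grows only linearly because
  the cross terms vanish.\<close>

lemma weak_law:
  fixes h :: "'a \<Rightarrow> real"
  assumes fin: "finite (set_pmf e)" and "0 < \<delta>" "1 \<le> n"
  shows "measure_pmf.prob (replicate_pmf n e) {ts. real n * (measure_pmf.expectation e h + \<delta>) \<le> (\<Sum>t\<leftarrow>ts. h t)}
    \<le> measure_pmf.expectation e (\<lambda>t. (h t - measure_pmf.expectation e h)\<^sup>2) / (real n * \<delta>\<^sup>2)"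
proof -
  let ?R = "replicate_pmf n e"
  define \<mu> where "\<mu> = measure_pmf.expectation e h"
  define h' where "h' t = h t - \<mu>" for t
  have finR: "finite (set_pmf ?R)" by (rule finite_set_replicate_pmf[OF fin])
  have zero: "measure_pmf.expectation e h' = 0"
    unfolding h'_def using fin by (subst Bochner_Integration.integral_diff) (auto simp: \<mu>_def integrable_measure_pmf_finite)
  have sum_h': "(\<Sum>t\<leftarrow>ts. h' t) = (\<Sum>t\<leftarrow>ts. h t) - real (length ts) * \<mu>" for ts
    by (induction ts) (auto simp: h'_def algebra_simps)
  have "(real n * \<delta>)\<^sup>2 * measure_pmf.prob ?R {ts. real n * (\<mu> + \<delta>) \<le> (\<Sum>t\<leftarrow>ts. h t)} =
      measure_pmf.expectation ?R (\<lambda>ts. (real n * \<delta>)\<^sup>2 * indicator {ts. real n * (\<mu> + \<delta>) \<le> (\<Sum>t\<leftarrow>ts. h t)} ts)"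
    by simp
  also have "\<dots> \<le> measure_pmf.expectation ?R (\<lambda>ts. (\<Sum>t\<leftarrow>ts. h' t)\<^sup>2)"
  proof (rule integral_mono_AE)
    show "AE ts in ?R. (real n * \<delta>)\<^sup>2 * indicator {ts. real n * (\<mu> + \<delta>) \<le> (\<Sum>t\<leftarrow>ts. h t)} ts \<le> (\<Sum>t\<leftarrow>ts. h' t)\<^sup>2"
    proof (rule AE_pmfI)
      fix ts assume "ts \<in> set_pmf ?R"
      then have len: "length ts = n" by (auto simp: set_replicate_pmf)
      show "(real n * \<delta>)\<^sup>2 * indicator {ts. real n * (\<mu> + \<delta>) \<le> (\<Sum>t\<leftarrow>ts. h t)} ts \<le> (\<Sum>t\<leftarrow>ts. h' t)\<^sup>2"
      proof (cases "real n * (\<mu> + \<delta>) \<le> (\<Sum>t\<leftarrow>ts. h t)")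
        case True
        then have "real n * \<delta> \<le> (\<Sum>t\<leftarrow>ts. h' t)" by (simp add: sum_h' len algebra_simps)
        then have "(real n * \<delta>)\<^sup>2 \<le> (\<Sum>t\<leftarrow>ts. h' t)\<^sup>2" using \<open>0 < \<delta>\<close> by (intro power_mono) auto
        then show ?thesis using True by simp
      qed simp
    qed
  qed (use finR in \<open>auto intro!: integrable_measure_pmf_finite\<close>)
  also have "\<dots> = real n * measure_pmf.expectation e (\<lambda>t. (h' t)\<^sup>2)"
    by (rule second_moment_replicate_pmf[OF fin zero])
  finally show ?thesis
    using assms(2,3) unfolding \<mu>_def[symmetric] h'_def by (simp add: field_simps power2_eq_square)
qed

section \<open>Products of kernels\<close>

lemma set_prod_list_pmf: "set_pmf (prod_list_pmf qs) = {zs. list_all2 (\<lambda>z q. z \<in> set_pmf q) zs qs}"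
proof (induction qs)
  case (Cons q qs)
  show ?case
  proof (rule set_eqI)
    fix zs show "zs \<in> set_pmf (prod_list_pmf (q # qs)) \<longleftrightarrow> zs \<in> {zs. list_all2 (\<lambda>z q. z \<in> set_pmf q) zs (q # qs)}"
      by (cases zs) (auto simp: Cons.IH)
  qed
qed auto

lemma length_prod_list_pmf: "zs \<in> set_pmf (prod_list_pmf qs) \<Longrightarrow> length zs = length qs"
  by (auto simp: set_prod_list_pmf dest: list_all2_lengthD)

lemma set_iid: "set_pmf (iid n p) = {(xs, ys). length xs = n \<and> length ys = n \<and> (\<forall>i<n. (xs ! i, ys ! i) \<in> set_pmf p)}"
proof (rule set_eqI, unfold split_paired_all)
  fix xs ys
  show "(xs, ys) \<in> set_pmf (iid n p) \<longleftrightarrow> (xs, ys) \<in> {(xs, ys). length xs = n \<and> length ys = n \<and> (\<forall>i<n. (xs ! i, ys ! i) \<in> set_pmf p)}"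
  proof (cases "length xs = n \<and> length ys = n")
    case True
    then show ?thesis by (simp add: set_pmf_iff pmf_iid) (simp add: Ball_def)
  next
    case False
    then show ?thesis by (auto simp: iid_def set_replicate_pmf)
  qed
qed

lemma finite_set_iid:
  fixes p :: "('x::finite \<times> 'y::finite) pmf"
  shows "finite (set_pmf (iid n p))"
  unfolding iid_def by (simp add: finite_set_replicate_pmf)

lemma pmf_extend_by: "pmf (extend_by p q) (w, x, y) = pmf p (x, y) * pmf (q x) w"
proof -
  have "pmf (map_pmf (\<lambda>w. (w, x', y')) (q x')) (w, x, y) = indicator {(x, y)} (x', y') * pmf (q x) w" for x' y'
  proof (cases "x' = x \<and> y' = y")
    case True
    have "inj (\<lambda>w. (w, x, y))" by (simp add: inj_def)
    from pmf_map_inj'[OF this, of "q x" w] show ?thesis using True by simp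
  next
    case False
    then have "(w, x, y) \<notin> (\<lambda>w. (w, x', y')) ` set_pmf (q x')" by auto
    then have "pmf (map_pmf (\<lambda>w. (w, x', y')) (q x')) (w, x, y) = 0"
      by (simp add: pmf_eq_0_set_pmf)
    then show ?thesis using False by (auto simp: indicator_def)
  qed
  note inner = this
  have "pmf (extend_by p q) (w, x, y) = measure_pmf.expectation p (\<lambda>xy. indicator {(x, y)} xy * pmf (q x) w)"
    unfolding extend_by_def pmf_bind
    by (intro Bochner_Integration.integral_cong refl) (simp only: split_paired_all prod.case inner)
  then show ?thesis by (simp add: measure_pmf_single)
qed

text \<open>A transposition of lists of triples. It turns the log-likelihood ratio of the n-fold
  kernels into a sum of independent terms, to which the weak law applies.\<close>

lemma extend_by_iid:
  "extend_by (iid n p) (\<lambda>xs. prod_list_pmf (map q xs)) =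
    map_pmf (\<lambda>ts. (map fst ts, map (fst \<circ> snd) ts, map (snd \<circ> snd) ts)) (replicate_pmf n (extend_by p q))"
    (is "?L = map_pmf ?f ?R")
proof (rule pmf_eqI, unfold split_paired_all)
  fix ws xs ys
  show "pmf ?L (ws, xs, ys) = pmf (map_pmf ?f ?R) (ws, xs, ys)"
  proof (cases "length ws = n \<and> length xs = n \<and> length ys = n")
    case True
    let ?ts = "zip ws (zip xs ys)"
    have inj: "inj ?f"
    proof (rule injI)
      fix ts us assume "?f ts = ?f us"
      then have "map fst ts = map fst us" "map fst (map snd ts) = map fst (map snd us)"
        "map snd (map snd ts) = map snd (map snd us)" by simp_all
      then show "ts = us" by (metis zip_map_fst_snd)
    qed
    have f: "?f ?ts = (ws, xs, ys)" using True
      by (simp add: map_map[symmetric] del: map_map)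
    have "pmf (map_pmf ?f ?R) (ws, xs, ys) = pmf ?R ?ts"
      using pmf_map_inj'[OF inj, of ?R ?ts] unfolding f .
    also have "\<dots> = (\<Prod>i<n. pmf p (xs ! i, ys ! i) * pmf (q (xs ! i)) (ws ! i))"
      using True by (simp add: replicate_pmf_eq_prod_list_pmf pmf_prod_list_pmf pmf_extend_by)
    also have "\<dots> = pmf ?L (ws, xs, ys)"
      using True by (simp add: pmf_extend_by pmf_iid pmf_prod_list_pmf prod.distrib)
    finally show ?thesis by simp
  next
    case False
    have "(ws, xs, ys) \<notin> set_pmf ?L"
      using False by (auto simp: extend_by_def set_iid dest!: length_prod_list_pmf)
    moreover have "(ws, xs, ys) \<notin> set_pmf (map_pmf ?f ?R)"
      using False by (auto simp: set_replicate_pmf)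
    ultimately have "pmf ?L (ws, xs, ys) = 0" "pmf (map_pmf ?f ?R) (ws, xs, ys) = 0"
      by (simp_all only: set_pmf_iff not_not)
    then show ?thesis by simp
  qed
qed

section \<open>Achievability\<close>

lemma pmf_cond_component:
  assumes "y \<in> snd ` snd ` set_pmf e"
  shows "pmf (map_pmf fst (cond_pmf e {t. snd (snd t) = y})) w =
    pmf (map_pmf (\<lambda>(w, x, y). (w, y)) e) (w, y) / pmf (map_pmf (\<lambda>(w, x, y). y) e) y"
proof -
  let ?S = "{t. snd (snd t) = y}"
  have ne: "set_pmf e \<inter> ?S \<noteq> {}" using assms by auto
  have "emeasure (measure_pmf e) ?S \<noteq> 0"
    using ne by (auto simp: measure_pmf.emeasure_eq_measure measure_pmf_zero_iff)
  then have A: "pmf (map_pmf fst (cond_pmf e ?S)) w = measure_pmf.prob e (?S \<inter> fst -` {w}) / measure_pmf.prob e ?S"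
    unfolding pmf_map cond_pmf.rep_eq[OF ne] by (subst measure_uniform_measure) auto
  have e1: "?S \<inter> fst -` {w} = (\<lambda>(w, x, y). (w, y)) -` {(w, y)}" by auto
  have e2: "?S = (\<lambda>(w, x, y). y) -` {y}" by auto
  show ?thesis
    unfolding A pmf_map[of "\<lambda>(w, x, y). (w, y)"] pmf_map[of "\<lambda>(w, x, y). y"]
      e1[symmetric] e2[symmetric] ..
qed

context
  fixes p :: "('x::finite \<times> 'y::finite) pmf" and q :: "'x \<Rightarrow> 'w::finite pmf"
  assumes fullY: "snd ` set_pmf p = UNIV"
begin

text \<open>The conditional law of \<open>W\<close> given \<open>Y = y\<close>: what Bob knows about
  Alice's word from his own input.\<close>

definition "bob_kernel y = map_pmf fst (cond_pmf (extend_by p q) {t. snd (snd t) = y})"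

text \<open>Since \<open>W\<close> depends on \<open>Y\<close> through \<open>X\<close> only, this
  log-ratio of the laws of \<open>W\<close> given \<open>(X, Y)\<close> and given \<open>Y\<close>
  is the density of \<open>I(W; X | Y)\<close>.\<close>

definition "info_density t = log 2 (pmf (q (fst (snd t))) (fst t) / pmf (bob_kernel (snd (snd t))) (fst t))"

lemma map_extend_by: "map_pmf snd (extend_by p q) = p"
proof -
  have "map_pmf snd (extend_by p q) = bind_pmf p (\<lambda>(x, y). return_pmf (x, y))"
    unfolding extend_by_def map_bind_pmf
    by (intro bind_pmf_cong refl) (auto simp: pmf.map_comp o_def map_pmf_const)
  then show ?thesis by (simp add: bind_return_pmf')
qed

lemma set_extend_by: "(w, x, y) \<in> set_pmf (extend_by p q) \<longleftrightarrow> (x, y) \<in> set_pmf p \<and> w \<in> set_pmf (q x)"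
  by (auto simp: set_pmf_iff pmf_extend_by)

lemma pmf_bob_kernel:
  "pmf (bob_kernel y) w = pmf (map_pmf (\<lambda>(w, x, y). (w, y)) (extend_by p q)) (w, y) /
    pmf (map_pmf (\<lambda>(w, x, y). y) (extend_by p q)) y"
proof -
  have "snd ` snd ` set_pmf (extend_by p q) = snd ` set_pmf p"
    using arg_cong[OF map_extend_by, of "\<lambda>P. snd ` set_pmf P"] by simp
  then show ?thesis unfolding bob_kernel_def using fullY by (intro pmf_cond_component) simp
qed

lemma pos_kernels:
  assumes "(w, x, y) \<in> set_pmf (extend_by p q)"
  shows "0 < pmf (q x) w" "0 < pmf (bob_kernel y) w"
proof -
  show "0 < pmf (q x) w" using assms by (simp add: set_extend_by pmf_positive)
  show "0 < pmf (bob_kernel y) w"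
    unfolding pmf_bob_kernel
    using pmf_map_pos[OF assms, of "\<lambda>(w, x, y). (w, y)"] pmf_map_pos[OF assms, of "\<lambda>(w, x, y). y"] by simp
qed

lemma cmi_extend_by: "cmi (extend_by p q) = measure_pmf.expectation (extend_by p q) info_density"
  unfolding cmi_def
proof (intro integral_cong_AE AE_pmfI)
  fix t assume t: "t \<in> set_pmf (extend_by p q)"
  obtain w x y where te: "t = (w, x, y)" by (metis surj_pair)
  have "map_pmf (\<lambda>(w, x, y). (x, y)) (extend_by p q) = p"
    using map_extend_by by (simp add: case_prod_unfold)
  moreover have "0 < pmf p (x, y)" using t by (simp add: te set_extend_by pmf_positive)
  moreover note pos_kernels[OF t[unfolded te]] pmf_map_pos[OF t[unfolded te], of "\<lambda>(w, x, y). y"]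
    pmf_map_pos[OF t[unfolded te], of "\<lambda>(w, x, y). (w, y)"]
  ultimately show "(case t of (u, v, w) \<Rightarrow> log 2 (pmf (extend_by p q) (u, v, w) *
      pmf (map_pmf (\<lambda>(u, v, w). w) (extend_by p q)) w /
      (pmf (map_pmf (\<lambda>(u, v, w). (u, w)) (extend_by p q)) (u, w) *
       pmf (map_pmf (\<lambda>(u, v, w). (v, w)) (extend_by p q)) (v, w)))) = info_density t"
    by (simp add: te info_density_def pmf_extend_by pmf_bob_kernel mult_ac)
qed simp_all

lemma info_density_list:
  assumes "set ts \<subseteq> set_pmf (extend_by p q)"
  shows "0 < pmf (prod_list_pmf (map (q \<circ> fst \<circ> snd) ts)) (map fst ts) \<and>
    0 < pmf (prod_list_pmf (map (bob_kernel \<circ> snd \<circ> snd) ts)) (map fst ts) \<and>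
    pmf (prod_list_pmf (map (q \<circ> fst \<circ> snd) ts)) (map fst ts) /
      pmf (prod_list_pmf (map (bob_kernel \<circ> snd \<circ> snd) ts)) (map fst ts) = 2 powr (\<Sum>t\<leftarrow>ts. info_density t)"
  using assms
proof (induction ts)
  case (Cons t ts)
  obtain w x y where te: "t = (w, x, y)" by (metis surj_pair)
  have t: "(w, x, y) \<in> set_pmf (extend_by p q)" using Cons.prems by (simp add: te)
  have "2 powr info_density t = pmf (q x) w / pmf (bob_kernel y) w"
    using pos_kernels[OF t] by (simp add: info_density_def te)
  then show ?case
    using Cons.IH Cons.prems pos_kernels[OF t]
    by (simp add: te pmf_map_inj_Cons powr_add times_divide_times_eq[symmetric] del: times_divide_times_eq)
qed simp

lemma expectation_extend_by:
  fixes P :: "('a \<times> 'b) pmf" and Q :: "'a \<Rightarrow> 'v pmf"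
  assumes finP: "finite (set_pmf P)" and finW: "finite W" and sub: "\<And>x y. (x, y) \<in> set_pmf P \<Longrightarrow> set_pmf (Q x) \<subseteq> W"
  shows "measure_pmf.expectation (extend_by P Q) \<phi> =
    (\<Sum>(x, y)\<in>set_pmf P. pmf P (x, y) * (\<Sum>w\<in>W. pmf (Q x) w * \<phi> (w, x, y)))"
proof -
  have "measure_pmf.expectation (extend_by P Q) \<phi> = (\<Sum>t\<in>W \<times> set_pmf P. \<phi> t * pmf (extend_by P Q) t)"
  proof (rule integral_measure_pmf_real)
    fix t assume "t \<in> set_pmf (extend_by P Q)"
    then show "t \<in> W \<times> set_pmf P" using sub by (fastforce simp: extend_by_def)
  qed (use finP finW in simp)
  also have "\<dots> = (\<Sum>w\<in>W. \<Sum>xy\<in>set_pmf P. pmf P xy * (pmf (Q (fst xy)) w * \<phi> (w, xy)))"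
    unfolding sum.cartesian_product'
    by (intro sum.cong refl) (auto simp: pmf_extend_by mult_ac split_paired_all)
  also have "\<dots> = (\<Sum>xy\<in>set_pmf P. pmf P xy * (\<Sum>w\<in>W. pmf (Q (fst xy)) w * \<phi> (w, xy)))"
    by (subst sum.swap) (simp add: sum_distrib_left)
  finally show ?thesis by (simp add: case_prod_unfold)
qed

text \<open>The matching code for the product kernels with \<open>2 ^ k\<close> bins. It succeeds
  with probability at least the mean of \<open>1 / (1 + s / 2 ^ k)\<close>, where \<open>s\<close>
  is two to the power of the sum of the information densities, and the weak law bounds the
  probability that this sum exceeds its mean by \<open>n * \<delta>\<close> or more.\<close>

lemma code_exists:
  assumes n: "1 \<le> n" and \<delta>: "0 < \<delta>"
  shows "\<exists>(f :: 'x list \<Rightarrow> nat) g. (\<forall>xs. f xs < 2 ^ k) \<and>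
    (1 - measure_pmf.expectation (extend_by p q) (\<lambda>t. (info_density t - cmi (extend_by p q))\<^sup>2) / (real n * \<delta>\<^sup>2))
      / (1 + 2 powr (real n * (cmi (extend_by p q) + \<delta>)) / 2 ^ k)
    \<le> measure_pmf.prob (iid n p) {(xs, ys). g ys (f xs) \<in> set_pmf (prod_list_pmf (map q xs))}"
proof -
  let ?e = "extend_by p q"
  define W where "W = {ws :: 'w list. length ws = n}"
  have finW: "finite W" using finite_lists_length_eq[of "UNIV :: 'w set" n] by (simp add: W_def)
  let ?qn = "\<lambda>xs. prod_list_pmf (map q xs)" and ?rn = "\<lambda>ys. prod_list_pmf (map bob_kernel ys)"
  let ?P = "iid n p"
  define I where "I = cmi ?e"
  define \<phi> where "\<phi> = (\<lambda>(ws, xs, ys). pmf (?rn ys) ws / (pmf (?rn ys) ws + pmf (?qn xs) ws / 2 ^ k))"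
  define c where "c = 1 / (1 + 2 powr (real n * (I + \<delta>)) / 2 ^ k)"
  define B where "B = {ts. real n * (I + \<delta>) \<le> (\<Sum>t\<leftarrow>ts. info_density t)}"
  let ?R = "replicate_pmf n ?e"
  have c0: "0 \<le> c" by (simp add: c_def add_nonneg_nonneg)
  obtain f :: "'x list \<Rightarrow> nat" and g where f: "\<And>xs. f xs < 2 ^ k"
    and g: "(\<Sum>(xs, ys)\<in>set_pmf ?P. pmf ?P (xs, ys) *
       (\<Sum>ws\<in>W. pmf (?qn xs) ws * pmf (?rn ys) ws / (pmf (?rn ys) ws + pmf (?qn xs) ws / real (2 ^ k))))
      \<le> measure_pmf.prob ?P {(xs, ys). g ys (f xs) \<in> set_pmf (?qn xs)}"
    using matching_code[OF finite_set_iid[of n p] finW, of "2 ^ k" ?qn ?rn] by auto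
  have "(\<Sum>(xs, ys)\<in>set_pmf ?P. pmf ?P (xs, ys) *
       (\<Sum>ws\<in>W. pmf (?qn xs) ws * pmf (?rn ys) ws / (pmf (?rn ys) ws + pmf (?qn xs) ws / real (2 ^ k))))
      = measure_pmf.expectation (extend_by ?P ?qn) \<phi>"
    by (subst expectation_extend_by[OF finite_set_iid finW])
      (auto simp: \<phi>_def W_def set_iid dest: length_prod_list_pmf)
  also have "\<dots> = measure_pmf.expectation ?R (\<lambda>ts. \<phi> (map fst ts, map (fst \<circ> snd) ts, map (snd \<circ> snd) ts))"
    unfolding extend_by_iid by simp
  also have "\<dots> \<ge> measure_pmf.expectation ?R (\<lambda>ts. c * indicator (- B) ts)"
  proof (intro integral_mono_AE AE_pmfI)
    fix ts assume "ts \<in> set_pmf ?R"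
    then have sub: "set ts \<subseteq> set_pmf ?e" by (auto simp: set_replicate_pmf)
    let ?q = "pmf (prod_list_pmf (map (q \<circ> fst \<circ> snd) ts)) (map fst ts)"
    let ?r = "pmf (prod_list_pmf (map (bob_kernel \<circ> snd \<circ> snd) ts)) (map fst ts)"
    have pos: "0 < ?q" "0 < ?r" and ratio: "?q / ?r = 2 powr (\<Sum>t\<leftarrow>ts. info_density t)"
      using info_density_list[OF sub] by auto
    have \<phi>: "\<phi> (map fst ts, map (fst \<circ> snd) ts, map (snd \<circ> snd) ts) = 1 / (1 + ?q / ?r / 2 ^ k)"
      using pos by (simp add: \<phi>_def comp_assoc field_simps)
    show "c * indicator (- B) ts \<le> \<phi> (map fst ts, map (fst \<circ> snd) ts, map (snd \<circ> snd) ts)"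
    proof (cases "ts \<in> B")
      case True
      then show ?thesis using pos unfolding \<phi> by simp
    next
      case False
      then have "2 powr (\<Sum>t\<leftarrow>ts. info_density t) \<le> 2 powr (real n * (I + \<delta>))" by (simp add: B_def)
      then have "c \<le> 1 / (1 + 2 powr (\<Sum>t\<leftarrow>ts. info_density t) / 2 ^ k)"
        unfolding c_def by (intro divide_left_mono add_left_mono divide_right_mono mult_pos_pos add_pos_pos) auto
      then show ?thesis using False unfolding \<phi> ratio by simp
    qed
  qed (auto intro!: integrable_measure_pmf_finite finite_set_replicate_pmf)
  also have "measure_pmf.expectation ?R (\<lambda>ts. c * indicator (- B) ts) = c * (1 - measure_pmf.prob ?R B)"
    by (simp add: measure_pmf.prob_compl[of B ?R, simplified, symmetric] Compl_eq_Diff_UNIV)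
  finally have "c * (1 - measure_pmf.prob ?R B) \<le> measure_pmf.prob ?P {(xs, ys). g ys (f xs) \<in> set_pmf (?qn xs)}"
    using g by linarith
  moreover have "measure_pmf.prob ?R B \<le> measure_pmf.expectation ?e (\<lambda>t. (info_density t - I)\<^sup>2) / (real n * \<delta>\<^sup>2)"
    using weak_law[of ?e \<delta> n info_density] n \<delta> by (simp add: B_def I_def cmi_extend_by)
  ultimately have "c * (1 - measure_pmf.expectation ?e (\<lambda>t. (info_density t - I)\<^sup>2) / (real n * \<delta>\<^sup>2))
      \<le> measure_pmf.prob ?P {(xs, ys). g ys (f xs) \<in> set_pmf (?qn xs)}"
    using c0 by (smt (verit) mult_left_mono)
  then show ?thesis using f unfolding c_def I_def by (intro exI[of _ f] exI[of _ g]) simp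
qed

end

section \<open>From codes to secure protocols\<close>

lemma finite_lists_length: "finite {xs :: 'a::finite list. length xs = n}"
  using finite_lists_length_eq[of "UNIV :: 'a set" n] by simp

lemma prob_cong_set_pmf:
  assumes "\<And>t. t \<in> set_pmf L \<Longrightarrow> t \<in> A \<longleftrightarrow> t \<in> B"
  shows "measure_pmf.prob L A = measure_pmf.prob L B"
  using assms by (intro measure_pmf.finite_measure_eq_AE AE_pmfI) auto

lemma cmi_deterministic:
  assumes F: "\<And>u v w. (u, v, w) \<in> set_pmf L \<Longrightarrow> u = F w"
  shows "cmi L = 0"
proof -
  have "cmi L = measure_pmf.expectation L (\<lambda>_. 0)"
    unfolding cmi_def
  proof (intro integral_cong_AE AE_pmfI)
    fix t assume t: "t \<in> set_pmf L"
    obtain u v w where te: "t = (u, v, w)" by (metis surj_pair)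
    have u: "u = F w" using F t by (simp add: te)
    have 1: "pmf L (u, v, w) = pmf (map_pmf (\<lambda>(u, v, w). (v, w)) L) (v, w)"
      unfolding pmf_map
      by (subst measure_pmf_single[symmetric], rule prob_cong_set_pmf) (auto simp: u dest: F)
    have 2: "pmf (map_pmf (\<lambda>(u, v, w). (u, w)) L) (u, w) = pmf (map_pmf (\<lambda>(u, v, w). w) L) w"
      unfolding pmf_map by (rule prob_cong_set_pmf) (auto simp: u dest: F)
    have "0 < pmf L (u, v, w)" "0 < pmf (map_pmf (\<lambda>(u, v, w). w) L) w"
      using t te pmf_map_pos[of "(u, v, w)" L "\<lambda>(u, v, w). w"] by (auto intro: pmf_positive)
    then show "(case t of (u, v, w) \<Rightarrow> log 2 (pmf L (u, v, w) * pmf (map_pmf (\<lambda>(u, v, w). w) L) w /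
        (pmf (map_pmf (\<lambda>(u, v, w). (u, w)) L) (u, w) * pmf (map_pmf (\<lambda>(u, v, w). (v, w)) L) (v, w)))) = 0"
      using 1 2 by (simp add: te)
  qed simp_all
  then show ?thesis by simp
qed

lemma cmi_nonneg_finite:
  fixes L :: "('u::finite \<times> 'v::finite \<times> 'w::finite) pmf"
  shows "0 \<le> cmi L"
  by (rule conditional_mutual_information_pmf) simp

lemma achievable_extend_by:
  fixes p :: "('x::finite \<times> 'y::finite) pmf" and K :: "'x \<Rightarrow> 'y \<Rightarrow> 'z::finite pmf" and q :: "'x \<Rightarrow> 'x set pmf"
  assumes fullY: "snd ` set_pmf p = UNIV"
    and q: "\<And>x. set_pmf (q x) \<subseteq> {w \<in> independent_sets UNIV (adj p K). x \<in> w}"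
    and \<delta>: "0 < \<delta>"
  shows "achievable p K (ennreal (cmi (extend_by p q) + \<delta>))"
proof -
  define I where "I = cmi (extend_by p q)"
  have I: "0 \<le> I" unfolding I_def by (rule cmi_nonneg_finite)
  define V where "V = measure_pmf.expectation (extend_by p q) (\<lambda>t. (info_density p q t - I)\<^sup>2)"
  \<comment> \<open>The rate has slack \<delta> above the information. Half of it is spent on the
    weak law; the other half makes the number of bins exponentially larger than the typical
    likelihood ratio.\<close>
  define k where "k n = nat \<lceil>real n * (I + \<delta>)\<rceil>" for n
  have k: "real (k n) = of_int \<lceil>real n * (I + \<delta>)\<rceil>" for n using I \<delta> by (simp add: k_def)
  define S where "S n = (1 - V / (real n * (\<delta> / 2)\<^sup>2)) / (1 + 2 powr (real n * (I + \<delta> / 2)) / 2 ^ k n)" for n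
  define good where "good n f g = {(xs, ys). g ys (f xs) \<in> set_pmf (prod_list_pmf (map q xs))}"
    for n :: nat and f :: "'x list \<Rightarrow> nat" and g :: "'y list \<Rightarrow> nat \<Rightarrow> 'x set list"
  have "\<exists>f g. (\<forall>xs. f xs < 2 ^ k n) \<and> S n \<le> measure_pmf.prob (iid n p) (good n f g)" if "1 \<le> n" for n
    using code_exists[OF fullY that, where q = q and \<delta> = "\<delta> / 2" and k = "k n"] \<delta> unfolding S_def V_def I_def good_def by simp
  then obtain f g where f: "\<And>n xs. 1 \<le> n \<Longrightarrow> f n xs < 2 ^ k n"
    and g: "\<And>n. 1 \<le> n \<Longrightarrow> S n \<le> measure_pmf.prob (iid n p) (good n (f n) (g n))" by metis
  define enc where "enc n = (SOME e. bij_betw e {..<2 ^ k n :: nat} {w :: msg. length w = k n})" for n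
  have enc: "bij_betw (enc n) {..<2 ^ k n :: nat} {w. length w = k n}" for n
  proof -
    have "\<exists>e. bij_betw e {..<2 ^ k n :: nat} {w :: msg. length w = k n}"
      by (rule finite_same_card_bij) (simp_all add: finite_msgs card_msgs)
    from someI_ex[OF this] show ?thesis unfolding enc_def .
  qed
  define dec where "dec n = the_inv_into {..<2 ^ k n :: nat} (enc n)" for n
  \<comment> \<open>The case \<open>n = 0\<close>, for which no code was chosen, is filled in so
    that \<open>F n\<close> has values in the codebook for every \<open>n\<close>.\<close>
  define F where "F n xs = (if 1 \<le> n then enc n (f n xs) else replicate (k n) False)" for n xs
  have F: "F n xs \<in> {w. length w = k n}" for n xs
    using f[of n xs] enc[of n] by (auto simp: F_def bij_betw_def)
  have dec: "dec n (F n xs) = f n xs" if "1 \<le> n" for n xs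
    using f[OF that, of xs] enc[of n] that by (simp add: F_def dec_def bij_betw_def the_inv_into_f_f)
  \<comment> \<open>Bob decodes the independent set \<open>w\<close> but not \<open>x\<close>. All
    members of \<open>w\<close> that are compatible with \<open>y\<close> induce the same law of
    \<open>z\<close>, so any of them will do.\<close>
  define Kw where "Kw w y = K (SOME x. x \<in> w \<and> (x, y) \<in> set_pmf p) y" for w y
  have Kw: "Kw w y = K x y" if w: "w \<in> set_pmf (q x)" and xy: "(x, y) \<in> set_pmf p" for w x y
  proof -
    let ?x = "SOME x. x \<in> w \<and> (x, y) \<in> set_pmf p"
    have wi: "w \<in> independent_sets UNIV (adj p K)" "x \<in> w" using q[of x] w by auto
    have "?x \<in> w \<and> (?x, y) \<in> set_pmf p"
      by (rule someI[of "\<lambda>x. x \<in> w \<and> (x, y) \<in> set_pmf p" x]) (use wi xy in simp)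
    moreover from this have "\<not> adj p K ?x x" using wi by (auto simp: independent_sets_def)
    ultimately show ?thesis unfolding Kw_def using xy by (intro not_adj_pmf_eq) auto
  qed
  define Q where "Q n ys m = prod_list_pmf (map (\<lambda>i. Kw (g n ys (dec n m) ! i) (ys ! i)) [0..<n])" for n ys m
  have Qlen: "length zs = n" if "zs \<in> set_pmf (Q n ys m)" for zs n ys m
    using length_prod_list_pmf[OF that[unfolded Q_def]] by simp
  have Qgood: "Q n ys (F n xs) = memoryless K xs ys"
    if n: "1 \<le> n" and xy: "(xs, ys) \<in> set_pmf (iid n p)" and good: "(xs, ys) \<in> good n (f n) (g n)" for n xs ys
  proof -
    have len: "length xs = n" "length ys = n" and pos: "\<And>i. i < n \<Longrightarrow> (xs ! i, ys ! i) \<in> set_pmf p"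
      using xy by (auto simp: set_iid)
    let ?w = "g n ys (f n xs)"
    have w: "list_all2 (\<lambda>w q. w \<in> set_pmf q) ?w (map q xs)"
      using good by (simp add: good_def set_prod_list_pmf)
    have "map (\<lambda>i. Kw (?w ! i) (ys ! i)) [0..<n] = map2 K xs ys"
    proof (rule nth_equalityI)
      fix i assume "i < length (map (\<lambda>i. Kw (?w ! i) (ys ! i)) [0..<n])"
      then have i: "i < n" by simp
      have "?w ! i \<in> set_pmf (q (xs ! i))" using w i len by (auto simp: list_all2_conv_all_nth)
      then show "map (\<lambda>i. Kw (?w ! i) (ys ! i)) [0..<n] ! i = map2 K xs ys ! i"
        using i len Kw[OF _ pos[OF i]] by simp
    qed (use len in simp)
    then show ?thesis by (simp add: Q_def dec[OF n] memoryless_def)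
  qed
  have "\<exists>\<pi>. protocol_for (iid n p) \<pi> \<and> (\<forall>ys s m. length (bob_output \<pi> ys s m) = n) \<and>
      law (iid n p) \<pi> = bind_pmf (iid n p) (\<lambda>(xs, ys). map_pmf (\<lambda>zs. (xs, ys, F n xs, zs)) (Q n ys (F n xs)))" for n
  proof -
    have "prefix_free {w :: msg. length w = k n}"
      by (auto simp: prefix_free_def prefix_def)
    \<comment> \<open>The default output has length \<open>n\<close> as well, since the length is
      prescribed for every seed.\<close>
    from ex_one_shot[where f = "F n" and d = "replicate n undefined" and Q = "Q n",
        OF this finite_msgs F finite_set_iid[of n p]]
    obtain \<pi> where \<pi>: "protocol_for (iid n p) \<pi>"
        "\<And>y s m. bob_output \<pi> y s m \<in> insert (replicate n undefined) (set_pmf (Q n y m))"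
        "law (iid n p) \<pi> = bind_pmf (iid n p) (\<lambda>(xs, ys). map_pmf (\<lambda>zs. (xs, ys, F n xs, zs)) (Q n ys (F n xs)))"
      by blast
    have "length (bob_output \<pi> ys s m) = n" for ys s m
      using \<pi>(2)[of ys s m] Qlen[of "bob_output \<pi> ys s m" n ys m] by auto
    then show ?thesis using \<pi>(1,3) by blast
  qed
  then obtain \<pi> where \<pi>: "\<And>n. protocol_for (iid n p) (\<pi> n)"
      and out: "\<And>n ys s m. length (bob_output (\<pi> n) ys s m) = n"
      and law: "\<And>n. law (iid n p) (\<pi> n) =
        bind_pmf (iid n p) (\<lambda>(xs, ys). map_pmf (\<lambda>zs. (xs, ys, F n xs, zs)) (Q n ys (F n xs)))"
    by metis
  have rate: "rate_n n p (\<pi> n) = ennreal (real (k n) / real n)" if "1 \<le> n" for n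
  proof -
    have lenF: "length (F n xs) = k n" for xs using F[of n xs] by simp
    have "(\<Sum>xs\<in>fst ` set_pmf (iid n p). pmf (map_pmf fst (iid n p)) xs) = 1"
      using sum_pmf_eq_1[of "fst ` set_pmf (iid n p)" "map_pmf fst (iid n p)"] finite_set_iid[of n p] by simp
    then have "expected_length (iid n p) (\<pi> n) = ennreal (real (k n))"
      unfolding expected_length_one_shot[OF \<pi> finite_set_iid law] lenF sum_distrib_right[symmetric] by simp
    then show ?thesis using that unfolding rate_n_def
      by (simp add: divide_ennreal ennreal_of_nat_eq_real_of_nat)
  qed
  have "(\<lambda>n. real (k n) / real n) \<longlonglongrightarrow> I + \<delta>"
  proof (rule tendsto_sandwich)
    show "\<forall>\<^sub>F n in sequentially. I + \<delta> \<le> real (k n) / real n"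
      using eventually_ge_at_top[of 1]
    proof eventually_elim
      case (elim n)
      have "real n * (I + \<delta>) \<le> real (k n)" unfolding k by linarith
      then show ?case using elim by (simp add: field_simps)
    qed
    show "\<forall>\<^sub>F n in sequentially. real (k n) / real n \<le> I + \<delta> + 1 / real n"
      using eventually_ge_at_top[of 1]
    proof eventually_elim
      case (elim n)
      have "real (k n) \<le> real n * (I + \<delta>) + 1" unfolding k by linarith
      then show ?case using elim by (simp add: field_simps)
    qed
    show "(\<lambda>n. I + \<delta> + 1 / real n) \<longlonglongrightarrow> I + \<delta>"
      using tendsto_add[OF tendsto_const lim_1_over_n, of "I + \<delta>"] by simp
  qed simp
  then have lim: "(\<lambda>n. ennreal (real (k n) / real n)) \<longlonglongrightarrow> ennreal (I + \<delta>)"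
    by (rule tendsto_ennrealI)
  have rate_lim: "(\<lambda>n. rate_n n p (\<pi> n)) \<longlonglongrightarrow> ennreal (I + \<delta>)"
    by (rule Lim_transform_eventually[OF lim])
      (auto intro!: eventually_mono[OF eventually_ge_at_top[of 1]] simp: rate)
  \<comment> \<open>The message is a function of \<open>xs\<close>, so nothing leaks at all; only
    the output is approximate.\<close>
  have leak: "leakage (iid n p) (\<pi> n) = 0" for n
  proof -
    let ?L = "law (iid n p) (\<pi> n)"
    let ?M = "map_pmf (\<lambda>(x, y, m, z). (m, (y, z), x)) ?L"
    have sub: "(\<lambda>(x, y, m, z). (x, y, z)) ` set_pmf ?L \<subseteq>
        {xs. length xs = n} \<times> {ys. length ys = n} \<times> {zs. length zs = n}"
      using Qlen by (auto simp: law set_iid)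
    have fin: "finite ((\<lambda>(x, y, m, z). (x, y, z)) ` set_pmf ?L)"
      by (rule finite_subset[OF sub]) (intro finite_cartesian_product finite_lists_length)
    have mF: "m = F n x" if "(m, v, x) \<in> set_pmf ?M" for m v x
      using that by (auto simp: law)
    have "cmi ?M = 0" by (rule cmi_deterministic) (rule mF)
    then show ?thesis unfolding leakage_eq[OF \<pi> fin] .
  qed
  \<comment> \<open>On good inputs the output law is exact; on the others two probability laws are
    at \<open>L1\<close> distance at most two.\<close>
  have err: "avg_L1_error n p K (\<pi> n) \<le> 2 * (1 - S n)" if n: "1 \<le> n" for n
  proof -
    let ?P = "iid n p" and ?G = "good n (f n) (g n)"
    have fin: "finite {zs :: 'z list. length zs = n}"
      using finite_lists_length_eq[of "UNIV :: 'z set" n] by simp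
    have "avg_L1_error n p K (\<pi> n) \<le> measure_pmf.expectation ?P (\<lambda>xy. 2 * indicator (- ?G) xy)"
      unfolding avg_L1_error_def
    proof (intro integral_mono_AE AE_pmfI)
      fix xy assume xy: "xy \<in> set_pmf ?P"
      obtain xs ys where e: "xy = (xs, ys)" by (metis surj_pair)
      have len: "length xs = n" "length ys = n" using xy by (auto simp: e set_iid)
      have "0 < pmf ?P (xs, ys)" using xy by (simp add: e pmf_positive)
      then have op: "output_prob ?P (\<pi> n) xs ys zs = pmf (Q n ys (F n xs)) zs" for zs
        unfolding output_prob_eq[OF \<pi>] measure_one_shot[OF law] by simp
      have "(\<Sum>zs\<in>{zs. length zs = n}. \<bar>pmf (Q n ys (F n xs)) zs - pmf (memoryless K xs ys) zs\<bar>) \<le> 2 * indicator (- ?G) (xs, ys)"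
      proof (cases "(xs, ys) \<in> ?G")
        case True
        then show ?thesis using Qgood[OF n xy[unfolded e] True] by simp
      next
        case False
        have "(\<Sum>zs\<in>{zs. length zs = n}. \<bar>pmf (Q n ys (F n xs)) zs - pmf (memoryless K xs ys) zs\<bar>)
            \<le> (\<Sum>zs\<in>{zs. length zs = n}. pmf (Q n ys (F n xs)) zs + pmf (memoryless K xs ys) zs)"
        proof (rule sum_mono)
          fix zs
          show "\<bar>pmf (Q n ys (F n xs)) zs - pmf (memoryless K xs ys) zs\<bar> \<le> pmf (Q n ys (F n xs)) zs + pmf (memoryless K xs ys) zs"
            using pmf_nonneg[of "Q n ys (F n xs)" zs] pmf_nonneg[of "memoryless K xs ys" zs] by linarith
        qed
        also have "\<dots> = 1 + 1"
          unfolding sum.distrib using fin Qlen length_prod_list_pmf len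
          by (intro arg_cong2[where f="(+)"] sum_pmf_eq_1) (fastforce simp: memoryless_def)+
        finally show ?thesis using False by simp
      qed
      then show "(\<lambda>(xs, ys). \<Sum>zs\<in>{zs. length zs = n}. \<bar>output_prob ?P (\<pi> n) xs ys zs - pmf (memoryless K xs ys) zs\<bar>) xy
          \<le> 2 * indicator (- ?G) xy"
        by (simp add: e op)
    qed (auto intro!: integrable_measure_pmf_finite finite_set_iid)
    also have "\<dots> = 2 * (1 - measure_pmf.prob ?P ?G)"
      by (simp add: measure_pmf.prob_compl[of ?G ?P, simplified, symmetric] Compl_eq_Diff_UNIV)
    also have "\<dots> \<le> 2 * (1 - S n)" using g[OF n] by simp
    finally show ?thesis .
  qed
  have S1: "S \<longlonglongrightarrow> 1"
  proof -
    have "(\<lambda>n. V / (\<delta> / 2)\<^sup>2 * (1 / real n)) \<longlonglongrightarrow> V / (\<delta> / 2)\<^sup>2 * 0"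
      by (intro tendsto_mult tendsto_const lim_1_over_n)
    then have a: "(\<lambda>n. V / (real n * (\<delta> / 2)\<^sup>2)) \<longlonglongrightarrow> 0" by (simp add: mult.commute)
    have b: "(\<lambda>n. 2 powr (real n * (I + \<delta> / 2)) / 2 ^ k n) \<longlonglongrightarrow> 0"
    proof (rule tendsto_sandwich[where f = "\<lambda>_. 0" and h = "\<lambda>n. (2 powr (- \<delta> / 2)) ^ n"])
      show "\<forall>\<^sub>F n in sequentially. 2 powr (real n * (I + \<delta> / 2)) / 2 ^ k n \<le> (2 powr (- \<delta> / 2)) ^ n"
      proof (rule always_eventually, rule allI)
        fix n
        have "2 powr (real n * (I + \<delta> / 2)) / 2 ^ k n = 2 powr (real n * (I + \<delta> / 2) - real (k n))"
          by (simp add: powr_diff powr_realpow)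
        also have "\<dots> \<le> 2 powr (real n * (- \<delta> / 2))"
        proof -
          have "real n * (I + \<delta>) \<le> real (k n)" unfolding k by linarith
          then show ?thesis by (simp add: algebra_simps)
        qed
        also have "\<dots> = (2 powr (- \<delta> / 2)) ^ n" by (simp add: powr_realpow[symmetric] powr_powr mult.commute)
        finally show "2 powr (real n * (I + \<delta> / 2)) / 2 ^ k n \<le> (2 powr (- \<delta> / 2)) ^ n" .
      qed
      show "(\<lambda>n. (2 powr (- \<delta> / 2)) ^ n) \<longlonglongrightarrow> 0"
        using \<delta> by (intro LIMSEQ_power_zero) (simp add: powr_less_one)
    qed auto
    have "S \<longlonglongrightarrow> (1 - 0) / (1 + 0)"
      unfolding S_def by (intro tendsto_divide tendsto_diff tendsto_add tendsto_const a b) simp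
    then show ?thesis by simp
  qed
  show ?thesis
    unfolding achievable_def I_def[symmetric]
  proof (intro exI[of _ \<pi>] conjI allI impI \<pi> out rate_lim)
    fix \<epsilon> :: real and N assume e: "0 < \<epsilon>"
    have "(\<lambda>n. 2 * (1 - S n)) \<longlonglongrightarrow> 2 * (1 - 1)"
      by (intro tendsto_mult tendsto_diff tendsto_const S1)
    then have "\<forall>\<^sub>F n in sequentially. 2 * (1 - S n) < \<epsilon>"
      using e by (intro order_tendstoD(2)) auto
    then have "\<forall>\<^sub>F n in sequentially. 2 * (1 - S n) < \<epsilon> \<and> N \<le> n \<and> 1 \<le> n"
      by (intro eventually_conj eventually_ge_at_top)
    then obtain n where n: "2 * (1 - S n) < \<epsilon>" "N \<le> n" "1 \<le> n"
      using eventually_happens'[OF sequentially_bot] by blast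
    then show "\<exists>n\<ge>N. 1 \<le> n \<and> avg_L1_error n p K (\<pi> n) \<le> \<epsilon> \<and> leakage (iid n p) (\<pi> n) \<le> real n * \<epsilon>"
      using err[OF n(3)] e by (intro exI[of _ n]) (auto simp: leak)
  qed
qed

section \<open>Continuity of conditional mutual information\<close>

definition xlog :: "real \<Rightarrow> real" where
  "xlog t = t * log 2 t"

lemma uniformly_continuous_xlog: "uniformly_continuous_on {0..1} xlog"
proof (rule compact_uniformly_continuous)
  show "continuous_on {0..1} xlog"
  proof (rule continuous_on_eq_continuous_within[THEN iffD2], rule ballI)
    fix t :: real assume t: "t \<in> {0..1}"
    show "continuous (at t within {0..1}) xlog"
    proof (cases "t = 0")
      case True
      have "((\<lambda>t::real. t * (ln t / ln 2)) \<longlongrightarrow> 0) (at_right 0)" by real_asymp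
      moreover have "xlog = (\<lambda>t. t * (ln t / ln 2))" "xlog 0 = 0" by (simp_all add: fun_eq_iff xlog_def log_def)
      ultimately have "(xlog \<longlongrightarrow> xlog 0) (at_right 0)" by (simp only:)
      moreover have "at (0::real) within {0..1} \<le> at_right 0"
        by (simp add: at_within_Icc_at_right)
      ultimately show ?thesis unfolding continuous_within True by (rule tendsto_mono[rotated])
    next
      case False
      then show ?thesis unfolding xlog_def log_def using t by (intro continuous_intros) auto
    qed
  qed
qed simp

lemma pmf_map_finite: "pmf (map_pmf f L) b = (\<Sum>t\<in>f -` {b}. pmf L t)" for L :: "'a::finite pmf"
  by (simp add: pmf_map measure_measure_pmf_finite)

lemma pmf_map_diff_le:
  fixes L :: "'a::finite pmf"
  assumes "\<And>t. \<bar>pmf L t - pmf L' t\<bar> \<le> \<rho>" "0 \<le> \<rho>"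
  shows "\<bar>pmf (map_pmf f L) b - pmf (map_pmf f L') b\<bar> \<le> real CARD('a) * \<rho>"
proof -
  have "\<bar>pmf (map_pmf f L) b - pmf (map_pmf f L') b\<bar> = \<bar>\<Sum>t\<in>f -` {b}. pmf L t - pmf L' t\<bar>"
    by (simp add: pmf_map_finite sum_subtractf)
  also have "\<dots> \<le> (\<Sum>t\<in>f -` {b}. \<rho>)" by (rule order.trans[OF sum_abs sum_mono]) (rule assms)
  also have "\<dots> \<le> real CARD('a) * \<rho>"
    using assms(2) card_mono[of UNIV "f -` {b}"] by (simp add: mult_right_mono)
  finally show ?thesis .
qed

lemma expectation_log_pmf_map:
  fixes L :: "'a::finite pmf" and f :: "'a \<Rightarrow> 'b::finite"
  shows "measure_pmf.expectation L (\<lambda>t. log 2 (pmf (map_pmf f L) (f t))) = (\<Sum>b\<in>UNIV. xlog (pmf (map_pmf f L) b))"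
proof -
  have "measure_pmf.expectation L (\<lambda>t. log 2 (pmf (map_pmf f L) (f t))) =
      measure_pmf.expectation (map_pmf f L) (\<lambda>b. log 2 (pmf (map_pmf f L) b))" by simp
  also have "\<dots> = (\<Sum>b\<in>UNIV. xlog (pmf (map_pmf f L) b))"
    by (subst integral_measure_pmf_real[of UNIV]) (auto simp: xlog_def mult.commute)
  finally show ?thesis .
qed

lemma cmi_eq_xlog:
  fixes L :: "('u::finite \<times> 'v::finite \<times> 'w::finite) pmf"
  shows "cmi L = (\<Sum>t\<in>UNIV. xlog (pmf (map_pmf (\<lambda>t. t) L) t)) + (\<Sum>w\<in>UNIV. xlog (pmf (map_pmf (\<lambda>(u, v, w). w) L) w))
    - (\<Sum>uw\<in>UNIV. xlog (pmf (map_pmf (\<lambda>(u, v, w). (u, w)) L) uw)) - (\<Sum>vw\<in>UNIV. xlog (pmf (map_pmf (\<lambda>(u, v, w). (v, w)) L) vw))"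
proof -
  let ?l = "\<lambda>f t. log 2 (pmf (map_pmf f L) (f t))"
  let ?f = "\<lambda>(u, v, w). w" and ?g = "\<lambda>(u, v, w). (u, w)" and ?h = "\<lambda>(u, v, w). (v, w)"
  have "cmi L = measure_pmf.expectation L (\<lambda>t. ?l (\<lambda>t. t) t + ?l ?f t - ?l ?g t - ?l ?h t)"
    unfolding cmi_def
  proof (intro integral_cong_AE AE_pmfI)
    fix t assume t: "t \<in> set_pmf L"
    obtain u v w where te: "t = (u, v, w)" by (metis surj_pair)
    have "0 < pmf L (u, v, w)" "0 < pmf (map_pmf ?f L) w" "0 < pmf (map_pmf ?g L) (u, w)" "0 < pmf (map_pmf ?h L) (v, w)"
      using t te pmf_map_pos[of "(u, v, w)" L ?f] pmf_map_pos[of "(u, v, w)" L ?g] pmf_map_pos[of "(u, v, w)" L ?h]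
      by (auto intro: pmf_positive)
    then show "(case t of (u, v, w) \<Rightarrow> log 2 (pmf L (u, v, w) * pmf (map_pmf ?f L) w /
        (pmf (map_pmf ?g L) (u, w) * pmf (map_pmf ?h L) (v, w)))) = ?l (\<lambda>t. t) t + ?l ?f t - ?l ?g t - ?l ?h t"
      by (simp add: te log_mult log_divide)
  qed simp_all
  also have "\<dots> = measure_pmf.expectation L (?l (\<lambda>t. t)) + measure_pmf.expectation L (?l ?f)
      - measure_pmf.expectation L (?l ?g) - measure_pmf.expectation L (?l ?h)"
    by (simp add: integrable_measure_pmf_finite)
  finally show ?thesis unfolding expectation_log_pmf_map .
qed

text \<open>By \<open>cmi_eq_xlog\<close> the information is a signed sum of values of
  \<open>xlog\<close> at the masses of four marginals, and \<open>xlog\<close> is uniformly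
  continuous on the unit interval; so \<rho> can be chosen uniformly in both laws.\<close>

lemma cmi_continuity:
  assumes "0 < \<delta>"
  shows "\<exists>\<rho>>0. \<forall>L L' :: ('u::finite \<times> 'v::finite \<times> 'w::finite) pmf.
    (\<forall>t. \<bar>pmf L t - pmf L' t\<bar> \<le> \<rho>) \<longrightarrow> \<bar>cmi L - cmi L'\<bar> \<le> \<delta>"
proof -
  define N where "N = real CARD('u \<times> 'v \<times> 'w)"
  have N: "0 < N" unfolding N_def of_nat_0_less_iff by (rule zero_less_card_finite)
  \<comment> \<open>\<open>M\<close> counts the terms of the four sums, each of which may move by
    \<open>\<delta> / M\<close>, while \<open>N\<close> bounds the number of masses that add up to a
    marginal one.\<close>
  define M where "M = real CARD('u \<times> 'v \<times> 'w) + real CARD('w) + real CARD('u \<times> 'w) + real CARD('v \<times> 'w)"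
  have M: "0 < M" using N unfolding M_def N_def by linarith
  obtain d where d: "0 < d" and uc: "\<And>s t. s \<in> {0..1} \<Longrightarrow> t \<in> {0..1} \<Longrightarrow> dist t s < d \<Longrightarrow> dist (xlog t) (xlog s) < \<delta> / M"
    using uniformly_continuous_xlog assms M unfolding uniformly_continuous_on_def by (metis divide_pos_pos)
  define \<rho> where "\<rho> = d / (2 * N)"
  have \<rho>: "0 < \<rho>" "N * \<rho> < d" using d N by (auto simp: \<rho>_def)
  have "\<bar>cmi L - cmi L'\<bar> \<le> \<delta>" if L: "\<forall>t. \<bar>pmf L t - pmf L' t\<bar> \<le> \<rho>" for L L' :: "('u \<times> 'v \<times> 'w) pmf"
  proof -
    have x: "\<bar>xlog (pmf (map_pmf f L) b) - xlog (pmf (map_pmf f L') b)\<bar> \<le> \<delta> / M" for f :: "_ \<Rightarrow> 'b" and b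
    proof -
      have "\<bar>pmf (map_pmf f L) b - pmf (map_pmf f L') b\<bar> \<le> N * \<rho>"
        unfolding N_def using L \<rho>(1) by (intro pmf_map_diff_le) auto
      then have "dist (pmf (map_pmf f L) b) (pmf (map_pmf f L') b) < d"
        using \<rho>(2) by (simp add: dist_real_def)
      from uc[OF _ _ this] show ?thesis by (simp add: dist_real_def pmf_le_1 less_imp_le)
    qed
    have s: "\<bar>(\<Sum>b\<in>UNIV. xlog (pmf (map_pmf f L) b)) - (\<Sum>b\<in>UNIV. xlog (pmf (map_pmf f L') b))\<bar> \<le> real CARD('b) * (\<delta> / M)"
      for f :: "_ \<Rightarrow> 'b::finite"
    proof -
      have "\<bar>(\<Sum>b\<in>UNIV. xlog (pmf (map_pmf f L) b)) - (\<Sum>b\<in>UNIV. xlog (pmf (map_pmf f L') b))\<bar>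
          \<le> (\<Sum>b\<in>(UNIV :: 'b set). \<delta> / M)"
        unfolding sum_subtractf[symmetric] by (rule order.trans[OF sum_abs sum_mono]) (rule x)
      then show ?thesis by simp
    qed
    have "\<bar>cmi L - cmi L'\<bar> \<le> M * (\<delta> / M)"
      unfolding cmi_eq_xlog M_def distrib_right
      using s[of "\<lambda>t. t"] s[of "\<lambda>(u, v, w). w"] s[of "\<lambda>(u, v, w). (u, w)"] s[of "\<lambda>(u, v, w). (v, w)"]
      unfolding M_def[symmetric] by linarith
    then show ?thesis using M by simp
  qed
  then show ?thesis using \<rho>(1) by blast
qed

section \<open>The single-letter lower bound\<close>

lemma bind_cond_fst: "bind_pmf (map_pmf fst R) (\<lambda>u. cond_pmf R {t. fst t = u}) = R"
proof (rule bind_cond_pmf_cancel)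
  fix u y assume "u \<in> set_pmf (map_pmf fst R)" "y \<in> set_pmf R" "fst y = u"
  then show "measure_pmf.prob R {y. fst y = u} = measure_pmf.prob (map_pmf fst R) {x. fst y = x}"
    by (auto simp: measure_map_pmf vimage_def intro!: arg_cong[where f="measure _"])
qed auto

text \<open>The identity for nonnegative integrals, applied after a shift by
  \<open>B\<close>.\<close>

lemma expectation_bind_pmf_bounded:
  fixes h :: "_ \<Rightarrow> real"
  assumes B: "\<And>t. \<bar>h t\<bar> \<le> B"
  shows "measure_pmf.expectation (bind_pmf M N) h = measure_pmf.expectation M (\<lambda>x. measure_pmf.expectation (N x) h)"
proof -
  let ?E = "\<lambda>M h. measure_pmf.expectation M h"
  have nn: "0 \<le> h t + B" for t using B[of t] by linarith
  have int: "integrable (measure_pmf M') h" for M'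
    by (rule measure_pmf.integrable_const_bound[where B = B]) (use B in auto)
  have bnd: "\<bar>?E M' h\<bar> \<le> B" for M'
  proof -
    have "\<bar>?E M' h\<bar> \<le> ?E M' (\<lambda>t. \<bar>h t\<bar>)" by (rule integral_abs_bound)
    also have "\<dots> \<le> ?E M' (\<lambda>_. B)" using int B by (intro integral_mono) auto
    finally show ?thesis by simp
  qed
  have int2: "integrable (measure_pmf M) (\<lambda>x. ?E (N x) h)"
    by (rule measure_pmf.integrable_const_bound[where B = B]) (use bnd in auto)
  have nn2: "0 \<le> ?E M' h + B" for M' using bnd[of M'] by linarith
  have *: "(\<integral>\<^sup>+ t. ennreal (h t + B) \<partial>measure_pmf M') = ennreal (?E M' h + B)" for M'
    using int nn by (subst nn_integral_eq_integral) auto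
  have "ennreal (?E (bind_pmf M N) h + B) = (\<integral>\<^sup>+ x. ennreal (?E (N x) h + B) \<partial>measure_pmf M)"
    unfolding *[symmetric] by simp
  also have "\<dots> = ennreal (?E M (\<lambda>x. ?E (N x) h) + B)"
    using int2 nn2 by (subst nn_integral_eq_integral) auto
  finally have "?E (bind_pmf M N) h + B = ?E M (\<lambda>x. ?E (N x) h) + B"
  proof (subst (asm) ennreal_inj)
    show "0 \<le> ?E (bind_pmf M N) h + B" by (rule nn2)
    have "0 \<le> ?E M (\<lambda>x. ?E (N x) h + B)" by (intro Bochner_Integration.integral_nonneg nn2)
    then show "0 \<le> ?E M (\<lambda>x. ?E (N x) h) + B" using int2 by simp
  qed
  then show ?thesis by simp
qed

lemma expectation_disintegrate:
  fixes R :: "('u \<times> 'f::finite) pmf" and h :: "_ \<Rightarrow> real"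
  assumes B: "\<And>t. \<bar>h t\<bar> \<le> B"
  shows "measure_pmf.expectation R h =
    measure_pmf.expectation (map_pmf fst R) (\<lambda>u. \<Sum>f\<in>UNIV. pmf R (u, f) / pmf (map_pmf fst R) u * h (u, f))"
proof -
  have "measure_pmf.expectation R h = measure_pmf.expectation (bind_pmf (map_pmf fst R) (\<lambda>u. cond_pmf R {t. fst t = u})) h"
    by (simp only: bind_cond_fst)
  also have "\<dots> = measure_pmf.expectation (map_pmf fst R) (\<lambda>u. measure_pmf.expectation (cond_pmf R {t. fst t = u}) h)"
    by (rule expectation_bind_pmf_bounded) (rule B)
  also have "\<dots> = measure_pmf.expectation (map_pmf fst R) (\<lambda>u. \<Sum>f\<in>UNIV. pmf R (u, f) / pmf (map_pmf fst R) u * h (u, f))"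
  proof (intro integral_cong_AE AE_pmfI)
    fix u assume u: "u \<in> set_pmf (map_pmf fst R)"
    then have ne: "set_pmf R \<inter> {t. fst t = u} \<noteq> {}" by auto
    have pu: "measure_pmf.prob R {t. fst t = u} = pmf (map_pmf fst R) u"
      by (simp add: pmf_map vimage_def)
    have "measure_pmf.expectation (cond_pmf R {t. fst t = u}) h =
        (\<Sum>t\<in>{u} \<times> UNIV. h t * pmf (cond_pmf R {t. fst t = u}) t)"
      using ne by (intro integral_measure_pmf_real) auto
    also have "\<dots> = (\<Sum>f\<in>UNIV. pmf R (u, f) / pmf (map_pmf fst R) u * h (u, f))"
      unfolding sum.cartesian_product' using ne by (simp add: pmf_cond pu mult.commute)
    finally show "measure_pmf.expectation (cond_pmf R {t. fst t = u}) h =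
      (\<Sum>f\<in>UNIV. pmf R (u, f) / pmf (map_pmf fst R) u * h (u, f))" .
  qed simp_all
  finally show ?thesis .
qed

lemma sum_disintegrate:
  fixes R :: "('u \<times> 'f::finite) pmf"
  assumes "u \<in> set_pmf (map_pmf fst R)"
  shows "(\<Sum>f\<in>UNIV. pmf R (u, f) / pmf (map_pmf fst R) u) = 1"
proof -
  have "pmf (map_pmf fst R) u = measure_pmf.prob R ({u} \<times> UNIV)"
    unfolding pmf_map by (intro arg_cong[where f="measure _"]) auto
  also have "\<dots> = (\<Sum>t\<in>{u} \<times> UNIV. pmf R t)" by (simp add: measure_measure_pmf_finite)
  also have "\<dots> = (\<Sum>f\<in>UNIV. pmf R (u, f))" by (simp add: sum.cartesian_product')
  finally have "pmf (map_pmf fst R) u = (\<Sum>f\<in>UNIV. pmf R (u, f))" .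
  moreover have "pmf (map_pmf fst R) u \<noteq> 0" using assms by (simp only: set_pmf_iff not_False_eq_True)
  ultimately show ?thesis by (simp add: sum_divide_distrib[symmetric])
qed

text \<open>The conditional law of the pair \<open>(Y, Z)\<close> given
  \<open>X = x\<close>.\<close>

definition channel :: "('x \<times> 'y) pmf \<Rightarrow> ('x \<Rightarrow> 'y \<Rightarrow> 'z pmf) \<Rightarrow> 'x \<Rightarrow> 'y \<times> 'z \<Rightarrow> real" where
  "channel p K x v = pmf p (x, fst v) / pmf (map_pmf fst p) x * pmf (K x (fst v)) (snd v)"

lemma channel_nonneg: "0 \<le> channel p K x v"
  by (simp add: channel_def)

lemma sum_channel_snd:
  fixes K :: "'x \<Rightarrow> 'y \<Rightarrow> 'z::finite pmf"
  shows "(\<Sum>z\<in>UNIV. channel p K x (y, z)) = pmf p (x, y) / pmf (map_pmf fst p) x"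
  unfolding channel_def fst_conv snd_conv sum_distrib_left[symmetric] by (simp add: sum_pmf_eq_1)

lemma sum_pmf_fst: "(\<Sum>y\<in>UNIV. pmf p (x, y)) = pmf (map_pmf fst p) x" for p :: "('x \<times> 'y::finite) pmf"
proof -
  have "pmf (map_pmf fst p) x = measure_pmf.prob p ({x} \<times> UNIV)"
    unfolding pmf_map by (intro arg_cong[where f="measure _"]) auto
  also have "\<dots> = (\<Sum>t\<in>{x} \<times> UNIV. pmf p t)" by (simp add: measure_measure_pmf_finite)
  finally show ?thesis by (simp add: sum.cartesian_product')
qed

lemma sum_channel:
  fixes K :: "'x \<Rightarrow> 'y::finite \<Rightarrow> 'z::finite pmf"
  assumes "x \<in> set_pmf (map_pmf fst p)"
  shows "(\<Sum>v\<in>UNIV. channel p K x v) = 1"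
proof -
  have ne: "pmf (map_pmf fst p) x \<noteq> 0" using assms by (simp only: set_pmf_iff not_False_eq_True)
  have "(\<Sum>v\<in>UNIV. channel p K x v) = (\<Sum>y\<in>UNIV. \<Sum>z\<in>UNIV. channel p K x (y, z))"
    by (simp only: UNIV_Times_UNIV[symmetric] sum.cartesian_product')
  also have "\<dots> = 1"
    using ne by (simp add: sum_channel_snd sum_divide_distrib[symmetric] sum_pmf_fst)
  finally show ?thesis .
qed

text \<open>Quantitative form of the support argument: if the posterior \<open>\<rho>\<close> of \<open>(X, Y, Z)\<close> nearly factors
  through the channel while \<open>Z\<close> is independent of \<open>X\<close> given \<open>Y\<close>, then adjacent \<open>x\<close>, \<open>x'\<close> cannot both be likely.\<close>

lemma adjacent_product_le:
  fixes \<rho> :: "'x::finite \<Rightarrow> 'y::finite \<times> 'z::finite \<Rightarrow> real"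
  assumes \<rho>0: "\<And>x v. 0 \<le> \<rho> x v" and \<rho>1: "(\<Sum>x\<in>UNIV. \<Sum>v\<in>UNIV. \<rho> x v) = 1"
    and ind: "\<And>x x' y z. \<rho> x (y, z) * (\<Sum>z'\<in>UNIV. \<rho> x' (y, z')) = \<rho> x' (y, z) * (\<Sum>z'\<in>UNIV. \<rho> x (y, z'))"
    and r: "\<And>x. r x = (\<Sum>v\<in>UNIV. \<rho> x v)"
    and D: "D = (\<Sum>x\<in>UNIV. \<Sum>v\<in>UNIV. \<bar>\<rho> x v - r x * channel p K x v\<bar>)"
  shows "r x * r x' * \<bar>channel p K x (y, z) * (\<Sum>z'\<in>UNIV. channel p K x' (y, z')) -
    channel p K x' (y, z) * (\<Sum>z'\<in>UNIV. channel p K x (y, z'))\<bar> \<le> 4 * D"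
proof -
  define s where "s x = (\<Sum>z'\<in>UNIV. \<rho> x (y, z'))" for x
  define c where "c x = channel p K x (y, z)" for x
  define c' where "c' x = (\<Sum>z'\<in>UNIV. channel p K x (y, z'))" for x
  have UN: "(UNIV :: ('y \<times> 'z) set) = UNIV \<times> UNIV" by simp
  have row: "(\<Sum>v\<in>UNIV. \<bar>\<rho> x v - r x * channel p K x v\<bar>) \<le> D" for x
    unfolding D by (rule member_le_sum) (auto intro: sum_nonneg)
  have dz: "(\<Sum>z'\<in>UNIV. \<bar>\<rho> x (y, z') - r x * channel p K x (y, z')\<bar>) \<le> D" for x
  proof -
    have "(\<Sum>z'\<in>UNIV. \<bar>\<rho> x (y, z') - r x * channel p K x (y, z')\<bar>) \<le>
        (\<Sum>y\<in>UNIV. \<Sum>z'\<in>UNIV. \<bar>\<rho> x (y, z') - r x * channel p K x (y, z')\<bar>)"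
      by (rule member_le_sum[of y]) (auto intro: sum_nonneg)
    also have "\<dots> = (\<Sum>v\<in>UNIV. \<bar>\<rho> x v - r x * channel p K x v\<bar>)"
      unfolding UN sum.cartesian_product' ..
    finally show ?thesis using row[of x] by linarith
  qed
  have d1: "\<bar>\<rho> x (y, z) - r x * c x\<bar> \<le> D" for x
    using order.trans[OF member_le_sum[of z UNIV "\<lambda>z'. \<bar>\<rho> x (y, z') - r x * channel p K x (y, z')\<bar>"] dz] by (simp add: c_def)
  have d2: "\<bar>s x - r x * c' x\<bar> \<le> D" for x
  proof -
    have "s x - r x * c' x = (\<Sum>z'\<in>UNIV. \<rho> x (y, z') - r x * channel p K x (y, z'))"
      by (simp add: s_def c'_def sum_subtractf sum_distrib_left)
    then show ?thesis using order.trans[OF sum_abs dz[of x]] by simp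
  qed
  have r0: "0 \<le> r x" for x unfolding r by (intro sum_nonneg \<rho>0)
  have r1: "r x \<le> 1" for x
    unfolding r \<rho>1[symmetric] by (rule member_le_sum) (auto intro: sum_nonneg \<rho>0)
  have zs: "\<rho> x (y, z) \<le> s x" for x unfolding s_def by (rule member_le_sum) (auto intro: \<rho>0)
  have sr: "s x \<le> r x" for x
  proof -
    have "s x \<le> (\<Sum>y\<in>UNIV. \<Sum>z'\<in>UNIV. \<rho> x (y, z'))"
      unfolding s_def by (rule member_le_sum[of y]) (auto intro: sum_nonneg \<rho>0)
    also have "\<dots> = r x" unfolding r UN sum.cartesian_product' ..
    finally show ?thesis .
  qed
  have c'0: "0 \<le> c' x" and c'1: "c' x \<le> 1" for x
    unfolding c'_def sum_channel_snd using pmf_le_pmf_map[of p "(x, y)" fst] by (auto simp: divide_le_eq)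
  \<comment> \<open>Replacing the two factors one after the other costs at most \<open>D\<close>
    each. The products for \<open>(x, x')\<close> and \<open>(x', x)\<close> are equal by
    \<open>ind\<close>, whence the total of \<open>4 * D\<close>.\<close>
  have prod: "\<bar>\<rho> x (y, z) * s x' - r x * c x * (r x' * c' x')\<bar> \<le> 2 * D" for x x'
  proof -
    have "\<rho> x (y, z) * s x' - r x * c x * (r x' * c' x') =
        \<rho> x (y, z) * (s x' - r x' * c' x') + (\<rho> x (y, z) - r x * c x) * (r x' * c' x')"
      by (simp add: algebra_simps)
    also have "\<bar>\<dots>\<bar> \<le> \<rho> x (y, z) * \<bar>s x' - r x' * c' x'\<bar> + \<bar>\<rho> x (y, z) - r x * c x\<bar> * (r x' * c' x')"
      by (rule order.trans[OF abs_triangle_ineq]) (simp add: abs_mult \<rho>0 r0 c'0)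
    also have "\<dots> \<le> 1 * D + D * (1 * 1)"
    proof (intro add_mono mult_mono d1 d2 r1 c'1)
      show "\<rho> x (y, z) \<le> 1" using zs[of x] sr[of x] r1[of x] by linarith
      show "0 \<le> D" using d1[of x] by linarith
    qed (use r0 c'0 in auto)
    finally show ?thesis by simp
  qed
  have ab: "\<rho> x (y, z) * s x' = \<rho> x' (y, z) * s x" unfolding s_def by (rule ind)
  have "r x * c x * (r x' * c' x') - r x' * c x' * (r x * c' x) = r x * r x' * (c x * c' x' - c x' * c' x)"
    by (simp add: algebra_simps)
  then have "r x * r x' * \<bar>c x * c' x' - c x' * c' x\<bar> = \<bar>r x * c x * (r x' * c' x') - r x' * c x' * (r x * c' x)\<bar>"
    by (simp add: abs_mult r0)
  also have "\<dots> \<le> 4 * D" using prod[of x x'] prod[of x' x] ab by linarith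
  finally show ?thesis by (simp add: c_def c'_def)
qed

text \<open>For the \<open>y\<close> and \<open>z\<close> that witness adjacency, the expression is
  the difference of the two values of \<open>K\<close> times the conditional probabilities of
  \<open>y\<close>, hence nonzero. With finitely many letters there is a least positive
  value.\<close>

lemma adjacency_gap:
  fixes p :: "('x::finite \<times> 'y::finite) pmf" and K :: "'x \<Rightarrow> 'y \<Rightarrow> 'z::finite pmf"
  assumes full: "set_pmf (map_pmf fst p) = UNIV"
  shows "\<exists>\<kappa>>0. \<forall>x x'. adj p K x x' \<longrightarrow> (\<exists>y z. \<kappa> \<le> \<bar>channel p K x (y, z) * (\<Sum>z'\<in>UNIV. channel p K x' (y, z')) -
    channel p K x' (y, z) * (\<Sum>z'\<in>UNIV. channel p K x (y, z'))\<bar>)"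
proof -
  define gap where "gap = (\<lambda>(x, x', y, z). \<bar>channel p K x (y, z) * (\<Sum>z'\<in>UNIV. channel p K x' (y, z')) -
    channel p K x' (y, z) * (\<Sum>z'\<in>UNIV. channel p K x (y, z'))\<bar>)"
  \<comment> \<open>The inserted \<open>1\<close> keeps the set nonempty when no gap is
    positive.\<close>
  define \<kappa> where "\<kappa> = Min (insert 1 (gap ` {t. 0 < gap t}))"
  have "0 < \<kappa>" unfolding \<kappa>_def by (subst Min_gr_iff) auto
  moreover have "\<exists>y z. \<kappa> \<le> gap (x, x', y, z)" if adj: "adj p K x x'" for x x'
  proof -
    obtain y z where yz: "0 < pmf p (x, y)" "0 < pmf p (x', y)" "pmf (K x y) z \<noteq> pmf (K x' y) z"
      using adj unfolding adj_def by blast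
    let ?a = "pmf p (x, y) / pmf (map_pmf fst p) x" and ?b = "pmf p (x', y) / pmf (map_pmf fst p) x'"
    have px: "0 < pmf (map_pmf fst p) x" for x using full by (intro pmf_positive) auto
    have "channel p K x (y, z) * ?b - channel p K x' (y, z) * ?a = ?a * ?b * (pmf (K x y) z - pmf (K x' y) z)"
      by (simp add: channel_def right_diff_distrib mult_ac diff_divide_distrib)
    then have "gap (x, x', y, z) = \<bar>?a * ?b * (pmf (K x y) z - pmf (K x' y) z)\<bar>"
      unfolding gap_def prod.case sum_channel_snd by (rule arg_cong)
    moreover have "?a * ?b * (pmf (K x y) z - pmf (K x' y) z) \<noteq> 0"
      using yz px[of x] px[of x'] by auto
    ultimately have "0 < gap (x, x', y, z)" by simp
    then have "\<kappa> \<le> gap (x, x', y, z)" unfolding \<kappa>_def by (intro Min_le) auto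
    then show ?thesis by blast
  qed
  ultimately show ?thesis unfolding gap_def prod.case by blast
qed

lemma cond_graph_entropy_eq:
  fixes p :: "('x::finite \<times> 'y::finite) pmf"
  shows "cond_graph_entropy V E p =
    Inf {cmi (extend_by p q) | q. \<forall>x\<in>V. set_pmf (q x) \<subseteq> {w \<in> independent_sets V E. x \<in> w}}"
proof -
  have fst_eq: "(fst :: 'x set \<times> 'x \<times> 'y \<Rightarrow> _) = (\<lambda>(w, x, y). w)" by (auto simp: fun_eq_iff)
  have "prob_space.conditional_mutual_information (measure_pmf (extend_by p q)) 2
      (count_space UNIV) (count_space UNIV) (count_space UNIV) fst (\<lambda>(w, x, y). x) (\<lambda>(w, x, y). y) = cmi (extend_by p q)"
    for q :: "'x \<Rightarrow> 'x set pmf"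
    unfolding fst_eq by (rule conditional_mutual_information_pmf(1)) simp
  then show ?thesis by (simp only: cond_graph_entropy_def)
qed

lemma cond_graph_entropy_le:
  fixes p :: "('x::finite \<times> 'y::finite) pmf"
  assumes "\<And>x. x \<in> V \<Longrightarrow> set_pmf (q x) \<subseteq> {w \<in> independent_sets V E. x \<in> w}"
  shows "cond_graph_entropy V E p \<le> cmi (extend_by p q)"
  unfolding cond_graph_entropy_eq
  by (rule cInf_lower) (use assms cmi_nonneg_finite in \<open>auto intro!: bdd_belowI[of _ 0]\<close>)

text \<open>The set \<open>S u\<close> of likely letters nearly behaves like a variable drawn from
  \<open>x\<close> alone. Replacing it by \<open>{x}\<close> where it misses \<open>x\<close> gives
  an admissible \<open>W\<close>, and the law of \<open>(S u, x, y)\<close> is close to the one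
  generated by \<open>W\<close>; continuity of the information then allows a comparison with the
  infimum. The constant \<open>C\<close> depends on the problem and \<delta> but not on
  \<open>R\<close>, so the bound can be summed over all letters of all protocols.\<close>

lemma single_letter:
  fixes p :: "('x::finite \<times> 'y::finite) pmf" and K :: "'x \<Rightarrow> 'y \<Rightarrow> 'z::finite pmf"
  assumes full: "set_pmf (map_pmf fst p) = UNIV" and \<delta>: "0 < \<delta>"
  shows "\<exists>C\<ge>0. \<forall>R :: ('u \<times> 'x \<times> 'y \<times> 'z) pmf.
    map_pmf (\<lambda>(u, x, v). (x, fst v)) R = p \<longrightarrow>
    (\<exists>\<alpha> \<beta>. \<forall>u x y z. pmf R (u, x, y, z) = \<alpha> u x y * \<beta> u y z) \<longrightarrow>
    (\<exists>(S :: 'u \<Rightarrow> 'x set) g. (\<forall>u x v. \<bar>g u x v\<bar> \<le> 1) \<and>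
      cond_graph_entropy UNIV (adj p K) p \<le> cmi (map_pmf (\<lambda>(u, x, v). (S u, x, fst v)) R) + \<delta> +
        C * measure_pmf.expectation R (\<lambda>(u, x, v). g u x v - (\<Sum>a\<in>UNIV. channel p K x a * g u x a)))"
proof -
  let ?ch = "channel p K"
  define H where "H = cond_graph_entropy UNIV (adj p K) p"
  obtain \<rho> where \<rho>: "0 < \<rho>" and cont: "\<And>L L' :: ('x set \<times> 'x \<times> 'y) pmf.
      (\<And>t. \<bar>pmf L t - pmf L' t\<bar> \<le> \<rho>) \<Longrightarrow> \<bar>cmi L - cmi L'\<bar> \<le> \<delta>"
    using cmi_continuity[OF \<delta>, where 'u = "'x set" and 'v = 'x and 'w = 'y] by metis
  obtain \<kappa> where \<kappa>: "0 < \<kappa>" and gap: "\<And>x x'. adj p K x x' \<Longrightarrow>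
      \<exists>y z. \<kappa> \<le> \<bar>?ch x (y, z) * (\<Sum>z'\<in>UNIV. ?ch x' (y, z')) - ?ch x' (y, z) * (\<Sum>z'\<in>UNIV. ?ch x (y, z'))\<bar>"
    using adjacency_gap[OF full, of K] by metis
  \<comment> \<open>Half of the tolerance \<rho> is allotted to letters below the threshold, the
    other half to the deviation from the channel.\<close>
  define \<theta> where "\<theta> = \<rho> / 2"
  have \<theta>: "0 < \<theta>" using \<rho> by (simp add: \<theta>_def)
  \<comment> \<open>The summand \<open>1\<close> pays for likely letters, the other one for those
    \<open>u\<close> at which the likely letters contain an edge.\<close>
  define A where "A = 1 + 4 / (\<kappa> * \<theta>\<^sup>2)"
  have A: "0 < A" using \<kappa> \<theta> by (simp add: A_def add_pos_pos)
  define d0 where "d0 = \<rho> / 2 / A"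
  have d0: "0 < d0" using \<rho> A by (simp add: d0_def)
  \<comment> \<open>For a deviation above \<open>d0\<close> the continuity estimate is void, but
    there \<open>C\<close> times the deviation is at least \<open>\<bar>H\<bar>\<close> and the
    claim is trivial.\<close>
  define C where "C = \<bar>H\<bar> / d0"
  have C: "0 \<le> C" using d0 by (simp add: C_def)
  have chs: "(\<Sum>v\<in>UNIV. ?ch x v) = 1" for x using sum_channel[of x p K] full by simp
  have ch1: "?ch x v \<le> 1" for x v
    unfolding chs[of x, symmetric] by (rule member_le_sum) (auto simp: channel_nonneg)
  have chz: "(\<Sum>z\<in>UNIV. ?ch x (y, z)) \<le> 1" "0 \<le> (\<Sum>z\<in>UNIV. ?ch x (y, z))" for x y
    unfolding sum_channel_snd using pmf_le_pmf_map[of p "(x, y)" fst] by (auto simp: divide_le_eq)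
  have "\<exists>(S :: 'u \<Rightarrow> 'x set) g. (\<forall>u x v. \<bar>g u x v\<bar> \<le> 1) \<and>
      H \<le> cmi (map_pmf (\<lambda>(u, x, v). (S u, x, fst v)) R) + \<delta> +
        C * measure_pmf.expectation R (\<lambda>(u, x, v). g u x v - (\<Sum>a\<in>UNIV. ?ch x a * g u x a))"
    if Rp: "map_pmf (\<lambda>(u, x, v). (x, fst v)) R = p"
      and fac: "\<And>u x y z. pmf R (u, x, y, z) = \<alpha> u x y * \<beta> u y z" for R :: "('u \<times> 'x \<times> 'y \<times> 'z) pmf" and \<alpha> \<beta>
  proof -
    let ?U = "map_pmf fst R"
    define c where "c u x v = pmf R (u, x, v) / pmf ?U u" for u x v
    define r where "r u x = (\<Sum>v\<in>UNIV. c u x v)" for u x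
    define D where "D u = (\<Sum>x\<in>UNIV. \<Sum>v\<in>UNIV. \<bar>c u x v - r u x * ?ch x v\<bar>)" for u
    \<comment> \<open>The sign is the test function that attains the \<open>L1\<close> distance
      \<open>D u\<close>. Its deviation from the channel mean therefore has expectation equal to
      that of \<open>D\<close>.\<close>
    define g where "g u x v = sgn (c u x v - r u x * ?ch x v)" for u x v
    define d where "d = measure_pmf.expectation R (\<lambda>(u, x, v). g u x v - (\<Sum>a\<in>UNIV. ?ch x a * g u x a))"
    have UN: "(UNIV :: ('x \<times> 'y \<times> 'z) set) = UNIV \<times> UNIV" "(UNIV :: ('y \<times> 'z) set) = UNIV \<times> UNIV" by simp_all
    have c0: "0 \<le> c u x v" for u x v by (simp add: c_def)
    have r0: "0 \<le> r u x" for u x unfolding r_def by (intro sum_nonneg c0)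
    have c1: "(\<Sum>x\<in>UNIV. \<Sum>v\<in>UNIV. c u x v) = 1" if "u \<in> set_pmf ?U" for u
      using sum_disintegrate[OF that] unfolding UN(1) sum.cartesian_product' c_def .
    have r1: "r u x \<le> 1" for u x
    proof (cases "u \<in> set_pmf ?U")
      case True
      show ?thesis unfolding c1[OF True, symmetric] r_def
        by (rule member_le_sum) (auto intro: sum_nonneg c0)
    next
      case False
      then have "pmf ?U u = 0" by (simp only: set_pmf_iff not_not)
      then show ?thesis by (simp add: r_def c_def)
    qed
    have c_le: "c u x v \<le> r u x" for u x v unfolding r_def by (rule member_le_sum) (auto intro: c0)
    have D0: "0 \<le> D u" for u unfolding D_def by (intro sum_nonneg) auto
    define B where "B = real CARD('x) * (real CARD('y \<times> 'z) * 2)"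
    have DB: "D u \<le> B" for u
    proof -
      have "\<bar>c u x v - r u x * ?ch x v\<bar> \<le> 2" for x v
      proof -
        have "r u x * ?ch x v \<le> 1 * 1" by (intro mult_mono r1 ch1 r0 channel_nonneg) simp
        moreover have "0 \<le> r u x * ?ch x v" by (intro mult_nonneg_nonneg r0 channel_nonneg)
        ultimately show ?thesis using c0[of u x v] c_le[of u x v] r1[of u x] by linarith
      qed
      then have "D u \<le> (\<Sum>x\<in>(UNIV :: 'x set). \<Sum>v\<in>(UNIV :: ('y \<times> 'z) set). 2)" unfolding D_def by (intro sum_mono)
      then show ?thesis by (simp add: B_def)
    qed
    have intD: "integrable (measure_pmf ?U) D"
      by (rule measure_pmf.integrable_const_bound[where B = B]) (use D0 DB in \<open>auto simp: abs_le_iff intro: order.trans\<close>)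
    have g1: "\<bar>g u x v\<bar> \<le> 1" for u x v by (simp add: g_def abs_sgn_eq)
    have chg: "\<bar>\<Sum>a\<in>UNIV. ?ch x a * g u x a\<bar> \<le> 1" for u x
    proof -
      have "\<bar>\<Sum>a\<in>UNIV. ?ch x a * g u x a\<bar> \<le> (\<Sum>a\<in>UNIV. ?ch x a)"
        by (rule order.trans[OF sum_abs sum_mono])
          (use g1 in \<open>simp add: abs_mult abs_of_nonneg[OF channel_nonneg] mult_left_le channel_nonneg\<close>)
      then show ?thesis by (simp add: chs)
    qed
    have d_eq: "d = measure_pmf.expectation ?U D"
    proof -
      let ?h = "\<lambda>(u, x, v). g u x v - (\<Sum>a\<in>UNIV. ?ch x a * g u x a)"
      have hB: "\<bar>?h t\<bar> \<le> 2" for t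
      proof -
        obtain u x v where t: "t = (u, x, v)" by (metis surj_pair)
        show ?thesis unfolding t prod.case using g1[of u x v] chg[of x u] by linarith
      qed
      have "d = measure_pmf.expectation ?U (\<lambda>u. \<Sum>f\<in>UNIV. pmf R (u, f) / pmf ?U u * ?h (u, f))"
        unfolding d_def by (rule expectation_disintegrate[OF hB])
      also have "(\<lambda>u. \<Sum>f\<in>UNIV. pmf R (u, f) / pmf ?U u * ?h (u, f)) = D"
      proof
        fix u
        have "(\<Sum>f\<in>UNIV. pmf R (u, f) / pmf ?U u * ?h (u, f)) =
            (\<Sum>x\<in>UNIV. \<Sum>v\<in>UNIV. c u x v * (g u x v - (\<Sum>a\<in>UNIV. ?ch x a * g u x a)))"
          unfolding UN(1) sum.cartesian_product' c_def prod.case ..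
        also have "\<dots> = D u"
          unfolding D_def
        proof (rule sum.cong[OF refl])
          fix x
          have "(\<Sum>v\<in>UNIV. c u x v * (g u x v - (\<Sum>a\<in>UNIV. ?ch x a * g u x a))) =
              (\<Sum>v\<in>UNIV. c u x v * g u x v) - r u x * (\<Sum>a\<in>UNIV. ?ch x a * g u x a)"
            by (simp add: right_diff_distrib sum_subtractf r_def sum_distrib_right)
          also have "\<dots> = (\<Sum>v\<in>UNIV. (c u x v - r u x * ?ch x v) * g u x v)"
            by (simp add: left_diff_distrib sum_subtractf sum_distrib_left mult.assoc)
          also have "\<dots> = (\<Sum>v\<in>UNIV. \<bar>c u x v - r u x * ?ch x v\<bar>)"
            by (intro sum.cong refl) (simp add: g_def abs_sgn)
          finally show "(\<Sum>v\<in>UNIV. c u x v * (g u x v - (\<Sum>a\<in>UNIV. ?ch x a * g u x a))) =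
            (\<Sum>v\<in>UNIV. \<bar>c u x v - r u x * ?ch x v\<bar>)" .
        qed
        finally show "(\<Sum>f\<in>UNIV. pmf R (u, f) / pmf ?U u * ?h (u, f)) = D u" .
      qed
      finally show ?thesis .
    qed
    have d_nn: "0 \<le> d" unfolding d_eq by (intro Bochner_Integration.integral_nonneg D0)
    define S0 where "S0 u = {x. \<theta> < r u x}" for u
    \<comment> \<open>Where the likely letters contain an edge, the empty set is a harmless value:
      \<open>W\<close> then falls back on \<open>{x}\<close>.\<close>
    define S where "S u = (if S0 u \<in> independent_sets UNIV (adj p K) then S0 u else {})" for u
    define W where "W u x = (if x \<in> S u then S u else {x})" for u x
    \<comment> \<open>Drawing \<open>W\<close> from \<open>x\<close> alone enforces the chain
      \<open>W - X - Y\<close>, which need not hold for \<open>S u\<close> itself because the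
      transcript may depend on \<open>y\<close>.\<close>
    define q where "q x = map_pmf (\<lambda>(u, x', v). W u x') (cond_pmf R {t. fst (snd t) = x})" for x
    \<comment> \<open>An edge among the likely letters forces a deviation of order
      \<open>\<kappa> * \<theta>\<^sup>2\<close> at this \<open>u\<close>, so such \<open>u\<close>
      can be charged to \<open>D u\<close>.\<close>
    have bad: "1 \<le> 4 / (\<kappa> * \<theta>\<^sup>2) * D u" if u: "u \<in> set_pmf ?U" and ni: "S0 u \<notin> independent_sets UNIV (adj p K)" for u
    proof -
      obtain x x' where xx: "x \<in> S0 u" "x' \<in> S0 u" "adj p K x x'"
        using ni by (auto simp: independent_sets_def)
      obtain y z where yz: "\<kappa> \<le> \<bar>?ch x (y, z) * (\<Sum>z'\<in>UNIV. ?ch x' (y, z')) - ?ch x' (y, z) * (\<Sum>z'\<in>UNIV. ?ch x (y, z'))\<bar>"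
        using gap[OF xx(3)] by blast
      have "\<theta>\<^sup>2 \<le> r u x * r u x'"
        unfolding power2_eq_square using xx \<theta> by (intro mult_mono) (auto simp: S0_def)
      then have "\<theta>\<^sup>2 * \<kappa> \<le> r u x * r u x' * \<bar>?ch x (y, z) * (\<Sum>z'\<in>UNIV. ?ch x' (y, z')) - ?ch x' (y, z) * (\<Sum>z'\<in>UNIV. ?ch x (y, z'))\<bar>"
        using yz \<kappa> r0 by (intro mult_mono) auto
      also have "\<dots> \<le> 4 * D u"
      proof (rule adjacent_product_le[where \<rho> = "c u"])
        show "c u x (y, z) * (\<Sum>z'\<in>UNIV. c u x' (y, z')) = c u x' (y, z) * (\<Sum>z'\<in>UNIV. c u x (y, z'))" for x x' y z
          unfolding c_def fac sum_distrib_left by (intro sum.cong refl) simp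
      qed (use c0 c1[OF u] in \<open>simp_all add: r_def D_def\<close>)
      finally show ?thesis using \<kappa> \<theta> by (simp add: field_simps)
    qed
    \<comment> \<open>For \<open>x\<close> in \<open>S u\<close> the two terms differ by the
      deviation from the channel. Otherwise both lie between \<open>0\<close> and
      \<open>r u x\<close>, which is at most the threshold or, at a bad \<open>u\<close>, charged to
      the deviation.\<close>
    have loc: "\<bar>indicator {w} (S u) * (\<Sum>z\<in>UNIV. c u x (y, z)) - indicator {w} (W u x) * (r u x * (\<Sum>z\<in>UNIV. ?ch x (y, z)))\<bar>
        \<le> A * D u + \<theta>" if u: "u \<in> set_pmf ?U" for u w x y
    proof -
      let ?a = "\<Sum>z\<in>UNIV. c u x (y, z)" and ?b = "r u x * (\<Sum>z\<in>UNIV. ?ch x (y, z))"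
      have AD: "D u \<le> A * D u" using D0[of u] \<kappa> \<theta> by (simp add: A_def distrib_right)
      have a0: "0 \<le> ?a" by (intro sum_nonneg c0)
      have b0: "0 \<le> ?b" using r0 chz by simp
      have ar: "?a \<le> r u x"
      proof -
        have "?a \<le> (\<Sum>y\<in>UNIV. \<Sum>z\<in>UNIV. c u x (y, z))"
          by (rule member_le_sum[of y]) (auto intro: sum_nonneg c0)
        also have "\<dots> = r u x" unfolding r_def UN(2) sum.cartesian_product' ..
        finally show ?thesis .
      qed
      have br: "?b \<le> r u x" using r0[of u x] chz[of x y] by (simp add: mult_left_le)
      show ?thesis
      proof (cases "x \<in> S u")
        case True
        have "\<bar>?a - ?b\<bar> = \<bar>\<Sum>z\<in>UNIV. c u x (y, z) - r u x * ?ch x (y, z)\<bar>"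
          by (simp add: sum_subtractf sum_distrib_left)
        also have "\<dots> \<le> (\<Sum>z\<in>UNIV. \<bar>c u x (y, z) - r u x * ?ch x (y, z)\<bar>)" by (rule sum_abs)
        also have "\<dots> \<le> (\<Sum>y\<in>UNIV. \<Sum>z\<in>UNIV. \<bar>c u x (y, z) - r u x * ?ch x (y, z)\<bar>)"
          by (rule member_le_sum[of y]) (auto intro: sum_nonneg)
        also have "\<dots> = (\<Sum>v\<in>UNIV. \<bar>c u x v - r u x * ?ch x v\<bar>)" unfolding UN(2) sum.cartesian_product' ..
        also have "\<dots> \<le> D u" unfolding D_def by (rule member_le_sum[of x]) (auto intro: sum_nonneg)
        finally have "\<bar>?a - ?b\<bar> \<le> A * D u + \<theta>" using AD \<theta> by linarith
        moreover have "0 \<le> A * D u + \<theta>" using A D0[of u] \<theta> by simp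
        ultimately show ?thesis using True by (simp add: W_def indicator_def)
      next
        case False
        have "r u x \<le> A * D u + \<theta>"
        proof (cases "S0 u \<in> independent_sets UNIV (adj p K)")
          case True
          then have "r u x \<le> \<theta>" using False by (simp add: S_def S0_def)
          then show ?thesis using A D0[of u] by (simp add: add_increasing)
        next
          case bad': False
          have "r u x \<le> 4 / (\<kappa> * \<theta>\<^sup>2) * D u" using bad[OF u bad'] r1[of u x] by linarith
          also have "\<dots> \<le> A * D u" using D0[of u] by (simp add: A_def distrib_right)
          finally show ?thesis using \<theta> by linarith
        qed
        then show ?thesis using a0 b0 ar br by (auto simp: indicator_def)
      qed
    qed
    let ?L = "map_pmf (\<lambda>(u, x, v). (S u, x, fst v)) R"
    have close: "\<bar>pmf ?L t - pmf (extend_by p q) t\<bar> \<le> A * d + \<theta>" for t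
    proof -
      obtain w x y where t: "t = (w, x, y)" by (metis surj_pair)
      let ?f = "\<lambda>u. indicator {w} (S u) * (\<Sum>z\<in>UNIV. c u x (y, z))"
      let ?k = "\<lambda>u. indicator {w} (W u x) * (r u x * (\<Sum>z\<in>UNIV. ?ch x (y, z)))"
      let ?kk = "\<lambda>u. indicator {w} (W u x) * r u x"
      have "pmf ?L t = measure_pmf.expectation R (indicator {(u, x', v). S u = w \<and> x' = x \<and> fst v = y})"
        unfolding pmf_map t by (auto intro!: arg_cong[where f="measure _"])
      also have "\<dots> = measure_pmf.expectation ?U (\<lambda>u. \<Sum>f\<in>UNIV. pmf R (u, f) / pmf ?U u *
          indicator {(u, x', v). S u = w \<and> x' = x \<and> fst v = y} (u, f))"
        by (rule expectation_disintegrate[where B = 1]) (simp add: indicator_def)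
      also have "\<dots> = measure_pmf.expectation ?U ?f"
      proof (intro Bochner_Integration.integral_cong refl)
        fix u
        have "(\<Sum>f\<in>UNIV. pmf R (u, f) / pmf ?U u * indicator {(u, x', v). S u = w \<and> x' = x \<and> fst v = y} (u, f)) =
            (\<Sum>x'\<in>UNIV. \<Sum>y'\<in>UNIV. \<Sum>z\<in>UNIV. c u x' (y', z) * (indicator {w} (S u) * (if x' = x then 1 else 0) * (if y' = y then 1 else 0)))"
          unfolding UN(1) sum.cartesian_product' unfolding UN(2) sum.cartesian_product' c_def
          by (intro sum.cong refl) (simp add: indicator_def)
        also have "\<dots> = (\<Sum>x'\<in>UNIV. if x' = x then (\<Sum>y'\<in>UNIV. if y' = y then ?f u else 0) else 0)"
        proof (rule sum.cong[OF refl])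
          fix x'
          have "(\<Sum>z\<in>UNIV. c u x' (y', z) * (indicator {w} (S u) * (if x' = x then 1 else 0) * (if y' = y then 1 else 0))) =
              (if x' = x then if y' = y then ?f u else 0 else 0)" for y'
            by (simp add: sum_distrib_left mult.commute)
          then show "(\<Sum>y'\<in>UNIV. \<Sum>z\<in>UNIV. c u x' (y', z) * (indicator {w} (S u) * (if x' = x then 1 else 0) * (if y' = y then 1 else 0))) =
              (if x' = x then (\<Sum>y'\<in>UNIV. if y' = y then ?f u else 0) else 0)"
            by (simp only: if_distrib[of "sum _"] sum.neutral_const split: if_split) simp
        qed
        also have "\<dots> = ?f u" by simp
        finally show "(\<Sum>f\<in>UNIV. pmf R (u, f) / pmf ?U u * indicator {(u, x', v). S u = w \<and> x' = x \<and> fst v = y} (u, f)) = ?f u" .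
      qed
      finally have L1: "pmf ?L t = measure_pmf.expectation ?U ?f" .
      have pX: "map_pmf (\<lambda>(u, x, v). x) R = map_pmf fst p"
        using arg_cong[OF Rp, of "map_pmf fst"] by (simp add: pmf.map_comp o_def case_prod_unfold)
      have prX: "measure_pmf.prob R {t. fst (snd t) = x} = pmf (map_pmf fst p) x"
        unfolding pX[symmetric] pmf_map by (intro arg_cong[where f="measure _"]) auto
      have pXpos: "0 < pmf (map_pmf fst p) x" using full by (intro pmf_positive) auto
      have ne: "set_pmf R \<inter> {t. fst (snd t) = x} \<noteq> {}"
      proof
        assume "set_pmf R \<inter> {t. fst (snd t) = x} = {}"
        then have "measure_pmf.prob R {t. fst (snd t) = x} = 0" by (simp add: measure_pmf_zero_iff)
        then show False using prX pXpos by simp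
      qed
      have "emeasure (measure_pmf R) {t. fst (snd t) = x} \<noteq> 0"
        using prX pXpos by (simp add: measure_pmf.emeasure_eq_measure)
      then have "pmf (q x) w = measure_pmf.prob R ({t. fst (snd t) = x} \<inter> (\<lambda>(u, x', v). W u x') -` {w}) / pmf (map_pmf fst p) x"
        unfolding q_def pmf_map[of _ "cond_pmf R _"] cond_pmf.rep_eq[OF ne] prX[symmetric]
        by (subst measure_uniform_measure) auto
      also have "measure_pmf.prob R ({t. fst (snd t) = x} \<inter> (\<lambda>(u, x', v). W u x') -` {w}) =
          measure_pmf.expectation R (indicator {(u, x', v). x' = x \<and> W u x' = w})"
        by (auto intro!: arg_cong[where f="measure _"])
      also have "\<dots> = measure_pmf.expectation ?U (\<lambda>u. \<Sum>f\<in>UNIV. pmf R (u, f) / pmf ?U u *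
          indicator {(u, x', v). x' = x \<and> W u x' = w} (u, f))"
        by (rule expectation_disintegrate[where B = 1]) (simp add: indicator_def)
      also have "\<dots> = measure_pmf.expectation ?U ?kk"
      proof (intro Bochner_Integration.integral_cong refl)
        fix u
        have "(\<Sum>f\<in>UNIV. pmf R (u, f) / pmf ?U u * indicator {(u, x', v). x' = x \<and> W u x' = w} (u, f)) =
            (\<Sum>x'\<in>UNIV. \<Sum>v\<in>UNIV. c u x' v * (if x' = x then indicator {w} (W u x) else 0))"
          unfolding UN(1) sum.cartesian_product' c_def
          by (intro sum.cong refl) (simp add: indicator_def)
        also have "\<dots> = (\<Sum>x'\<in>UNIV. if x' = x then ?kk u else 0)"
          by (intro sum.cong refl) (auto simp: r_def sum_distrib_left mult.commute)
        also have "\<dots> = ?kk u" by simp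
        finally show "(\<Sum>f\<in>UNIV. pmf R (u, f) / pmf ?U u * indicator {(u, x', v). x' = x \<and> W u x' = w} (u, f)) = ?kk u" .
      qed
      finally have qx: "pmf (q x) w = measure_pmf.expectation ?U ?kk / pmf (map_pmf fst p) x" .
      have "pmf (extend_by p q) t = (\<Sum>z\<in>UNIV. ?ch x (y, z)) * measure_pmf.expectation ?U ?kk"
        unfolding t pmf_extend_by qx sum_channel_snd by simp
      also have "\<dots> = measure_pmf.expectation ?U ?k"
      proof -
        have "?k = (\<lambda>u. (\<Sum>z\<in>UNIV. ?ch x (y, z)) * ?kk u)" by (simp add: fun_eq_iff mult_ac)
        then show ?thesis by (simp only: integral_mult_right_zero)
      qed
      finally have L2: "pmf (extend_by p q) t = measure_pmf.expectation ?U ?k" .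
      have intf: "integrable (measure_pmf ?U) ?f"
      proof (rule measure_pmf.integrable_const_bound[where B = 1], rule AE_pmfI)
        fix u
        have "(\<Sum>z\<in>UNIV. c u x (y, z)) \<le> (\<Sum>y\<in>UNIV. \<Sum>z\<in>UNIV. c u x (y, z))"
          by (rule member_le_sum[of y]) (auto intro: sum_nonneg c0)
        also have "\<dots> = r u x" unfolding r_def UN(2) sum.cartesian_product' ..
        finally have "(\<Sum>z\<in>UNIV. c u x (y, z)) \<le> 1" using r1[of u x] by linarith
        moreover have "0 \<le> (\<Sum>z\<in>UNIV. c u x (y, z))" by (intro sum_nonneg c0)
        ultimately show "norm (?f u) \<le> 1" by (simp add: indicator_def)
      qed simp
      have intk: "integrable (measure_pmf ?U) ?k"
      proof (rule measure_pmf.integrable_const_bound[where B = 1], rule AE_pmfI)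
        fix u
        have "r u x * (\<Sum>z\<in>UNIV. ?ch x (y, z)) \<le> 1 * 1" using r0 r1 chz by (intro mult_mono) auto
        moreover have "0 \<le> r u x * (\<Sum>z\<in>UNIV. ?ch x (y, z))" using r0 chz by simp
        ultimately show "norm (?k u) \<le> 1" by (simp add: indicator_def)
      qed simp
      have "pmf ?L t - pmf (extend_by p q) t = measure_pmf.expectation ?U (\<lambda>u. ?f u - ?k u)"
        unfolding L1 L2 using intf intk by (rule Bochner_Integration.integral_diff[symmetric])
      also have "\<bar>\<dots>\<bar> \<le> measure_pmf.expectation ?U (\<lambda>u. \<bar>?f u - ?k u\<bar>)" by (rule integral_abs_bound)
      also have "\<dots> \<le> measure_pmf.expectation ?U (\<lambda>u. A * D u + \<theta>)"
        by (rule integral_mono_AE) (use intf intk intD loc in \<open>auto intro!: AE_pmfI\<close>)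
      also have "\<dots> = A * d + \<theta>" using intD by (simp add: d_eq)
      finally show ?thesis .
    qed
    have feas: "set_pmf (q x) \<subseteq> {w \<in> independent_sets UNIV (adj p K). x \<in> w}" for x
    proof -
      have "{x} \<in> independent_sets UNIV (adj p K)" "{} \<in> independent_sets UNIV (adj p K)"
        by (simp_all add: independent_sets_def adj_def)
      then have W: "W u x \<in> independent_sets UNIV (adj p K)" "x \<in> W u x" for u
        by (simp_all add: W_def S_def)
      have "set_pmf (map_pmf fst (map_pmf (\<lambda>(u, x, v). (x, fst v)) R)) = UNIV" using full Rp by simp
      then have "(\<lambda>t. fst (snd t)) ` set_pmf R = UNIV" by (simp add: image_image case_prod_unfold)
      then obtain t where "t \<in> set_pmf R" "x = fst (snd t)" by blast
      then have ne: "set_pmf R \<inter> {t. fst (snd t) = x} \<noteq> {}" by blast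
      show ?thesis
      proof
        fix w assume "w \<in> set_pmf (q x)"
        then obtain t where t: "t \<in> set_pmf (cond_pmf R {t. fst (snd t) = x})" "w = (\<lambda>(u, x', v). W u x') t"
          unfolding q_def set_map_pmf by blast
        have "fst (snd t) = x" using t(1) unfolding set_cond_pmf[OF ne] by simp
        then have "w = W (fst t) x" using t(2) by (simp add: case_prod_unfold)
        then show "w \<in> {w \<in> independent_sets UNIV (adj p K). x \<in> w}" using W by simp
      qed
    qed
    have "H \<le> cmi (extend_by p q)" unfolding H_def by (rule cond_graph_entropy_le) (rule feas)
    have "H \<le> cmi ?L + \<delta> + C * d"
    proof (cases "d \<le> d0")
      case True
      have "A * d \<le> \<rho> / 2" using True A by (simp add: d0_def field_simps)
      then have "\<bar>pmf ?L t - pmf (extend_by p q) t\<bar> \<le> \<rho>" for t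
        using close[of t] by (simp add: \<theta>_def)
      from cont[OF this] have "\<bar>cmi ?L - cmi (extend_by p q)\<bar> \<le> \<delta>" .
      moreover have "0 \<le> C * d" using C d_nn by simp
      ultimately show ?thesis using \<open>H \<le> cmi (extend_by p q)\<close> by linarith
    next
      case False
      have "\<bar>H\<bar> = C * d0" using d0 by (simp add: C_def)
      also have "\<dots> \<le> C * d" using C False by (intro mult_left_mono) auto
      finally show ?thesis using cmi_nonneg_finite[of ?L] \<delta> by linarith
    qed
    then show ?thesis using g1 unfolding d_def by (intro exI[of _ S] exI[of _ g] conjI allI)
  qed
  then show ?thesis using C unfolding H_def by (intro exI[of _ C] conjI allI impI) (assumption, elim exE, blast)
qed

section \<open>Sequential normalisation\<close>

text \<open>A protocol may have infinitely many possible transcripts; monotone convergence over a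
  bound on the length extends the finite inequality.\<close>

lemma kraft_infinite:
  fixes C :: "msg set"
  assumes "prefix_free C"
  shows "(\<integral>\<^sup>+ m. indicator C m * ennreal ((1 / 2) ^ length m) \<partial>count_space UNIV) \<le> 1"
proof -
  define f :: "nat \<Rightarrow> msg \<Rightarrow> ennreal" where
    "f N m = indicator (C \<inter> {m. length m \<le> N}) m * ennreal ((1 / 2) ^ length m)" for N m
  have inc: "incseq f"
    by (auto simp: f_def incseq_def le_fun_def indicator_def)
  have fin: "finite {m :: msg. length m \<le> N}" for N
    using finite_lists_length_le[of "UNIV :: bool set" N] by simp
  have le: "integral\<^sup>N (count_space UNIV) (f N) \<le> 1" for N
  proof -
    let ?D = "C \<inter> {m. length m \<le> N}"
    have "integral\<^sup>N (count_space UNIV) (f N) = (\<Sum>m\<in>?D. f N m)"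
      using fin[of N] by (intro nn_integral_count_space') (auto simp: f_def)
    also have "\<dots> = (\<Sum>m\<in>?D. ennreal ((1 / 2) ^ length m))"
      by (intro sum.cong refl) (simp add: f_def)
    also have "\<dots> = ennreal (\<Sum>m\<in>?D. (1 / 2) ^ length m)" by (rule sum_ennreal) simp
    also have "\<dots> \<le> ennreal 1"
      using assms fin[of N] by (intro ennreal_leI kraft_finite) (auto simp: prefix_free_def)
    finally show ?thesis by simp
  qed
  have "indicator C m * ennreal ((1 / 2) ^ length m) = (SUP N. f N m)" for m
  proof (rule antisym)
    show "indicator C m * ennreal ((1 / 2) ^ length m) \<le> (SUP N. f N m)"
      by (rule SUP_upper2[of "length m"]) (auto simp: f_def indicator_def)
    show "(SUP N. f N m) \<le> indicator C m * ennreal ((1 / 2) ^ length m)"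
      by (rule SUP_least) (auto simp: f_def indicator_def)
  qed
  then have "(\<integral>\<^sup>+ m. indicator C m * ennreal ((1 / 2) ^ length m) \<partial>count_space UNIV) =
      (\<integral>\<^sup>+ m. (SUP N. f N m) \<partial>count_space UNIV)" by simp
  also have "\<dots> = (SUP N. integral\<^sup>N (count_space UNIV) (f N))"
    by (rule nn_integral_monotone_convergence_SUP[OF inc]) simp
  also have "\<dots> \<le> 1" by (rule SUP_least) (rule le)
  finally show ?thesis .
qed

text \<open>The last letter occurs in its own factor only, so the letters can be summed out from the
  last to the first.\<close>

lemma sum_lists_prefix:
  fixes F :: "nat \<Rightarrow> 'a::finite list \<Rightarrow> 'a \<Rightarrow> real"
  assumes nn: "\<And>i s a. 0 \<le> F i s a" and le: "\<And>i s. (\<Sum>a\<in>UNIV. F i s a) \<le> 1"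
  shows "(\<Sum>xs\<in>{xs. length xs = n}. \<Prod>i<n. F i (take i xs) (xs ! i)) \<le> 1"
proof (induction n)
  case (Suc n)
  have eq: "{xs :: 'a list. length xs = Suc n} = (\<lambda>(xs, a). xs @ [a]) ` ({xs. length xs = n} \<times> UNIV)"
  proof (rule set_eqI)
    fix xs :: "'a list"
    show "xs \<in> {xs. length xs = Suc n} \<longleftrightarrow> xs \<in> (\<lambda>(xs, a). xs @ [a]) ` ({xs. length xs = n} \<times> UNIV)"
      by (cases xs rule: rev_cases) auto
  qed
  have inj: "inj_on (\<lambda>(xs, a). xs @ [a]) ({xs :: 'a list. length xs = n} \<times> UNIV)"
    by (auto simp: inj_on_def)
  have "(\<Sum>xs\<in>{xs. length xs = Suc n}. \<Prod>i<Suc n. F i (take i xs) (xs ! i)) =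
      (\<Sum>(xs, a)\<in>{xs. length xs = n} \<times> UNIV. \<Prod>i<Suc n. F i (take i (xs @ [a])) ((xs @ [a]) ! i))"
    unfolding eq by (subst sum.reindex[OF inj]) (simp add: case_prod_unfold)
  also have "\<dots> = (\<Sum>xs\<in>{xs. length xs = n}. \<Sum>a\<in>UNIV. (\<Prod>i<n. F i (take i xs) (xs ! i)) * F n xs a)"
    unfolding sum.cartesian_product' by (intro sum.cong refl) (simp add: nth_append)
  also have "\<dots> = (\<Sum>xs\<in>{xs. length xs = n}. (\<Prod>i<n. F i (take i xs) (xs ! i)) * (\<Sum>a\<in>UNIV. F n xs a))"
    by (simp add: sum_distrib_left)
  also have "\<dots> \<le> (\<Sum>xs\<in>{xs. length xs = n}. (\<Prod>i<n. F i (take i xs) (xs ! i)))"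
    by (intro sum_mono mult_left_le le prod_nonneg) (simp add: nn)
  also have "\<dots> \<le> 1" by (rule Suc.IH)
  finally show ?case .
qed simp

lemma sum_lists_Suc:
  fixes f :: "'a::finite list \<Rightarrow> real"
  shows "(\<Sum>xs\<in>{xs. length xs = Suc n}. f xs) = (\<Sum>xs\<in>{xs. length xs = n}. \<Sum>a\<in>UNIV. f (a # xs))"
proof -
  have eq: "{xs :: 'a list. length xs = Suc n} = (\<lambda>(xs, a). a # xs) ` ({xs. length xs = n} \<times> UNIV)"
    by (auto simp: length_Suc_conv image_iff)
  have inj: "inj_on (\<lambda>(xs, a). a # xs) ({xs :: 'a list. length xs = n} \<times> UNIV)"
    by (auto simp: inj_on_def)
  show ?thesis
    unfolding eq sum.reindex[OF inj] sum.cartesian_product' by simp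
qed

text \<open>The mirror image: here it is the first letter that occurs in its own factor
  only.\<close>

lemma sum_lists_suffix:
  fixes F :: "nat \<Rightarrow> 'a::finite list \<Rightarrow> 'a \<Rightarrow> real"
  assumes nn: "\<And>i s a. 0 \<le> F i s a" and le: "\<And>i s. (\<Sum>a\<in>UNIV. F i s a) \<le> 1"
  shows "(\<Sum>xs\<in>{xs. length xs = n}. \<Prod>i<n. F i (drop (Suc i) xs) (xs ! i)) \<le> 1"
  using assms
proof (induction n arbitrary: F)
  case (Suc n)
  have "(\<Sum>xs\<in>{xs. length xs = Suc n}. \<Prod>i<Suc n. F i (drop (Suc i) xs) (xs ! i)) =
      (\<Sum>xs\<in>{xs. length xs = n}. (\<Sum>a\<in>UNIV. F 0 xs a) * (\<Prod>i<n. F (Suc i) (drop (Suc i) xs) (xs ! i)))"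
    unfolding sum_lists_Suc by (simp add: prod.lessThan_Suc_shift sum_distrib_right del: prod.lessThan_Suc)
  also have "\<dots> \<le> (\<Sum>xs\<in>{xs. length xs = n}. 1 * (\<Prod>i<n. F (Suc i) (drop (Suc i) xs) (xs ! i)))"
    by (intro sum_mono mult_right_mono Suc.prems prod_nonneg)
  also have "\<dots> \<le> 1" using Suc.IH[of "\<lambda>i. F (Suc i)"] Suc.prems by simp
  finally show ?case .
qed simp

lemma nn_integral_measure_pmf_count_space:
  "(\<integral>\<^sup>+ x. f x \<partial>measure_pmf L) = (\<integral>\<^sup>+ x. ennreal (pmf L x) * f x \<partial>count_space UNIV)"
  by (simp add: measure_pmf_eq_density nn_integral_density)

lemma nn_integral_finite_lists_le:
  fixes f :: "'a::finite list \<Rightarrow> real"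
  assumes "\<And>xs. length xs = n \<Longrightarrow> 0 \<le> f xs" "(\<Sum>xs\<in>{xs. length xs = n}. f xs) \<le> B"
  shows "(\<integral>\<^sup>+ xs. ennreal (indicator {xs. length xs = n} xs * f xs) \<partial>count_space UNIV) \<le> ennreal B"
proof -
  have "(\<integral>\<^sup>+ xs. ennreal (indicator {xs. length xs = n} xs * f xs) \<partial>count_space UNIV) =
      (\<Sum>xs\<in>{xs. length xs = n}. ennreal (indicator {xs. length xs = n} xs * f xs))"
    by (intro nn_integral_count_space' finite_lists_length) auto
  also have "\<dots> = (\<Sum>xs\<in>{xs. length xs = n}. ennreal (f xs))" by (intro sum.cong refl) simp
  also have "\<dots> = ennreal (\<Sum>xs\<in>{xs. length xs = n}. f xs)" by (rule sum_ennreal) (simp add: assms(1))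
  also have "\<dots> \<le> ennreal B" by (rule ennreal_leI) (rule assms(2))
  finally show ?thesis .
qed

lemma replicate_pmf_component: "i < n \<Longrightarrow> map_pmf (\<lambda>ts. ts ! i) (replicate_pmf n e) = e"
proof (induction n arbitrary: i)
  case (Suc n)
  show ?case
  proof (cases i)
    case 0
    then have "map_pmf (\<lambda>ts. ts ! i) (replicate_pmf (Suc n) e) = map_pmf fst (pair_pmf e (replicate_pmf n e))"
      unfolding replicate_pmf_Suc_pair pmf.map_comp by (intro map_pmf_cong refl) (auto simp: case_prod_unfold)
    then show ?thesis by (simp add: map_fst_pair_pmf)
  next
    case (Suc j)
    then have "map_pmf (\<lambda>ts. ts ! i) (replicate_pmf (Suc n) e) =
        map_pmf (\<lambda>ts. ts ! j) (map_pmf snd (pair_pmf e (replicate_pmf n e)))"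
      unfolding replicate_pmf_Suc_pair pmf.map_comp by (intro map_pmf_cong refl) (auto simp: case_prod_unfold)
    then show ?thesis using Suc.IH[of j] Suc Suc.prems by (simp add: map_snd_pair_pmf)
  qed
qed simp

lemma iid_component:
  assumes "i < n"
  shows "map_pmf (\<lambda>(xs, ys). (xs ! i, ys ! i)) (iid n p) = p"
proof -
  have "map_pmf (\<lambda>(xs, ys). (xs ! i, ys ! i)) (iid n p) = map_pmf (\<lambda>ts. ts ! i) (replicate_pmf n p)"
    unfolding iid_def pmf.map_comp
    by (intro map_pmf_cong refl) (use assms in \<open>auto simp: set_replicate_pmf\<close>)
  then show ?thesis using replicate_pmf_component[OF assms, of p] by simp
qed

section \<open>The rate bounds the single-letter informations\<close>

text \<open>Gibbs' inequality against the sub-probability \<open>2 ^ (- length m)\<close> times the product of the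
  conditional laws of \<open>xs ! i\<close> given \<open>w i\<close> and \<open>ys ! i\<close>; the arguments of \<open>w i\<close> are chosen such that the
  product is normalised letter by letter.\<close>

lemma expected_length_ge_cmi:
  fixes p :: "('x::finite \<times> 'y::finite) pmf" and L :: "(msg \<times> 'x list \<times> 'y list) pmf"
    and w :: "nat \<Rightarrow> msg \<times> 'x list \<times> 'y list \<Rightarrow> 'w::finite"
  assumes C: "prefix_free C" "fst ` set_pmf L \<subseteq> C" and iid: "map_pmf snd L = iid n p"
    and int: "integrable (measure_pmf L) (\<lambda>(m, xs, ys). real (length m))"
  shows "(\<Sum>i<n. cmi (map_pmf (\<lambda>(m, xs, ys). (w i (m, take i xs, drop (Suc i) ys), xs ! i, ys ! i)) L))
    \<le> measure_pmf.expectation L (\<lambda>(m, xs, ys). real (length m))"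
proof -
  define t where "t i = (\<lambda>(m, xs, ys). (w i (m, take i xs, drop (Suc i) ys), xs ! i :: 'x, ys ! i :: 'y))" for i
  define M where "M i = map_pmf (t i) L" for i
  define MY where "MY i = map_pmf (\<lambda>(u, v, w). w) (M i)" for i
  define MW where "MW i = map_pmf (\<lambda>(u, v, w). (u, w)) (M i)" for i
  define MX where "MX i = map_pmf (\<lambda>(u, v, w). (v, w)) (M i)" for i
  \<comment> \<open>The likelihood ratio whose expected logarithm is the information of a letter.
    Multiplied by the mass of \<open>(x, y)\<close> it becomes the mass of \<open>y\<close> times
    the conditional probability \<open>R\<close> of \<open>x\<close>.\<close>
  define ratio where "ratio i = (\<lambda>(u, x, y). pmf (M i) (u, x, y) * pmf (MY i) y / (pmf (MW i) (u, y) * pmf (MX i) (x, y)))" for i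
  define R where "R i u y x = pmf (M i) (u, x, y) / pmf (MW i) (u, y)" for i u y x
  have set_L: "length xs = n" "length ys = n" "m \<in> C" "(xs, ys) \<in> set_pmf (iid n p)" if "(m, xs, ys) \<in> set_pmf L" for m xs ys
  proof -
    have "(xs, ys) \<in> set_pmf (map_pmf snd L)" using that by force
    then show "(xs, ys) \<in> set_pmf (iid n p)" by (simp only: iid)
    then show "length xs = n" "length ys = n" by (auto simp: set_iid)
    show "m \<in> C" using that C(2) by force
  qed
  have MXp: "MX i = p" if "i < n" for i
  proof -
    have "MX i = map_pmf (\<lambda>(xs, ys). (xs ! i, ys ! i)) (map_pmf snd L)"
      by (simp add: MX_def M_def t_def pmf.map_comp o_def case_prod_unfold)
    then show ?thesis by (simp only: iid iid_component[OF that])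
  qed
  have MYp: "MY i = map_pmf snd p" if "i < n" for i
    using MXp[OF that] by (auto simp: MY_def MX_def pmf.map_comp o_def case_prod_unfold)
  have pos: "0 < pmf (M i) (u, x, y)" "0 < pmf (MY i) y" "0 < pmf (MW i) (u, y)" "0 < pmf (MX i) (x, y)"
    if "\<omega> \<in> set_pmf L" "t i \<omega> = (u, x, y)" for i \<omega> u x y
  proof -
    have "(u, x, y) \<in> set_pmf (M i)" using that by (auto simp: M_def intro!: image_eqI[of _ _ \<omega>])
    then show "0 < pmf (M i) (u, x, y)" "0 < pmf (MY i) y" "0 < pmf (MW i) (u, y)" "0 < pmf (MX i) (x, y)"
      using pmf_map_pos[of "(u, x, y)" "M i" "\<lambda>(u, v, w). w"] pmf_map_pos[of "(u, x, y)" "M i" "\<lambda>(u, v, w). (u, w)"]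
        pmf_map_pos[of "(u, x, y)" "M i" "\<lambda>(u, v, w). (v, w)"]
      by (auto simp: MY_def MW_def MX_def intro: pmf_positive)
  qed
  have int_ln: "integrable (measure_pmf L) (\<lambda>\<omega>. ln (ratio i (t i \<omega>)))" for i
  proof -
    have "integrable (measure_pmf (map_pmf (t i) L)) (\<lambda>v. ln (ratio i v))"
      by (rule integrable_measure_pmf_finite) simp
    then show ?thesis by simp
  qed
  have cmi: "cmi (M i) = measure_pmf.expectation L (\<lambda>\<omega>. ln (ratio i (t i \<omega>))) / ln 2" for i
  proof -
    have "cmi (M i) = measure_pmf.expectation (M i) (\<lambda>v. ln (ratio i v) / ln 2)"
      unfolding cmi_def ratio_def MY_def MW_def MX_def by (simp add: log_def case_prod_unfold)
    also have "\<dots> = measure_pmf.expectation L (\<lambda>\<omega>. ln (ratio i (t i \<omega>)) / ln 2)" by (simp add: M_def)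
    finally show ?thesis by simp
  qed
  \<comment> \<open>On the support, \<open>exp g\<close> is the reference mass divided by the mass
    of \<open>(xs, ys)\<close>. The latter is at least the mass of \<open>(m, xs, ys)\<close>, so
    Gibbs' inequality applies whatever way \<open>m\<close> was generated.\<close>
  define g where "g \<omega> = (\<Sum>i<n. ln (ratio i (t i \<omega>))) - real (length (fst \<omega>)) * ln 2" for \<omega>
  have int': "integrable (measure_pmf L) (\<lambda>\<omega>. real (length (fst \<omega>)) * ln 2)"
    using int by (simp add: case_prod_unfold)
  have int_g: "integrable (measure_pmf L) g"
    unfolding g_def by (intro Bochner_Integration.integrable_diff Bochner_Integration.integrable_sum int_ln int')
  define \<phi> where "\<phi> = (\<lambda>(m, xs, ys). indicator {ys. length ys = n} ys * ((\<Prod>i<n. pmf (map_pmf snd p) (ys ! i)) *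
    (indicator {xs. length xs = n} xs * (\<Prod>i<n. R i (w i (m, take i xs, drop (Suc i) ys)) (ys ! i) (xs ! i)))))"
  have R0: "0 \<le> R i u y x" for i u y x by (simp add: R_def)
  have R1: "(\<Sum>x\<in>UNIV. R i u y x) \<le> 1" for i u y
  proof -
    have "(\<Sum>x\<in>UNIV. pmf (M i) (u, x, y)) = measure_pmf.prob (M i) ((\<lambda>x. (u, x, y)) ` UNIV)"
      by (subst measure_measure_pmf_finite) (auto simp: sum.reindex inj_on_def)
    also have "\<dots> \<le> pmf (MW i) (u, y)"
      unfolding MW_def pmf_map by (intro measure_pmf.finite_measure_mono) auto
    finally show ?thesis by (simp add: R_def sum_divide_distrib[symmetric] divide_le_eq)
  qed
  have pt: "ennreal (pmf L \<omega>) * ennreal (exp (g \<omega>)) \<le>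
      indicator C (fst \<omega>) * ennreal ((1 / 2) ^ length (fst \<omega>)) * ennreal (\<phi> \<omega>)" for \<omega>
  proof (cases "\<omega> \<in> set_pmf L")
    case True
    obtain m xs ys where \<omega>: "\<omega> = (m, xs, ys)" by (metis surj_pair)
    note sL = set_L[OF True[unfolded \<omega>]]
    have rpos: "0 < ratio i (t i \<omega>)" for i
      using pos[OF True, of i] by (cases "t i \<omega>") (auto simp: ratio_def)
    have "exp (g \<omega>) = (\<Prod>i<n. ratio i (t i \<omega>)) * (1 / 2) ^ length m"
    proof -
      have "exp (- (real (length m) * ln 2)) = (1 / 2 :: real) ^ length m"
        by (simp add: exp_minus exp_of_nat_mult power_one_over inverse_eq_divide)
      then show ?thesis
        using rpos unfolding g_def diff_conv_add_uminus exp_add by (simp add: exp_sum \<omega>)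
    qed
    moreover have "pmf L \<omega> \<le> (\<Prod>i<n. pmf p (xs ! i, ys ! i))"
      using pmf_le_pmf_map[of L \<omega> snd] sL by (simp add: iid \<omega> pmf_iid)
    moreover have "0 \<le> (\<Prod>i<n. ratio i (t i \<omega>))" using rpos by (intro prod_nonneg) (simp add: less_imp_le)
    ultimately have "pmf L \<omega> * exp (g \<omega>) \<le> (\<Prod>i<n. pmf p (xs ! i, ys ! i)) * ((\<Prod>i<n. ratio i (t i \<omega>)) * (1 / 2) ^ length m)"
      by (simp add: mult_right_mono)
    also have "\<dots> = (1 / 2) ^ length m * (\<Prod>i<n. pmf p (xs ! i, ys ! i) * ratio i (t i \<omega>))"
      by (simp add: prod.distrib mult_ac)
    also have "(\<Prod>i<n. pmf p (xs ! i, ys ! i) * ratio i (t i \<omega>)) =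
        (\<Prod>i<n. pmf (map_pmf snd p) (ys ! i) * R i (w i (m, take i xs, drop (Suc i) ys)) (ys ! i) (xs ! i))"
    proof (rule prod.cong[OF refl])
      fix i assume "i \<in> {..<n}"
      then have i: "i < n" by simp
      have ti: "t i \<omega> = (w i (m, take i xs, drop (Suc i) ys), xs ! i, ys ! i)" by (simp add: t_def \<omega>)
      show "pmf p (xs ! i, ys ! i) * ratio i (t i \<omega>) =
        pmf (map_pmf snd p) (ys ! i) * R i (w i (m, take i xs, drop (Suc i) ys)) (ys ! i) (xs ! i)"
        using pos(4)[OF True ti] by (simp add: ti ratio_def R_def MXp[OF i] MYp[OF i])
    qed
    also have "\<dots> = \<phi> \<omega>" using sL by (simp add: \<phi>_def \<omega> prod.distrib)
    finally have "pmf L \<omega> * exp (g \<omega>) \<le> (1 / 2) ^ length m * \<phi> \<omega>" .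
    then show ?thesis using sL(3) by (simp add: \<omega> ennreal_mult'[symmetric] ennreal_leI)
  next
    case False
    then have "pmf L \<omega> = 0" by (simp only: set_pmf_iff not_not)
    then show ?thesis by simp
  qed
  \<comment> \<open>For fixed \<open>m\<close> and \<open>ys\<close>, the i-th factor involves
    \<open>xs\<close> only up to its letter \<open>xs ! i\<close>, since \<open>w i\<close> looks at
    the past of \<open>xs\<close> and the future of \<open>ys\<close>.\<close>
  have \<phi>1: "(\<integral>\<^sup>+ v. ennreal (\<phi> (m, v)) \<partial>count_space UNIV) \<le> 1" for m
  proof -
    let ?pr = "\<lambda>ys. \<Prod>i<n. pmf (map_pmf snd p) (ys ! i)"
    let ?in = "\<lambda>ys xs. \<Prod>i<n. R i (w i (m, take i xs, drop (Suc i) ys)) (ys ! i) (xs ! i)"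
    have "(\<integral>\<^sup>+ v. ennreal (\<phi> (m, v)) \<partial>count_space UNIV) = (\<integral>\<^sup>+ ys. \<integral>\<^sup>+ xs. ennreal (\<phi> (m, xs, ys)) \<partial>count_space UNIV \<partial>count_space UNIV)"
      using nn_integral_snd_count_space[of "\<lambda>v. ennreal (\<phi> (m, v))"] by simp
    also have "\<dots> \<le> (\<integral>\<^sup>+ ys. ennreal (indicator {ys. length ys = n} ys * ?pr ys) \<partial>count_space UNIV)"
    proof (rule nn_integral_mono)
      fix ys :: "'y list"
      have "(\<integral>\<^sup>+ xs. ennreal (\<phi> (m, xs, ys)) \<partial>count_space UNIV) =
          (\<integral>\<^sup>+ xs. ennreal (indicator {ys. length ys = n} ys * ?pr ys) * ennreal (indicator {xs. length xs = n} xs * ?in ys xs) \<partial>count_space UNIV)"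
        by (intro nn_integral_cong) (simp add: \<phi>_def ennreal_mult'[symmetric] prod_nonneg R0 mult.assoc)
      also have "\<dots> = ennreal (indicator {ys. length ys = n} ys * ?pr ys) *
          (\<integral>\<^sup>+ xs. ennreal (indicator {xs. length xs = n} xs * ?in ys xs) \<partial>count_space UNIV)"
        by (rule nn_integral_cmult) simp
      also have "\<dots> \<le> ennreal (indicator {ys. length ys = n} ys * ?pr ys) * ennreal 1"
        by (intro mult_left_mono nn_integral_finite_lists_le
          sum_lists_prefix[of "\<lambda>i s x. R i (w i (m, s, drop (Suc i) ys)) (ys ! i) x"] R0 R1)
          (auto intro: prod_nonneg R0)
      finally show "(\<integral>\<^sup>+ xs. ennreal (\<phi> (m, xs, ys)) \<partial>count_space UNIV) \<le> ennreal (indicator {ys. length ys = n} ys * ?pr ys)"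
        by simp
    qed
    also have "\<dots> \<le> ennreal 1"
      by (intro nn_integral_finite_lists_le sum_lists_prefix[of "\<lambda>i s y. pmf (map_pmf snd p) y"])
        (auto intro: prod_nonneg simp: sum_pmf_eq_1)
    finally show ?thesis by simp
  qed
  have "(\<integral>\<^sup>+ \<omega>. ennreal (exp (g \<omega>)) \<partial>measure_pmf L) \<le>
      (\<integral>\<^sup>+ \<omega>. indicator C (fst \<omega>) * ennreal ((1 / 2) ^ length (fst \<omega>)) * ennreal (\<phi> \<omega>) \<partial>count_space UNIV)"
    unfolding nn_integral_measure_pmf_count_space by (intro nn_integral_mono pt)
  also have "\<dots> = (\<integral>\<^sup>+ m. \<integral>\<^sup>+ v. indicator C m * ennreal ((1 / 2) ^ length m) * ennreal (\<phi> (m, v)) \<partial>count_space UNIV \<partial>count_space UNIV)"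
    by (simp add: nn_integral_fst_count_space[symmetric])
  also have "\<dots> = (\<integral>\<^sup>+ m. indicator C m * ennreal ((1 / 2) ^ length m) * (\<integral>\<^sup>+ v. ennreal (\<phi> (m, v)) \<partial>count_space UNIV) \<partial>count_space UNIV)"
    by (intro nn_integral_cong nn_integral_cmult) simp
  also have "\<dots> \<le> (\<integral>\<^sup>+ m. indicator C m * ennreal ((1 / 2) ^ length m) * 1 \<partial>count_space UNIV)"
    by (intro nn_integral_mono mult_left_mono \<phi>1) simp
  also have "\<dots> \<le> 1" using kraft_infinite[OF C(1)] by simp
  finally have "measure_pmf.expectation L g \<le> 0" by (rule gibbs[OF int_g])
  moreover have "measure_pmf.expectation L g = (\<Sum>i<n. measure_pmf.expectation L (\<lambda>\<omega>. ln (ratio i (t i \<omega>)))) -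
      measure_pmf.expectation L (\<lambda>\<omega>. real (length (fst \<omega>))) * ln 2"
    unfolding g_def using int_ln int' by simp
  moreover have "(\<Sum>i<n. cmi (M i)) * ln 2 = (\<Sum>i<n. measure_pmf.expectation L (\<lambda>\<omega>. ln (ratio i (t i \<omega>))))"
    unfolding cmi sum_distrib_right by simp
  ultimately have "(\<Sum>i<n. cmi (M i)) * ln 2 \<le> measure_pmf.expectation L (\<lambda>\<omega>. real (length (fst \<omega>))) * ln 2"
    by linarith
  then have "(\<Sum>i<n. cmi (M i)) \<le> measure_pmf.expectation L (\<lambda>\<omega>. real (length (fst \<omega>)))" by simp
  then show ?thesis by (simp add: M_def t_def case_prod_unfold)
qed

section \<open>The leakage bounds the deviation from the channel\<close>

lemma exp_le_quadratic:
  fixes x :: real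
  assumes "\<bar>x\<bar> \<le> 1"
  shows "exp x \<le> 1 + x + x\<^sup>2"
proof (cases "0 \<le> x")
  case True
  then show ?thesis using assms by (intro exp_bound) auto
next
  case False
  have "1 \<le> 1 - x ^ 3" using False by (simp add: power_le_zero_eq)
  also have "\<dots> = (1 - x) * (1 + x + x\<^sup>2)" by (simp add: algebra_simps power2_eq_square power3_eq_cube)
  finally have "1 / (1 - x) \<le> 1 + x + x\<^sup>2" using False by (simp add: divide_le_eq mult.commute)
  moreover have "1 - x \<le> exp (- x)" using exp_ge_add_one_self[of "- x"] by simp
  then have "exp x \<le> 1 / (1 - x)" using False by (simp add: exp_minus field_simps)
  ultimately show ?thesis by linarith
qed

lemma normalised_exponential_tilt:
  fixes c G :: "'v::finite \<Rightarrow> real"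
  assumes c: "\<And>a. 0 \<le> c a" "(\<Sum>a\<in>UNIV. c a) \<le> 1" and G: "\<And>a. \<bar>G a\<bar> \<le> 1" and \<tau>: "0 \<le> \<tau>" "\<tau> \<le> 1"
  shows "(\<Sum>a\<in>UNIV. c a * exp (\<tau> * G a - \<tau> * (\<Sum>a\<in>UNIV. c a * G a) - \<tau>\<^sup>2)) \<le> 1"
proof -
  let ?m = "\<tau> * (\<Sum>a\<in>UNIV. c a * G a) + \<tau>\<^sup>2"
  have "(\<Sum>a\<in>UNIV. c a * exp (\<tau> * G a - \<tau> * (\<Sum>a\<in>UNIV. c a * G a) - \<tau>\<^sup>2)) = (\<Sum>a\<in>UNIV. c a * exp (\<tau> * G a)) * exp (- ?m)"
    unfolding sum_distrib_right
  proof (intro sum.cong refl)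
    fix a
    have "\<tau> * G a - \<tau> * (\<Sum>a\<in>UNIV. c a * G a) - \<tau>\<^sup>2 = \<tau> * G a + - ?m" by simp
    then show "c a * exp (\<tau> * G a - \<tau> * (\<Sum>a\<in>UNIV. c a * G a) - \<tau>\<^sup>2) = c a * exp (\<tau> * G a) * exp (- ?m)"
      by (simp only: exp_add mult.assoc)
  qed
  also have "\<dots> \<le> (1 + ?m) * exp (- ?m)"
  proof (rule mult_right_mono)
    have "(\<Sum>a\<in>UNIV. c a * exp (\<tau> * G a)) \<le> (\<Sum>a\<in>UNIV. c a * (1 + \<tau> * G a + \<tau>\<^sup>2))"
    proof (intro sum_mono mult_left_mono c)
      fix a
      have "\<bar>\<tau> * G a\<bar> \<le> 1 * 1" unfolding abs_mult using \<tau> G by (intro mult_mono) auto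
      then have "exp (\<tau> * G a) \<le> 1 + \<tau> * G a + (\<tau> * G a)\<^sup>2" by (intro exp_le_quadratic) simp
      also have "(\<tau> * G a)\<^sup>2 \<le> \<tau>\<^sup>2"
        unfolding power_mult_distrib using G[of a] by (intro mult_left_le) (auto simp: abs_square_le_1)
      finally show "exp (\<tau> * G a) \<le> 1 + \<tau> * G a + \<tau>\<^sup>2" by simp
    qed
    also have "\<dots> = (\<Sum>a\<in>UNIV. c a) * (1 + \<tau>\<^sup>2) + \<tau> * (\<Sum>a\<in>UNIV. c a * G a)"
      by (simp add: distrib_left sum.distrib sum_distrib_left sum_distrib_right mult.left_commute)
    also have "\<dots> \<le> 1 * (1 + \<tau>\<^sup>2) + \<tau> * (\<Sum>a\<in>UNIV. c a * G a)"
      using c by (intro add_right_mono mult_right_mono) auto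
    finally show "(\<Sum>a\<in>UNIV. c a * exp (\<tau> * G a)) \<le> 1 + ?m" by simp
  qed simp
  also have "\<dots> \<le> exp ?m * exp (- ?m)"
    by (intro mult_right_mono exp_ge_add_one_self) simp
  also have "\<dots> = 1" by (rule exp_minus_inverse)
  finally show ?thesis .
qed

section \<open>Conditional laws given the later letters\<close>

definition suffix_law :: "(('m \<times> 'k) \<times> 'v list) pmf \<Rightarrow> nat \<Rightarrow> ('k \<times> 'v list) pmf" where
  "suffix_law L i = map_pmf (\<lambda>((m, k), vs). (k, drop i vs)) L"

text \<open>The conditional law of the letter at position \<open>i\<close> given \<open>k\<close>
  and the later letters \<open>s\<close>. It vanishes where the condition has probability zero, so
  in general it is a sub-probability.\<close>

definition suffix_cond :: "(('m \<times> 'k) \<times> 'v list) pmf \<Rightarrow> nat \<Rightarrow> 'k \<Rightarrow> 'v list \<Rightarrow> 'v \<Rightarrow> real" where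
  "suffix_cond L i k s a = pmf (suffix_law L i) (k, a # s) / pmf (suffix_law L (Suc i)) (k, s)"

lemma suffix_law_Suc: "suffix_law L (Suc i) = map_pmf (\<lambda>(k, s). (k, tl s)) (suffix_law L i)"
  by (simp add: suffix_law_def pmf.map_comp o_def case_prod_unfold drop_Suc tl_drop)

text \<open>Only an inequality, since \<open>tl\<close> fixes the empty list: an empty suffix may
  stem from an empty one.\<close>

lemma sum_suffix_law_le:
  fixes L :: "(('m \<times> 'k) \<times> 'v::finite list) pmf"
  shows "(\<Sum>a\<in>UNIV. pmf (suffix_law L i) (k, a # s)) \<le> pmf (suffix_law L (Suc i)) (k, s)"
proof -
  have "(\<Sum>a\<in>UNIV. pmf (suffix_law L i) (k, a # s)) = measure_pmf.prob (suffix_law L i) ((\<lambda>a. (k, a # s)) ` UNIV)"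
    by (subst measure_measure_pmf_finite) (auto simp: sum.reindex inj_on_def)
  also have "\<dots> \<le> pmf (suffix_law L (Suc i)) (k, s)"
    unfolding suffix_law_Suc pmf_map by (intro measure_pmf.finite_measure_mono) auto
  finally show ?thesis .
qed

lemma suffix_cond_nonneg: "0 \<le> suffix_cond L i k s a"
  by (simp add: suffix_cond_def)

lemma sum_suffix_cond_le:
  fixes L :: "(('m \<times> 'k) \<times> 'v::finite list) pmf"
  shows "(\<Sum>a\<in>UNIV. suffix_cond L i k s a) \<le> 1"
  using sum_suffix_law_le[of L i k s] pmf_nonneg[of "suffix_law L (Suc i)" "(k, s)"]
  by (cases "pmf (suffix_law L (Suc i)) (k, s) = 0")
    (auto simp: suffix_cond_def sum_divide_distrib[symmetric] divide_le_eq)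

text \<open>Gibbs' inequality (in the Donsker--Varadhan form): the reference law is tilted letter by letter,
  from the last letter of \<open>vs\<close> to the first.\<close>

lemma leakage_ge_deviation:
  fixes L :: "(('m::countable \<times> 'k::countable) \<times> 'v::finite list) pmf"
    and G :: "nat \<Rightarrow> 'm \<times> 'k \<Rightarrow> 'v list \<Rightarrow> 'v \<Rightarrow> real"
  assumes len: "\<And>mk vs. (mk, vs) \<in> set_pmf L \<Longrightarrow> length vs = n"
    and fin: "finite ((\<lambda>((m, k), vs). (vs, k)) ` set_pmf L)"
    and G: "\<And>i mk s a. \<bar>G i mk s a\<bar> \<le> 1" and \<tau>: "0 \<le> \<tau>" "\<tau> \<le> 1"
  shows "\<tau> * (\<Sum>i<n. measure_pmf.expectation L (\<lambda>(mk, vs). G i mk (drop (Suc i) vs) (vs ! i) -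
      (\<Sum>a\<in>UNIV. suffix_cond L i (snd mk) (drop (Suc i) vs) a * G i mk (drop (Suc i) vs) a)))
    \<le> ln 2 * cmi (map_pmf (\<lambda>((m, k), vs). (m, vs, k)) L) + real n * \<tau>\<^sup>2"
proof -
  let ?Q = "suffix_cond L"
  define M where "M = map_pmf (\<lambda>((m, k), vs). (m, vs, k)) L"
  define MK where "MK = map_pmf fst L"
  define ratio where "ratio = (\<lambda>(m, vs, k). pmf M (m, vs, k) * pmf (map_pmf (\<lambda>(u, v, w). w) M) k /
    (pmf (map_pmf (\<lambda>(u, v, w). (u, w)) M) (m, k) * pmf (map_pmf (\<lambda>(u, v, w). (v, w)) M) (vs, k)))"
  define d where "d i = (\<lambda>(mk, vs). G i mk (drop (Suc i) vs) (vs ! i) -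
      (\<Sum>a\<in>UNIV. ?Q i (snd mk) (drop (Suc i) vs) a * G i mk (drop (Suc i) vs) a))" for i
  \<comment> \<open>The exponential of \<open>g\<close> is the density with respect to
    \<open>L\<close> of the measure that keeps \<open>(m, k)\<close>, draws \<open>vs\<close> given
    \<open>k\<close> alone and is then tilted. The expected logarithm of \<open>ratio\<close> is, up
    to \<open>ln 2\<close>, the information leaked by \<open>m\<close>.\<close>
  define g where "g = (\<lambda>((m, k), vs). (\<Sum>i<n. \<tau> * d i ((m, k), vs) - \<tau>\<^sup>2) - ln (ratio (m, vs, k)))"
  \<comment> \<open>The tilted conditional law of a letter; its exponent is \<tau> times the
    deviation \<open>d i\<close>, less \<tau>^2 for the normalisation.\<close>
  define F where "F mk i s a = ?Q i (snd mk) s a * exp (\<tau> * G i mk s a - \<tau> * (\<Sum>a\<in>UNIV. ?Q i (snd mk) s a * G i mk s a) - \<tau>\<^sup>2)"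
    for mk i s a
  have F0: "0 \<le> F mk i s a" for mk i s a by (simp add: F_def suffix_cond_nonneg)
  have F1: "(\<Sum>a\<in>UNIV. F mk i s a) \<le> 1" for mk i s
    unfolding F_def by (rule normalised_exponential_tilt) (rule suffix_cond_nonneg sum_suffix_cond_le G \<tau>)+
  have "finite (snd ` set_pmf M)"
  proof -
    have "snd ` set_pmf M = (\<lambda>((m, k), vs). (vs, k)) ` set_pmf L"
      unfolding M_def set_map_pmf image_image by (intro image_cong refl) (simp only: case_prod_unfold snd_conv fst_conv)
    then show ?thesis using fin by simp
  qed
  note cmi = conditional_mutual_information_pmf(3)[OF this]
  have int_r: "integrable (measure_pmf L) (\<lambda>((m, k), vs). ln (ratio (m, vs, k)))"
  proof -
    have "integrable (measure_pmf M) (\<lambda>t. ln 2 * log 2 (ratio t))"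
      using cmi by (intro integrable_mult_right) (simp add: ratio_def case_prod_unfold)
    then show ?thesis unfolding M_def by (simp add: log_def case_prod_unfold)
  qed
  have cmi_eq: "ln 2 * cmi M = measure_pmf.expectation L (\<lambda>((m, k), vs). ln (ratio (m, vs, k)))"
  proof -
    have "cmi M = measure_pmf.expectation M (\<lambda>t. log 2 (ratio t))"
      unfolding cmi_def ratio_def by (simp add: case_prod_unfold)
    also have "ln 2 * \<dots> = measure_pmf.expectation M (\<lambda>t. ln (ratio t))"
      by (subst integral_mult_right_zero[symmetric]) (simp add: log_def)
    finally show ?thesis unfolding M_def by (simp add: case_prod_unfold)
  qed
  have d2: "\<bar>d i \<omega>\<bar> \<le> 2" for i \<omega>
  proof -
    obtain mk vs where \<omega>: "\<omega> = (mk, vs)" by (cases \<omega>)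
    let ?s = "drop (Suc i) vs"
    have "\<bar>\<Sum>a\<in>UNIV. ?Q i (snd mk) ?s a * G i mk ?s a\<bar> \<le> (\<Sum>a\<in>UNIV. ?Q i (snd mk) ?s a)"
      by (rule order.trans[OF sum_abs sum_mono])
        (use G in \<open>simp add: abs_mult abs_of_nonneg[OF suffix_cond_nonneg] mult_left_le suffix_cond_nonneg\<close>)
    also have "\<dots> \<le> 1" by (rule sum_suffix_cond_le)
    finally show ?thesis using G[of i mk ?s "vs ! i"] unfolding d_def \<omega> prod.case by linarith
  qed
  have int_d: "integrable (measure_pmf L) (d i)" for i
    by (rule measure_pmf.integrable_const_bound[where B = 2]) (use d2 in auto)
  have g_eq: "g = (\<lambda>\<omega>. (\<Sum>i<n. \<tau> * d i \<omega> - \<tau>\<^sup>2) - (\<lambda>((m, k), vs). ln (ratio (m, vs, k))) \<omega>)"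
    by (auto simp: g_def fun_eq_iff)
  have int_g: "integrable (measure_pmf L) g"
    unfolding g_eq by (intro Bochner_Integration.integrable_diff Bochner_Integration.integrable_sum
      integrable_mult_right int_d int_r) simp
  define \<phi> where "\<phi> = (\<lambda>(mk, vs). indicator {vs. length vs = n} vs * (\<Prod>i<n. F mk i (drop (Suc i) vs) (vs ! i)))"
  have pt: "ennreal (pmf L \<omega>) * ennreal (exp (g \<omega>)) \<le> ennreal (pmf MK (fst \<omega>)) * ennreal (\<phi> \<omega>)" for \<omega>
  proof (cases "\<omega> \<in> set_pmf L")
    case True
    obtain m k vs where \<omega>: "\<omega> = ((m, k), vs)" by (metis surj_pair)
    have lenv: "length vs = n" using len True by (simp add: \<omega>)
    let ?A = "\<lambda>i. pmf (suffix_law L i) (k, drop i vs)"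
    have Apos: "0 < ?A i" for i
      using pmf_map_pos[OF True, of "\<lambda>((m, k), vs). (k, drop i vs)"] by (simp add: \<omega> suffix_law_def)
    have q: "?Q i k (drop (Suc i) vs) (vs ! i) = ?A i / ?A (Suc i)" if "i < n" for i
      using that lenv by (simp add: suffix_cond_def Cons_nth_drop_Suc)
    \<comment> \<open>The masses of the suffixes telescope; as the suffix at \<open>n\<close> is
      empty, the product of the conditional laws is the law of \<open>vs\<close> given
      \<open>k\<close>.\<close>
    have tele: "(\<Prod>i<n. ?Q i k (drop (Suc i) vs) (vs ! i)) = ?A 0 / ?A n"
    proof -
      have "(\<Prod>i<j. ?A i / ?A (Suc i)) = ?A 0 / ?A j" for j
      proof (induction j)
        case 0
        show ?case using Apos[of 0] by simp
      next
        case (Suc j)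
        have "(\<Prod>i<Suc j. ?A i / ?A (Suc i)) = (?A 0 / ?A j) * (?A j / ?A (Suc j))"
          unfolding prod.lessThan_Suc Suc.IH ..
        also have "\<dots> = ?A 0 / ?A (Suc j)" using Apos[of j] by simp
        finally show ?case .
      qed
      moreover have "(\<Prod>i<n. ?Q i k (drop (Suc i) vs) (vs ! i)) = (\<Prod>i<n. ?A i / ?A (Suc i))"
        using q by (intro prod.cong) auto
      ultimately show ?thesis by simp
    qed
    have M1: "pmf M (m, vs, k) = pmf L \<omega>"
    proof -
      have "inj (\<lambda>((m, k), vs). (m, vs, k))" by (auto simp: inj_on_def)
      from pmf_map_inj'[OF this, of L \<omega>] show ?thesis by (simp add: M_def \<omega>)
    qed
    have M2: "pmf (map_pmf (\<lambda>(u, v, w). w) M) k = ?A n"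
    proof -
      have "?A n = measure_pmf.prob L ((\<lambda>((m, k), vs). (k, drop n vs)) -` {(k, [])})"
        using lenv by (simp add: suffix_law_def pmf_map)
      also have "\<dots> = measure_pmf.prob L ((\<lambda>((m, k), vs). k) -` {k})"
        by (rule prob_cong_set_pmf) (auto dest: len)
      also have "\<dots> = pmf (map_pmf (\<lambda>(u, v, w). w) M) k"
        unfolding M_def pmf.map_comp pmf_map by (intro arg_cong[where f="measure _"]) auto
      finally show ?thesis by simp
    qed
    have M3: "pmf (map_pmf (\<lambda>(u, v, w). (u, w)) M) (m, k) = pmf MK (m, k)"
      unfolding M_def MK_def pmf.map_comp pmf_map by (intro arg_cong[where f="measure _"]) auto
    have M4: "pmf (map_pmf (\<lambda>(u, v, w). (v, w)) M) (vs, k) = ?A 0"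
      unfolding M_def suffix_law_def pmf.map_comp pmf_map by (intro arg_cong[where f="measure _"]) auto
    have Lpos: "0 < pmf L \<omega>" using True by (rule pmf_positive)
    have MKpos: "0 < pmf MK (m, k)" using pmf_map_pos[OF True, of fst] by (simp add: MK_def \<omega>)
    have r: "ratio (m, vs, k) = pmf L \<omega> * ?A n / (pmf MK (m, k) * ?A 0)"
      unfolding ratio_def prod.case M1 M2 M3 M4 ..
    have rpos: "0 < ratio (m, vs, k)" unfolding r using Lpos MKpos Apos[of 0] Apos[of n] by (intro divide_pos_pos mult_pos_pos)
    have "exp (g \<omega>) = (\<Prod>i<n. exp (\<tau> * d i \<omega> - \<tau>\<^sup>2)) / ratio (m, vs, k)"
      using rpos by (simp add: g_def \<omega> exp_diff[of "sum _ _"] exp_sum)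
    moreover have "l * (P / (l * b / (c * a))) = c * ((a / b) * P)"
      if "0 < l" "0 < a" "0 < b" "0 < c" for l a b c P :: real
      using that by (simp add: field_simps)
    ultimately have "pmf L \<omega> * exp (g \<omega>) = pmf MK (m, k) * ((?A 0 / ?A n) * (\<Prod>i<n. exp (\<tau> * d i \<omega> - \<tau>\<^sup>2)))"
      unfolding r using Lpos MKpos Apos[of 0] Apos[of n] by presburger
    also have "(?A 0 / ?A n) * (\<Prod>i<n. exp (\<tau> * d i \<omega> - \<tau>\<^sup>2)) = \<phi> \<omega>"
      unfolding tele[symmetric] prod.distrib[symmetric] \<phi>_def \<omega> prod.case using lenv
      by (simp add: F_def d_def right_diff_distrib)
    finally show ?thesis by (simp add: \<omega> ennreal_mult'[symmetric])
  next
    case False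
    then have "pmf L \<omega> = 0" by (simp only: set_pmf_iff not_not)
    then show ?thesis by simp
  qed
  have \<phi>1: "(\<integral>\<^sup>+ vs. ennreal (\<phi> (mk, vs)) \<partial>count_space UNIV) \<le> 1" for mk
  proof -
    have "(\<integral>\<^sup>+ vs. ennreal (\<phi> (mk, vs)) \<partial>count_space UNIV) \<le> ennreal 1"
      unfolding \<phi>_def prod.case
      by (intro nn_integral_finite_lists_le sum_lists_suffix[of "F mk"] F0 F1 prod_nonneg)
    then show ?thesis by simp
  qed
  have "(\<integral>\<^sup>+ \<omega>. ennreal (exp (g \<omega>)) \<partial>measure_pmf L) \<le>
      (\<integral>\<^sup>+ \<omega>. ennreal (pmf MK (fst \<omega>)) * ennreal (\<phi> \<omega>) \<partial>count_space UNIV)"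
    unfolding nn_integral_measure_pmf_count_space by (intro nn_integral_mono pt)
  also have "\<dots> = (\<integral>\<^sup>+ mk. \<integral>\<^sup>+ vs. ennreal (pmf MK mk) * ennreal (\<phi> (mk, vs)) \<partial>count_space UNIV \<partial>count_space UNIV)"
    by (simp add: nn_integral_fst_count_space[symmetric])
  also have "\<dots> = (\<integral>\<^sup>+ mk. ennreal (pmf MK mk) * (\<integral>\<^sup>+ vs. ennreal (\<phi> (mk, vs)) \<partial>count_space UNIV) \<partial>count_space UNIV)"
    by (intro nn_integral_cong nn_integral_cmult) simp
  also have "\<dots> \<le> (\<integral>\<^sup>+ mk. ennreal (pmf MK mk) * 1 \<partial>count_space UNIV)"
    by (intro nn_integral_mono mult_left_mono \<phi>1) simp
  also have "\<dots> = 1" by (simp add: nn_integral_pmf_eq_1)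
  finally have "measure_pmf.expectation L g \<le> 0" by (rule gibbs[OF int_g])
  moreover have "measure_pmf.expectation L g = (\<Sum>i<n. \<tau> * measure_pmf.expectation L (d i) - \<tau>\<^sup>2) - ln 2 * cmi M"
  proof -
    have int_t: "integrable (measure_pmf L) (\<lambda>\<omega>. \<tau> * d i \<omega> - \<tau>\<^sup>2)" for i
      by (intro Bochner_Integration.integrable_diff integrable_mult_right int_d measure_pmf.integrable_const)
    have "measure_pmf.expectation L g = measure_pmf.expectation L (\<lambda>\<omega>. \<Sum>i<n. \<tau> * d i \<omega> - \<tau>\<^sup>2) - ln 2 * cmi M"
      unfolding g_eq cmi_eq
      by (rule Bochner_Integration.integral_diff[OF Bochner_Integration.integrable_sum[OF int_t] int_r])
    moreover have "measure_pmf.expectation L (\<lambda>\<omega>. \<Sum>i<n. \<tau> * d i \<omega> - \<tau>\<^sup>2) =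
        (\<Sum>i<n. measure_pmf.expectation L (\<lambda>\<omega>. \<tau> * d i \<omega> - \<tau>\<^sup>2))"
      by (rule Bochner_Integration.integral_sum[OF int_t])
    moreover have "measure_pmf.expectation L (\<lambda>\<omega>. \<tau> * d i \<omega> - \<tau>\<^sup>2) = \<tau> * measure_pmf.expectation L (d i) - \<tau>\<^sup>2" for i
      using Bochner_Integration.integral_diff[OF integrable_mult_right[OF int_d] measure_pmf.integrable_const, of \<tau> i "\<tau>\<^sup>2"]
      by simp
    ultimately show ?thesis by simp
  qed
  ultimately have "\<tau> * (\<Sum>i<n. measure_pmf.expectation L (d i)) \<le> ln 2 * cmi M + real n * \<tau>\<^sup>2"
    by (simp add: sum_subtractf sum_distrib_left)
  then show ?thesis by (simp add: M_def d_def)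
qed

text \<open>The product law \<open>\<Prod>i. e (xs ! i) (vs ! i)\<close> with the first \<open>i\<close> letters of \<open>vs\<close> summed out, for
  \<open>r x = (\<Sum>a. e x a)\<close>.\<close>

definition suffix_product :: "('x \<Rightarrow> real) \<Rightarrow> ('x \<Rightarrow> 'v \<Rightarrow> real) \<Rightarrow> nat \<Rightarrow> 'x list \<Rightarrow> 'v list \<Rightarrow> real" where
  "suffix_product r e i xs s = (\<Prod>j<i. r (xs ! j)) * (\<Prod>j<length s. e (xs ! (i + j)) (s ! j))"

lemma suffix_product_Cons:
  "suffix_product r e i xs (a # s) =
    (\<Prod>j<i. r (xs ! j)) * e (xs ! i) a * (\<Prod>j<length s. e (xs ! (Suc i + j)) (s ! j))"
  unfolding suffix_product_def length_Cons prod.lessThan_Suc_shift by (simp add: mult.assoc)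

lemma suffix_product_Suc:
  "suffix_product r e (Suc i) xs s =
    (\<Prod>j<i. r (xs ! j)) * r (xs ! i) * (\<Prod>j<length s. e (xs ! (Suc i + j)) (s ! j))"
  by (simp add: suffix_product_def)

lemma sum_suffix_product:
  fixes e :: "'x \<Rightarrow> 'v::finite \<Rightarrow> real"
  assumes "\<And>x. r x = (\<Sum>a\<in>UNIV. e x a)"
  shows "(\<Sum>a\<in>UNIV. suffix_product r e i xs (a # s)) = suffix_product r e (Suc i) xs s"
  unfolding suffix_product_Cons suffix_product_Suc
  by (simp only: sum_distrib_left[symmetric] sum_distrib_right[symmetric] assms[symmetric])

context
  fixes L :: "(('m \<times> 'x::finite list) \<times> 'v::finite list) pmf" and n :: nat
    and r :: "'x \<Rightarrow> real" and e c :: "'x \<Rightarrow> 'v \<Rightarrow> real"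
  assumes len: "\<And>m xs vs. ((m, xs), vs) \<in> set_pmf L \<Longrightarrow> length xs = n \<and> length vs = n"
    and r: "\<And>x. r x = (\<Sum>a\<in>UNIV. e x a)" and e: "\<And>x a. e x a = r x * c x a"
    and c: "\<And>x a. 0 \<le> c x a" "\<And>x. (\<Sum>a\<in>UNIV. c x a) \<le> 1"
begin

text \<open>The \<open>L1\<close> distance between the law of \<open>xs\<close> with a suffix of
  \<open>vs\<close> and its product counterpart; at \<open>i = 0\<close> it is the error of the
  whole sequence.\<close>

definition "suffix_error i =
  (\<Sum>xs | length xs = n. \<Sum>s | length s = n - i. \<bar>pmf (suffix_law L i) (xs, s) - suffix_product r e i xs s\<bar>)"

lemma length_suffix_law: "(xs, s) \<in> set_pmf (suffix_law L i) \<Longrightarrow> length xs = n \<and> length s = n - i"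
  unfolding suffix_law_def set_map_pmf using len by fastforce

lemma sum_suffix_law_eq:
  assumes "i < n"
  shows "(\<Sum>a\<in>UNIV. pmf (suffix_law L i) (xs, a # s)) = pmf (suffix_law L (Suc i)) (xs, s)"
proof -
  have "pmf (suffix_law L (Suc i)) (xs, s) = measure_pmf.prob (suffix_law L i) ((\<lambda>(k, s). (k, tl s)) -` {(xs, s)})"
    by (simp add: suffix_law_Suc pmf_map)
  also have "\<dots> = measure_pmf.prob (suffix_law L i) ((\<lambda>a. (xs, a # s)) ` UNIV)"
  proof (rule prob_cong_set_pmf)
    fix t assume t: "t \<in> set_pmf (suffix_law L i)"
    obtain k u where [simp]: "t = (k, u)" by (cases t)
    have "length u = n - i" using length_suffix_law t by auto
    then have "u \<noteq> []" using assms by auto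
    then show "t \<in> (\<lambda>(k, s). (k, tl s)) -` {(xs, s)} \<longleftrightarrow> t \<in> (\<lambda>a. (xs, a # s)) ` UNIV"
      by (cases u) auto
  qed
  also have "\<dots> = (\<Sum>a\<in>UNIV. pmf (suffix_law L i) (xs, a # s))"
    by (subst measure_measure_pmf_finite) (auto simp: sum.reindex inj_on_def)
  finally show ?thesis by simp
qed

text \<open>Summing out a letter does not increase an \<open>L1\<close> distance.\<close>

lemma suffix_error_Suc:
  assumes "i < n"
  shows "suffix_error (Suc i) \<le> suffix_error i"
proof -
  have ni: "n - i = Suc (n - Suc i)" using assms by simp
  have "suffix_error (Suc i) \<le> (\<Sum>xs | length xs = n. \<Sum>s | length s = n - Suc i.
      \<Sum>a\<in>UNIV. \<bar>pmf (suffix_law L i) (xs, a # s) - suffix_product r e i xs (a # s)\<bar>)"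
    unfolding suffix_error_def sum_suffix_law_eq[OF assms, symmetric] sum_suffix_product[OF r, symmetric]
      sum_subtractf[symmetric]
    by (intro sum_mono sum_abs)
  also have "\<dots> = suffix_error i"
    unfolding suffix_error_def ni sum_lists_Suc ..
  finally show ?thesis .
qed

lemma suffix_error_le: "i \<le> n \<Longrightarrow> suffix_error i \<le> suffix_error 0"
proof (induction i)
  case (Suc i)
  then show ?case using suffix_error_Suc[of i] by simp
qed simp

text \<open>Multiplied by the mass of the shorter suffix, the conditional law gives the mass of the
  longer one; multiplying by \<open>c\<close> does the same for the product law. The deviation is
  therefore at most the sum of two suffix errors.\<close>

lemma suffix_cond_deviation:
  assumes i: "i < n"
  shows "measure_pmf.expectation L (\<lambda>((m, xs), vs). \<Sum>a\<in>UNIV. \<bar>suffix_cond L i xs (drop (Suc i) vs) a - c (xs ! i) a\<bar>)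
    \<le> 2 * suffix_error 0"
proof -
  let ?A = "\<lambda>i xs s. pmf (suffix_law L i) (xs, s)"
  let ?\<Phi> = "suffix_product r e"
  let ?h = "\<lambda>(xs, s). \<Sum>a\<in>UNIV. \<bar>suffix_cond L i xs s a - c (xs ! i) a\<bar>"
  have ni: "n - i = Suc (n - Suc i)" using i by simp
  have "measure_pmf.expectation L (\<lambda>((m, xs), vs). \<Sum>a\<in>UNIV. \<bar>suffix_cond L i xs (drop (Suc i) vs) a - c (xs ! i) a\<bar>) =
      measure_pmf.expectation (suffix_law L (Suc i)) ?h"
    unfolding suffix_law_def integral_map_pmf by (simp add: case_prod_unfold)
  also have "\<dots> = (\<Sum>t\<in>{xs. length xs = n} \<times> {s. length s = n - Suc i}. pmf (suffix_law L (Suc i)) t * ?h t)"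
    by (subst integral_measure_pmf_real[where A = "{xs. length xs = n} \<times> {s. length s = n - Suc i}"])
      (auto simp: finite_lists_length mult.commute dest: length_suffix_law)
  also have "\<dots> = (\<Sum>xs | length xs = n. \<Sum>s | length s = n - Suc i. ?A (Suc i) xs s * ?h (xs, s))"
    by (subst sum.cartesian_product) (simp only: case_prod_unfold prod.collapse)
  also have "\<dots> \<le> (\<Sum>xs | length xs = n. \<Sum>s | length s = n - Suc i.
      (\<Sum>a\<in>UNIV. \<bar>?A i xs (a # s) - ?\<Phi> i xs (a # s)\<bar>) + \<bar>?A (Suc i) xs s - ?\<Phi> (Suc i) xs s\<bar>)"
  proof (intro sum_mono)
    fix xs :: "'x list" and s :: "'v list"
    have "?A (Suc i) xs s * \<bar>suffix_cond L i xs s a - c (xs ! i) a\<bar> \<le>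
        \<bar>?A i xs (a # s) - ?\<Phi> i xs (a # s)\<bar> + \<bar>?A (Suc i) xs s - ?\<Phi> (Suc i) xs s\<bar> * c (xs ! i) a" for a
    proof -
      have "?A i xs (a # s) \<le> (\<Sum>a\<in>UNIV. ?A i xs (a # s))"
        by (rule member_le_sum) auto
      then have le: "?A i xs (a # s) \<le> ?A (Suc i) xs s" using sum_suffix_law_eq[OF i] by simp
      have "?A (Suc i) xs s * suffix_cond L i xs s a = ?A i xs (a # s)"
        using le pmf_nonneg[of "suffix_law L i" "(xs, a # s)"] by (auto simp: suffix_cond_def)
      then have "?A (Suc i) xs s * \<bar>suffix_cond L i xs s a - c (xs ! i) a\<bar> = \<bar>?A i xs (a # s) - ?A (Suc i) xs s * c (xs ! i) a\<bar>"
        by (subst abs_of_nonneg[of "?A (Suc i) xs s", symmetric]) (simp_all only: abs_mult[symmetric] right_diff_distrib pmf_nonneg)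
      also have "\<dots> \<le> \<bar>?A i xs (a # s) - ?\<Phi> i xs (a # s)\<bar> + \<bar>(?A (Suc i) xs s - ?\<Phi> (Suc i) xs s) * c (xs ! i) a\<bar>"
      proof -
        have "?\<Phi> i xs (a # s) = ?\<Phi> (Suc i) xs s * c (xs ! i) a"
          unfolding suffix_product_Cons suffix_product_Suc e[of "xs ! i"] by (simp only: mult_ac)
        then show ?thesis unfolding left_diff_distrib by linarith
      qed
      also have "\<bar>(?A (Suc i) xs s - ?\<Phi> (Suc i) xs s) * c (xs ! i) a\<bar> = \<bar>?A (Suc i) xs s - ?\<Phi> (Suc i) xs s\<bar> * c (xs ! i) a"
        by (simp only: abs_mult abs_of_nonneg[OF c(1)])
      finally show ?thesis .
    qed
    then have "?A (Suc i) xs s * ?h (xs, s) \<le> (\<Sum>a\<in>UNIV. \<bar>?A i xs (a # s) - ?\<Phi> i xs (a # s)\<bar> +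
        \<bar>?A (Suc i) xs s - ?\<Phi> (Suc i) xs s\<bar> * c (xs ! i) a)"
      unfolding prod.case sum_distrib_left by (rule sum_mono)
    also have "\<dots> = (\<Sum>a\<in>UNIV. \<bar>?A i xs (a # s) - ?\<Phi> i xs (a # s)\<bar>) +
        \<bar>?A (Suc i) xs s - ?\<Phi> (Suc i) xs s\<bar> * (\<Sum>a\<in>UNIV. c (xs ! i) a)"
      by (simp only: sum.distrib sum_distrib_left)
    also have "\<dots> \<le> (\<Sum>a\<in>UNIV. \<bar>?A i xs (a # s) - ?\<Phi> i xs (a # s)\<bar>) + \<bar>?A (Suc i) xs s - ?\<Phi> (Suc i) xs s\<bar> * 1"
      by (intro add_left_mono mult_left_mono c) simp
    finally show "?A (Suc i) xs s * ?h (xs, s) \<le>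
      (\<Sum>a\<in>UNIV. \<bar>?A i xs (a # s) - ?\<Phi> i xs (a # s)\<bar>) + \<bar>?A (Suc i) xs s - ?\<Phi> (Suc i) xs s\<bar>" by simp
  qed
  also have "\<dots> = suffix_error i + suffix_error (Suc i)"
    unfolding suffix_error_def ni sum_lists_Suc sum.distrib ..
  also have "\<dots> \<le> 2 * suffix_error 0"
    using suffix_error_le[of i] suffix_error_le[of "Suc i"] i by simp
  finally show ?thesis .
qed

end

text \<open>Replaces the true conditional laws in \<open>leakage_ge_deviation\<close> by the
  channel. As \<open>G\<close> is bounded by one, each letter costs at most the \<open>L1\<close>
  deviation of the two laws, which is on average at most \<open>2 * \<epsilon>\<close>.\<close>

lemma leakage_ge_channel_deviation:
  fixes L :: "(('m::countable \<times> 'x::finite list) \<times> 'v::finite list) pmf"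
    and G :: "nat \<Rightarrow> 'm \<times> 'x list \<Rightarrow> 'v list \<Rightarrow> 'v \<Rightarrow> real"
  assumes len: "\<And>m xs vs. ((m, xs), vs) \<in> set_pmf L \<Longrightarrow> length xs = n \<and> length vs = n"
    and r: "\<And>x. r x = (\<Sum>a\<in>UNIV. e x a)" and e: "\<And>x a. e x a = r x * c x a"
    and c: "\<And>x a. 0 \<le> c x a" "\<And>x. (\<Sum>a\<in>UNIV. c x a) \<le> 1"
    and G: "\<And>i mk s a. \<bar>G i mk s a\<bar> \<le> 1" and \<tau>: "0 \<le> \<tau>" "\<tau> \<le> 1"
    and err: "(\<Sum>xs | length xs = n. \<Sum>vs | length vs = n.
      \<bar>pmf (map_pmf (\<lambda>((m, xs), vs). (xs, vs)) L) (xs, vs) - (\<Prod>i<n. e (xs ! i) (vs ! i))\<bar>) \<le> \<epsilon>"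
  shows "\<tau> * (\<Sum>i<n. measure_pmf.expectation L (\<lambda>(mk, vs). G i mk (drop (Suc i) vs) (vs ! i) -
      (\<Sum>a\<in>UNIV. c (snd mk ! i) a * G i mk (drop (Suc i) vs) a)))
    \<le> ln 2 * cmi (map_pmf (\<lambda>((m, k), vs). (m, vs, k)) L) + real n * \<tau>\<^sup>2 + 2 * real n * \<epsilon> * \<tau>"
proof -
  let ?Q = "\<lambda>i (mk, vs). \<Sum>a\<in>UNIV. suffix_cond L i (snd mk) (drop (Suc i) vs) a * G i mk (drop (Suc i) vs) a"
  let ?c = "\<lambda>i (mk, vs). \<Sum>a\<in>UNIV. c (snd mk ! i) a * G i mk (drop (Suc i) vs) a"
  let ?G = "\<lambda>i (mk, vs). G i mk (drop (Suc i) vs) (vs ! i)"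
  let ?D = "\<lambda>i ((m, xs), vs). \<Sum>a\<in>UNIV. \<bar>suffix_cond L i xs (drop (Suc i) vs) a - c (xs ! i) a\<bar>"
  have bound: "\<bar>\<Sum>a\<in>UNIV. w a * G i mk s a\<bar> \<le> 1" if "\<And>a. 0 \<le> w a" "(\<Sum>a\<in>UNIV. w a) \<le> 1" for w i mk s
  proof -
    have "\<bar>\<Sum>a\<in>UNIV. w a * G i mk s a\<bar> \<le> (\<Sum>a\<in>UNIV. w a)"
      by (rule order.trans[OF sum_abs sum_mono]) (use G that in \<open>simp add: abs_mult mult_left_le\<close>)
    then show ?thesis using that(2) by linarith
  qed
  have int: "integrable (measure_pmf L) (?G i)" "integrable (measure_pmf L) (?Q i)" "integrable (measure_pmf L) (?c i)" for i
    by (rule measure_pmf.integrable_const_bound[where B = 1];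
      auto intro!: G bound c suffix_cond_nonneg sum_suffix_cond_le)+
  have err0: "suffix_error L n r e 0 \<le> \<epsilon>"
  proof -
    have "suffix_law L 0 = map_pmf (\<lambda>((m, xs), vs). (xs, vs)) L" by (simp add: suffix_law_def)
    then have "suffix_error L n r e 0 = (\<Sum>xs | length xs = n. \<Sum>vs | length vs = n.
      \<bar>pmf (map_pmf (\<lambda>((m, xs), vs). (xs, vs)) L) (xs, vs) - (\<Prod>i<n. e (xs ! i) (vs ! i))\<bar>)"
      by (simp add: suffix_error_def[OF len r e c] suffix_product_def)
    then show ?thesis using err by simp
  qed
  have le: "measure_pmf.expectation L (\<lambda>t. ?G i t - ?c i t) \<le> measure_pmf.expectation L (\<lambda>t. ?G i t - ?Q i t) + 2 * \<epsilon>"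
    if i: "i < n" for i
  proof -
    have D2: "0 \<le> ?D i t" "?D i t \<le> 2" for t
    proof -
      obtain m xs vs where t: "t = ((m, xs), vs)" by (metis surj_pair)
      have "?D i t \<le> (\<Sum>a\<in>UNIV. suffix_cond L i xs (drop (Suc i) vs) a + c (xs ! i) a)"
        unfolding t prod.case using c(1) suffix_cond_nonneg[of L i xs "drop (Suc i) vs"]
        by (intro sum_mono) (simp add: abs_le_iff add_increasing add_increasing2)
      also have "\<dots> \<le> 2" using sum_suffix_cond_le[of L i xs "drop (Suc i) vs"] c(2)[of "xs ! i"] by (simp add: sum.distrib)
      finally show "?D i t \<le> 2" .
      show "0 \<le> ?D i t" unfolding t prod.case by (intro sum_nonneg) simp
    qed
    have intD: "integrable (measure_pmf L) (?D i)"
      by (rule measure_pmf.integrable_const_bound[where B = 2]) (use D2 in \<open>auto simp: case_prod_unfold\<close>)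
    have "?Q i t - ?c i t \<le> ?D i t" for t
    proof -
      obtain m xs vs where t: "t = ((m, xs), vs)" by (metis surj_pair)
      show ?thesis
        unfolding t prod.case snd_conv sum_subtractf[symmetric] left_diff_distrib[symmetric]
      proof (rule sum_mono)
        fix a
        let ?s = "drop (Suc i) vs"
        have "(suffix_cond L i xs ?s a - c (xs ! i) a) * G i (m, xs) ?s a \<le>
            \<bar>suffix_cond L i xs ?s a - c (xs ! i) a\<bar> * \<bar>G i (m, xs) ?s a\<bar>"
          unfolding abs_mult[symmetric] by (rule abs_ge_self)
        also have "\<dots> \<le> \<bar>suffix_cond L i xs ?s a - c (xs ! i) a\<bar>" by (intro mult_left_le G) simp
        finally show "(suffix_cond L i xs ?s a - c (xs ! i) a) * G i (m, xs) ?s a \<le>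
          \<bar>suffix_cond L i xs ?s a - c (xs ! i) a\<bar>" .
      qed
    qed
    then have "measure_pmf.expectation L (\<lambda>t. ?Q i t - ?c i t) \<le> measure_pmf.expectation L (?D i)"
      by (intro integral_mono intD Bochner_Integration.integrable_diff int)
    also have "\<dots> \<le> 2 * suffix_error L n r e 0"
      by (rule suffix_cond_deviation[OF _ r e c i]) (rule len)
    also have "\<dots> \<le> 2 * \<epsilon>" using err0 by simp
    finally show ?thesis
      unfolding Bochner_Integration.integral_diff[OF int(1) int(2)] Bochner_Integration.integral_diff[OF int(1) int(3)]
        Bochner_Integration.integral_diff[OF int(2) int(3)] by linarith
  qed
  have "\<tau> * (\<Sum>i<n. measure_pmf.expectation L (\<lambda>t. ?G i t - ?c i t)) \<le>
      \<tau> * (\<Sum>i<n. measure_pmf.expectation L (\<lambda>t. ?G i t - ?Q i t) + 2 * \<epsilon>)"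
    using \<tau> by (intro mult_left_mono sum_mono le) auto
  also have "\<dots> = \<tau> * (\<Sum>i<n. measure_pmf.expectation L (\<lambda>t. ?G i t - ?Q i t)) + 2 * real n * \<epsilon> * \<tau>"
    by (simp only: sum.distrib sum_constant distrib_left) (simp add: mult_ac)
  also have "\<tau> * (\<Sum>i<n. measure_pmf.expectation L (\<lambda>t. ?G i t - ?Q i t)) \<le>
      ln 2 * cmi (map_pmf (\<lambda>((m, k), vs). (m, vs, k)) L) + real n * \<tau>\<^sup>2"
  proof -
    have "finite ((\<lambda>((m, k), vs). (vs, k)) ` set_pmf L)"
      by (rule finite_subset[of _ "{vs. length vs = n} \<times> {xs. length xs = n}"])
        (auto simp: finite_lists_length dest: len)
    moreover have "\<And>mk vs. (mk, vs) \<in> set_pmf L \<Longrightarrow> length vs = n" using len by (metis surj_pair)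
    ultimately show ?thesis using leakage_ge_deviation[of L n G \<tau>] G \<tau> by (simp add: case_prod_unfold)
  qed
  finally show ?thesis by (simp add: case_prod_unfold)
qed

section \<open>The asymptotic rate\<close>

text \<open>Intended for \<open>zip\<close>, which is injective only on pairs of lists of equal
  length; hence injectivity is demanded on the support.\<close>

lemma cmi_relabel:
  fixes L :: "('u \<times> 'v \<times> 'w) pmf"
  assumes inj: "inj_on f ((\<lambda>(u, v, w). v) ` set_pmf L)"
  shows "cmi (map_pmf (\<lambda>(u, v, w). (u, f v, w)) L) = cmi L"
proof -
  let ?F = "\<lambda>(u, v, w). (u, f v, w)" and ?G = "\<lambda>(v, w). (f v, w)"
  have v: "(\<lambda>(u, v, w). v) (u, v, w) \<in> (\<lambda>(u, v, w). v) ` set_pmf L" if "(u, v, w) \<in> set_pmf L" for u v w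
    using that by (rule imageI)
  have injF: "inj_on ?F (set_pmf L)"
    using inj v by (fastforce simp: inj_on_def)
  have injG: "inj_on ?G (set_pmf (map_pmf (\<lambda>(u, v, w). (v, w)) L))"
    using inj v unfolding set_map_pmf by (fastforce simp: inj_on_def)
  have m: "map_pmf (\<lambda>(u, v, w). w) (map_pmf ?F L) = map_pmf (\<lambda>(u, v, w). w) L"
    "map_pmf (\<lambda>(u, v, w). (u, w)) (map_pmf ?F L) = map_pmf (\<lambda>(u, v, w). (u, w)) L"
    "map_pmf (\<lambda>(u, v, w). (v, w)) (map_pmf ?F L) = map_pmf ?G (map_pmf (\<lambda>(u, v, w). (v, w)) L)"
    by (simp_all add: pmf.map_comp o_def case_prod_unfold)
  show ?thesis
    unfolding cmi_def m integral_map_pmf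
  proof (rule integral_cong_AE, simp, simp, rule AE_pmfI)
    fix t assume t: "t \<in> set_pmf L"
    obtain u v' w where tt: "t = (u, v', w)" by (metis surj_pair)
    have 1: "pmf (map_pmf ?F L) (u, f v', w) = pmf L (u, v', w)"
      using pmf_map_inj[OF injF t] by (simp add: tt)
    have "(v', w) \<in> set_pmf (map_pmf (\<lambda>(u, v, w). (v, w)) L)" using t unfolding tt by force
    from pmf_map_inj[OF injG this]
    have 2: "pmf (map_pmf ?G (map_pmf (\<lambda>(u, v, w). (v, w)) L)) (f v', w) = pmf (map_pmf (\<lambda>(u, v, w). (v, w)) L) (v', w)"
      by simp
    show "(case ?F t of (u, v, w) \<Rightarrow> log 2 (pmf (map_pmf ?F L) (u, v, w) * pmf (map_pmf (\<lambda>(u, v, w). w) L) w /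
          (pmf (map_pmf (\<lambda>(u, v, w). (u, w)) L) (u, w) * pmf (map_pmf ?G (map_pmf (\<lambda>(u, v, w). (v, w)) L)) (v, w)))) =
        (case t of (u, v, w) \<Rightarrow> log 2 (pmf L (u, v, w) * pmf (map_pmf (\<lambda>(u, v, w). w) L) w /
          (pmf (map_pmf (\<lambda>(u, v, w). (u, w)) L) (u, w) * pmf (map_pmf (\<lambda>(u, v, w). (v, w)) L) (v, w))))"
      by (simp only: tt prod.case 1 2)
  qed
qed

lemma sum_lists_zip:
  fixes f :: "('a::finite \<times> 'b::finite) list \<Rightarrow> real"
  shows "(\<Sum>vs | length vs = n. f vs) = (\<Sum>ys | length ys = n. \<Sum>zs | length zs = n. f (zip ys zs))"
proof -
  have "(\<Sum>vs | length vs = n. f vs) = (\<Sum>t\<in>{ys. length ys = n} \<times> {zs. length zs = n}. f (zip (fst t) (snd t)))"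
    by (rule sum.reindex_bij_witness[where i = "\<lambda>t. zip (fst t) (snd t)" and j = "\<lambda>vs. (map fst vs, map snd vs)"])
      (auto simp: zip_map_fst_snd)
  also have "\<dots> = (\<Sum>ys | length ys = n. \<Sum>zs | length zs = n. f (zip ys zs))"
    by (subst sum.cartesian_product) (simp only: case_prod_unfold)
  finally show ?thesis .
qed

section \<open>A protocol seen letter by letter\<close>

context
  fixes n :: nat and p :: "('x::finite \<times> 'y::finite) pmf" and K :: "'x \<Rightarrow> 'y \<Rightarrow> 'z::finite pmf"
    and \<pi> :: "('x list, 'y list, 'z list) protocol"
  assumes \<pi>: "protocol_for (iid n p) \<pi>" and out: "\<And>ys s m. length (bob_output \<pi> ys s m) = n"
begin

lemma length_law:
  assumes "(xs, ys, m, zs) \<in> set_pmf (law (iid n p) \<pi>)"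
  shows "length xs = n" "length ys = n" "length zs = n" "m \<in> words \<pi>"
proof -
  have "pmf (law (iid n p) \<pi>) (xs, ys, m, zs) \<noteq> 0" using assms by (simp add: set_pmf_iff)
  then have nz: "pmf (iid n p) (xs, ys) \<noteq> 0" "weight_A \<pi> xs m \<noteq> 0" "weight_B \<pi> ys m zs \<noteq> 0"
    unfolding pmf_law[OF \<pi>] by auto
  have "(xs, ys) \<in> set_pmf (iid n p)" using nz(1) by (simp add: set_pmf_iff)
  then show "length xs = n" "length ys = n" by (simp_all add: set_iid)
  show "m \<in> words \<pi>" using nz(2) by (auto simp: weight_A_def split: if_splits)
  show "length zs = n"
  proof (rule ccontr)
    assume "length zs \<noteq> n"
    then have "{s \<in> space (seed_B \<pi>). follows_B \<pi> ys s (split_word \<pi> m) \<and> bob_output \<pi> ys s m = zs} = {}"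
      using out by auto
    then have "weight_B \<pi> ys m zs = 0" unfolding weight_B_def by (simp only: measure_empty)
    then show False using nz(3) by contradiction
  qed
qed

definition "letter_law i = map_pmf (\<lambda>(xs, ys, m, zs). ((m, take i xs, drop (Suc i) ys), xs ! i, ys ! i, zs ! i)) (law (iid n p) \<pi>)"

lemma letter_law_inputs:
  assumes "i < n"
  shows "map_pmf (\<lambda>(u, x, v). (x, fst v)) (letter_law i) = p"
proof -
  have "map_pmf (\<lambda>(u, x, v). (x, fst v)) (letter_law i) =
      map_pmf (\<lambda>(xs, ys). (xs ! i, ys ! i)) (map_pmf (\<lambda>(xs, ys, m, zs). (xs, ys)) (law (iid n p) \<pi>))"
    by (simp add: letter_law_def pmf.map_comp o_def case_prod_unfold)
  then show ?thesis unfolding map_law_inputs[OF \<pi>] iid_component[OF assms] .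
qed

lemma pmf_iid_split:
  assumes "i < n" "length xs = n" "length ys = n"
  shows "pmf (iid n p) (xs, ys) = (\<Prod>j<i. pmf p (take i xs ! j, ys ! j)) *
    (pmf p (xs ! i, ys ! i) * (\<Prod>j\<in>{Suc i..<n}. pmf p (xs ! j, drop (Suc i) ys ! (j - Suc i))))"
proof -
  have "pmf (iid n p) (xs, ys) = (\<Prod>j\<in>{0..<n}. pmf p (xs ! j, ys ! j))"
    using pmf_iid[OF assms(2,3)] by (simp add: lessThan_atLeast0)
  also have "\<dots> = (\<Prod>j\<in>{0..<i}. pmf p (xs ! j, ys ! j)) * (\<Prod>j\<in>{i..<n}. pmf p (xs ! j, ys ! j))"
    using assms(1) by (simp add: prod.atLeastLessThan_concat)
  also have "(\<Prod>j\<in>{i..<n}. pmf p (xs ! j, ys ! j)) = pmf p (xs ! i, ys ! i) * (\<Prod>j\<in>{Suc i..<n}. pmf p (xs ! j, ys ! j))"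
    using assms(1) by (rule prod.atLeast_Suc_lessThan)
  also have "(\<Prod>j\<in>{0..<i}. pmf p (xs ! j, ys ! j)) = (\<Prod>j<i. pmf p (take i xs ! j, ys ! j))"
    by (auto intro!: prod.cong)
  also have "(\<Prod>j\<in>{Suc i..<n}. pmf p (xs ! j, ys ! j)) =
      (\<Prod>j\<in>{Suc i..<n}. pmf p (xs ! j, drop (Suc i) ys ! (j - Suc i)))"
    using assms by (intro prod.cong) auto
  finally show ?thesis .
qed

text \<open>Given \<open>u\<close> and the letter, what remains to be summed out are the later
  \<open>x\<close>, the earlier \<open>y\<close> and the other outputs. Every input pair before
  position \<open>i\<close> has a known \<open>x\<close> and every one after it a known
  \<open>y\<close>, so the sum separates into one over the later \<open>x\<close> weighted by Alice
  and one over the earlier \<open>y\<close> and the outputs weighted by Bob.\<close>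

lemma pmf_letter_law:
  assumes i: "i < n"
  shows "\<exists>\<alpha> \<beta>. \<forall>u x y z. pmf (letter_law i) (u, x, y, z) = \<alpha> u x y * \<beta> u y z"
proof -
  define X where "X t x = {xs :: 'x list. length xs = n \<and> take i xs = t \<and> xs ! i = x}" for t x
  define YZ where "YZ s y z = {(ys :: 'y list, zs :: 'z list). length ys = n \<and> length zs = n \<and> drop (Suc i) ys = s \<and> ys ! i = y \<and> zs ! i = z}"
    for s y z
  have finX: "finite (X t x)" for t x
    unfolding X_def by (rule finite_subset[OF _ finite_lists_length[of n]]) auto
  have finYZ: "finite (YZ s y z)" for s y z
    unfolding YZ_def by (rule finite_subset[OF _ finite_cartesian_product[OF finite_lists_length[of n] finite_lists_length[of n]]]) auto
  define \<alpha> where "\<alpha> = (\<lambda>(m, t, s) x y. \<Sum>xs\<in>X t x.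
    pmf p (x, y) * (\<Prod>j\<in>{Suc i..<n}. pmf p (xs ! j, s ! (j - Suc i))) * weight_A \<pi> xs m)"
  define \<beta> where "\<beta> = (\<lambda>(m, t, s) y z. \<Sum>(ys, zs)\<in>YZ s y z. (\<Prod>j<i. pmf p (t ! j, ys ! j)) * weight_B \<pi> ys m zs)"
  have "pmf (letter_law i) ((m, t, s), x, y, z) = \<alpha> (m, t, s) x y * \<beta> (m, t, s) y z" for m t s x y z
  proof -
    define E where "E = (\<lambda>(xs, ys, zs). (xs, ys, m, zs)) ` (X t x \<times> YZ s y z)"
    have "pmf (letter_law i) ((m, t, s), x, y, z) = measure_pmf.prob (law (iid n p) \<pi>) E"
      unfolding letter_law_def pmf_map
    proof (rule prob_cong_set_pmf)
      fix w assume w: "w \<in> set_pmf (law (iid n p) \<pi>)"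
      obtain xs ys m' zs where [simp]: "w = (xs, ys, m', zs)" by (metis surj_pair)
      have l: "length xs = n" "length ys = n" "length zs = n" using length_law w by auto
      have "w \<in> E \<longleftrightarrow> m' = m \<and> xs \<in> X t x \<and> (ys, zs) \<in> YZ s y z"
        unfolding E_def by force
      then show "w \<in> (\<lambda>(xs, ys, m, zs). ((m, take i xs, drop (Suc i) ys), xs ! i, ys ! i, zs ! i)) -` {((m, t, s), x, y, z)} \<longleftrightarrow> w \<in> E"
        using l by (auto simp: X_def YZ_def)
    qed
    also have "\<dots> = (\<Sum>w\<in>E. pmf (law (iid n p) \<pi>) w)"
      by (rule measure_measure_pmf_finite) (simp add: E_def finX finYZ)
    also have "\<dots> = (\<Sum>(xs, ys, zs)\<in>X t x \<times> YZ s y z. pmf (law (iid n p) \<pi>) (xs, ys, m, zs))"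
      unfolding E_def by (subst sum.reindex) (auto simp: inj_on_def case_prod_unfold intro!: sum.cong)
    also have "\<dots> = (\<Sum>(xs, yz)\<in>X t x \<times> YZ s y z.
        pmf p (x, y) * (\<Prod>j\<in>{Suc i..<n}. pmf p (xs ! j, s ! (j - Suc i))) * weight_A \<pi> xs m *
        (case yz of (ys, zs) \<Rightarrow> (\<Prod>j<i. pmf p (t ! j, ys ! j)) * weight_B \<pi> ys m zs))"
    proof (intro sum.cong refl)
      fix w assume w: "w \<in> X t x \<times> YZ s y z"
      obtain xs ys zs where [simp]: "w = (xs, ys, zs)" by (metis surj_pair)
      have x: "length xs = n" "take i xs = t" "xs ! i = x" and y: "length ys = n" "drop (Suc i) ys = s" "ys ! i = y"
        using w by (auto simp: X_def YZ_def)
      show "(case w of (xs, ys, zs) \<Rightarrow> pmf (law (iid n p) \<pi>) (xs, ys, m, zs)) = (case w of (xs, yz) \<Rightarrow>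
          pmf p (x, y) * (\<Prod>j\<in>{Suc i..<n}. pmf p (xs ! j, s ! (j - Suc i))) * weight_A \<pi> xs m *
          (case yz of (ys, zs) \<Rightarrow> (\<Prod>j<i. pmf p (t ! j, ys ! j)) * weight_B \<pi> ys m zs))"
        using pmf_iid_split[OF i x(1) y(1)] by (simp add: pmf_law[OF \<pi>] x y mult_ac)
    qed
    also have "\<dots> = \<alpha> (m, t, s) x y * \<beta> (m, t, s) y z"
      by (simp add: \<alpha>_def \<beta>_def sum_product sum.cartesian_product)
    finally show ?thesis .
  qed
  then have "\<forall>u x y z. pmf (letter_law i) (u, x, y, z) = \<alpha> u x y * \<beta> u y z" by (metis surj_pair)
  then show ?thesis by blast
qed

definition "zip_law = map_pmf (\<lambda>(xs, ys, m, zs). ((m, xs), zip ys zs)) (law (iid n p) \<pi>)"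

lemma finite_law: "finite ((\<lambda>(x, y, m, z). (x, y, z)) ` set_pmf (law (iid n p) \<pi>))"
  by (rule finite_subset[of _ "{xs. length xs = n} \<times> {ys. length ys = n} \<times> {zs. length zs = n}"])
    (auto simp: finite_lists_length dest: length_law)

lemma leakage_zip_law: "leakage (iid n p) \<pi> = cmi (map_pmf (\<lambda>((m, k), vs). (m, vs, k)) zip_law)"
proof -
  let ?L = "map_pmf (\<lambda>(xs, ys, m, zs). (m, (ys, zs), xs)) (law (iid n p) \<pi>)"
  have "inj_on (\<lambda>(ys, zs). zip ys zs) ((\<lambda>(u, v, w). v) ` set_pmf ?L)"
  proof (rule inj_on_subset)
    show "inj_on (\<lambda>(ys, zs). zip ys zs) {(ys :: 'y list, zs :: 'z list). length ys = n \<and> length zs = n}"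
      by (rule inj_on_inverseI[where g = "\<lambda>vs. (map fst vs, map snd vs)"]) auto
    show "(\<lambda>(u, v, w). v) ` set_pmf ?L \<subseteq> {(ys, zs). length ys = n \<and> length zs = n}"
      by (auto dest: length_law)
  qed
  from cmi_relabel[OF this] show ?thesis
    unfolding leakage_eq[OF \<pi> finite_law] zip_law_def pmf.map_comp by (simp add: o_def case_prod_unfold)
qed

lemma avg_L1_error_zip_law:
  "avg_L1_error n p K \<pi> = (\<Sum>xs | length xs = n. \<Sum>vs | length vs = n.
    \<bar>pmf (map_pmf (\<lambda>((m, xs), vs). (xs, vs)) zip_law) (xs, vs) -
      (\<Prod>i<n. pmf p (xs ! i, fst (vs ! i)) * pmf (K (xs ! i) (fst (vs ! i))) (snd (vs ! i)))\<bar>)"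
proof -
  let ?P = "\<lambda>xs ys zs. measure_pmf.prob (law (iid n p) \<pi>) {(x', y', m, z'). x' = xs \<and> y' = ys \<and> z' = zs}"
  have P: "pmf (map_pmf (\<lambda>((m, xs), vs). (xs, vs)) zip_law) (xs, zip ys zs) = ?P xs ys zs"
    if "length ys = n" "length zs = n" for xs ys zs
    unfolding zip_law_def pmf.map_comp pmf_map
  proof (rule prob_cong_set_pmf)
    fix w assume w: "w \<in> set_pmf (law (iid n p) \<pi>)"
    obtain xs' ys' m' zs' where [simp]: "w = (xs', ys', m', zs')" by (metis surj_pair)
    have l: "length ys' = n" "length zs' = n" using length_law w by auto
    have "zip ys' zs' = zip ys zs \<longleftrightarrow> ys' = ys \<and> zs' = zs"
      using l that by (metis map_fst_zip map_snd_zip)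
    then show "w \<in> ((\<lambda>((m, xs), vs). (xs, vs)) \<circ> (\<lambda>(xs, ys, m, zs). ((m, xs), zip ys zs))) -` {(xs, zip ys zs)} \<longleftrightarrow>
        w \<in> {(x', y', m, z'). x' = xs \<and> y' = ys \<and> z' = zs}"
      by simp
  qed
  \<comment> \<open>At inputs of probability zero both sides vanish, whatever value
    \<open>output_prob\<close> has there.\<close>
  have P0: "?P xs ys zs = pmf (iid n p) (xs, ys) * output_prob (iid n p) \<pi> xs ys zs" for xs ys zs
  proof (cases "pmf (iid n p) (xs, ys) = 0")
    case True
    have "?P xs ys zs = measure_pmf.prob (law (iid n p) \<pi>) {}"
    proof (rule prob_cong_set_pmf)
      fix w assume w: "w \<in> set_pmf (law (iid n p) \<pi>)"
      obtain xs' ys' m' zs' where [simp]: "w = (xs', ys', m', zs')" by (metis surj_pair)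
      have "pmf (law (iid n p) \<pi>) w \<noteq> 0" using w by (simp only: set_pmf_iff not_False_eq_True)
      then have "(xs', ys') \<noteq> (xs, ys)" using True by (auto simp: pmf_law[OF \<pi>])
      then show "w \<in> {(x', y', m, z'). x' = xs \<and> y' = ys \<and> z' = zs} \<longleftrightarrow> w \<in> {}" by auto
    qed
    then show ?thesis using True by simp
  next
    case False
    then show ?thesis by (simp add: output_prob_eq[OF \<pi>])
  qed
  have "avg_L1_error n p K \<pi> = (\<Sum>t\<in>{xs. length xs = n} \<times> {ys. length ys = n}. pmf (iid n p) t *
      (case t of (xs, ys) \<Rightarrow> \<Sum>zs | length zs = n. \<bar>output_prob (iid n p) \<pi> xs ys zs - pmf (memoryless K xs ys) zs\<bar>))"
    unfolding avg_L1_error_def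
    by (subst integral_measure_pmf_real[where A = "{xs. length xs = n} \<times> {ys. length ys = n}"])
      (auto simp: finite_lists_length mult.commute set_iid)
  also have "\<dots> = (\<Sum>xs | length xs = n. \<Sum>ys | length ys = n. pmf (iid n p) (xs, ys) *
      (\<Sum>zs | length zs = n. \<bar>output_prob (iid n p) \<pi> xs ys zs - pmf (memoryless K xs ys) zs\<bar>))"
    by (subst sum.cartesian_product) (simp only: case_prod_unfold prod.collapse)
  also have "\<dots> = (\<Sum>xs | length xs = n. \<Sum>ys | length ys = n. \<Sum>zs | length zs = n.
    \<bar>pmf (map_pmf (\<lambda>((m, xs), vs). (xs, vs)) zip_law) (xs, zip ys zs) -
      (\<Prod>i<n. pmf p (xs ! i, fst (zip ys zs ! i)) * pmf (K (xs ! i) (fst (zip ys zs ! i))) (snd (zip ys zs ! i)))\<bar>)"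
    unfolding sum_distrib_left
  proof (intro sum.cong refl)
    fix xs :: "'x list" and ys :: "'y list" and zs :: "'z list"
    assume "xs \<in> {xs. length xs = n}" "ys \<in> {ys. length ys = n}" "zs \<in> {zs. length zs = n}"
    then have l: "length xs = n" "length ys = n" "length zs = n" by auto
    have "(\<Prod>i<n. pmf p (xs ! i, fst (zip ys zs ! i)) * pmf (K (xs ! i) (fst (zip ys zs ! i))) (snd (zip ys zs ! i))) =
        pmf (iid n p) (xs, ys) * pmf (memoryless K xs ys) zs"
      unfolding pmf_iid[OF l(1,2)] pmf_memoryless[OF l] prod.distrib[symmetric] using l by (intro prod.cong) auto
    then show "pmf (iid n p) (xs, ys) * \<bar>output_prob (iid n p) \<pi> xs ys zs - pmf (memoryless K xs ys) zs\<bar> =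
      \<bar>pmf (map_pmf (\<lambda>((m, xs), vs). (xs, vs)) zip_law) (xs, zip ys zs) -
        (\<Prod>i<n. pmf p (xs ! i, fst (zip ys zs ! i)) * pmf (K (xs ! i) (fst (zip ys zs ! i))) (snd (zip ys zs ! i)))\<bar>"
      unfolding P[OF l(2,3)] P0 by (simp add: right_diff_distrib[symmetric] abs_mult)
  qed
  finally show ?thesis unfolding sum_lists_zip .
qed

end

text \<open>The single-letter bounds are added up, the informations by
  \<open>expected_length_ge_cmi\<close> and the deviations by
  \<open>leakage_ge_channel_deviation\<close>. The constant \<open>C\<close> depends neither on
  \<open>n\<close> nor on the protocol nor on \<tau>, which leaves \<tau> free to be tuned.\<close>

lemma expected_length_lower_bound:
  fixes p :: "('x::finite \<times> 'y::finite) pmf" and K :: "'x \<Rightarrow> 'y \<Rightarrow> 'z::finite pmf"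
  assumes full: "set_pmf (map_pmf fst p) = UNIV" and \<delta>: "0 < \<delta>"
  shows "\<exists>C\<ge>0. \<forall>n (\<pi> :: ('x list, 'y list, 'z list) protocol) \<tau>.
    protocol_for (iid n p) \<pi> \<longrightarrow> (\<forall>ys s m. length (bob_output \<pi> ys s m) = n) \<longrightarrow> 0 < \<tau> \<longrightarrow> \<tau> \<le> 1 \<longrightarrow>
    ennreal (real n * (cond_graph_entropy UNIV (adj p K) p - \<delta>) -
      C * (ln 2 * leakage (iid n p) \<pi> / \<tau> + real n * \<tau> + 2 * real n * avg_L1_error n p K \<pi>))
    \<le> expected_length (iid n p) \<pi>"
proof -
  define H where "H = cond_graph_entropy UNIV (adj p K) p"
  obtain C where C: "0 \<le> C" and single: "\<And>R :: ((msg \<times> 'x list \<times> 'y list) \<times> 'x \<times> 'y \<times> 'z) pmf.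
      map_pmf (\<lambda>(u, x, v). (x, fst v)) R = p \<Longrightarrow>
      \<exists>\<alpha> \<beta>. \<forall>u x y z. pmf R (u, x, y, z) = \<alpha> u x y * \<beta> u y z \<Longrightarrow>
      \<exists>(S :: msg \<times> 'x list \<times> 'y list \<Rightarrow> 'x set) g. (\<forall>u x v. \<bar>g u x v\<bar> \<le> 1) \<and>
        H \<le> cmi (map_pmf (\<lambda>(u, x, v). (S u, x, fst v)) R) + \<delta> +
        C * measure_pmf.expectation R (\<lambda>(u, x, v). g u x v - (\<Sum>a\<in>UNIV. channel p K x a * g u x a))"
    using single_letter[OF full \<delta>, of K, where 'u = "msg \<times> 'x list \<times> 'y list"] unfolding H_def by blast
  have "ennreal (real n * (H - \<delta>) -
      C * (ln 2 * leakage (iid n p) \<pi> / \<tau> + real n * \<tau> + 2 * real n * avg_L1_error n p K \<pi>))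
    \<le> expected_length (iid n p) \<pi>"
    if \<pi>: "protocol_for (iid n p) \<pi>" and out: "\<And>ys s m. length (bob_output \<pi> ys s m) = n" and \<tau>: "0 < \<tau>" "\<tau> \<le> 1"
    for n and \<pi> :: "('x list, 'y list, 'z list) protocol" and \<tau>
  proof (cases "expected_length (iid n p) \<pi> = \<infinity>")
    case True
    then show ?thesis by simp
  next
    case False
    let ?R = "letter_law n p \<pi>"
    let ?dev = "\<lambda>g i. measure_pmf.expectation (?R i) (\<lambda>(u, x, v). g u x v - (\<Sum>a\<in>UNIV. channel p K x a * g u x a))"
    \<comment> \<open>Stated for all \<open>i\<close>, with dummies beyond \<open>n\<close>, so that
      the axiom of choice yields whole families.\<close>
    have "\<forall>i. \<exists>(S :: msg \<times> 'x list \<times> 'y list \<Rightarrow> 'x set) g. (\<forall>u x v. \<bar>g u x v\<bar> \<le> 1) \<and>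
        (i < n \<longrightarrow> H \<le> cmi (map_pmf (\<lambda>(u, x, v). (S u, x, fst v)) (?R i)) + \<delta> + C * ?dev g i)"
    proof
      fix i
      show "\<exists>(S :: msg \<times> 'x list \<times> 'y list \<Rightarrow> 'x set) g. (\<forall>u x v. \<bar>g u x v\<bar> \<le> 1) \<and>
        (i < n \<longrightarrow> H \<le> cmi (map_pmf (\<lambda>(u, x, v). (S u, x, fst v)) (?R i)) + \<delta> + C * ?dev g i)"
      proof (cases "i < n")
        case True
        show ?thesis
          using single[OF letter_law_inputs[OF \<pi> out True] pmf_letter_law[OF \<pi> out True]] by blast
      next
        case False
        then show ?thesis
          by (intro exI[of _ "\<lambda>_. {}"] exI[of _ "\<lambda>_ _ _. 0"]) simp
      qed
    qed
    from choice[OF this] obtain S :: "nat \<Rightarrow> msg \<times> 'x list \<times> 'y list \<Rightarrow> 'x set" where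
      "\<forall>i. \<exists>g. (\<forall>u x v. \<bar>g u x v\<bar> \<le> 1) \<and>
        (i < n \<longrightarrow> H \<le> cmi (map_pmf (\<lambda>(u, x, v). (S i u, x, fst v)) (?R i)) + \<delta> + C * ?dev g i)"
      by (rule exE)
    from choice[OF this] obtain g where
      gS: "\<forall>i. (\<forall>u x v. \<bar>g i u x v\<bar> \<le> 1) \<and>
        (i < n \<longrightarrow> H \<le> cmi (map_pmf (\<lambda>(u, x, v). (S i u, x, fst v)) (?R i)) + \<delta> + C * ?dev (g i) i)"
      by (rule exE)
    have g: "\<bar>g i u x v\<bar> \<le> 1" for i u x v
      using conjunct1[OF spec[OF gS, of i]] by (elim allE)
    have HS: "H \<le> cmi (map_pmf (\<lambda>(u, x, v). (S i u, x, fst v)) (?R i)) + \<delta> + C * ?dev (g i) i" if "i < n" for i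
      using conjunct2[OF spec[OF gS, of i]] that by (rule mp)
    let ?P = "law (iid n p) \<pi>"
    define L where "L = map_pmf (\<lambda>(xs, ys, m, zs). (m, xs, ys)) ?P"
    have EL: "expected_length (iid n p) \<pi> = (\<integral>\<^sup>+(m, xs, ys). ennreal (real (length m)) \<partial>measure_pmf L)"
      unfolding expected_length_eq[OF \<pi>] L_def nn_integral_map_pmf
      by (intro nn_integral_cong) (simp add: case_prod_unfold ennreal_of_nat_eq_real_of_nat)
    have intL: "integrable (measure_pmf L) (\<lambda>(m, xs, ys). real (length m))"
      using False unfolding EL by (intro integrableI_bounded) (auto simp: case_prod_unfold less_top)
    have EL': "expected_length (iid n p) \<pi> = ennreal (measure_pmf.expectation L (\<lambda>(m, xs, ys). real (length m)))"
      unfolding EL using nn_integral_eq_integral[OF intL] by (simp add: case_prod_unfold)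
    have "(\<Sum>i<n. cmi (map_pmf (\<lambda>(m, xs, ys). (S i (m, take i xs, drop (Suc i) ys), xs ! i, ys ! i)) L))
        \<le> measure_pmf.expectation L (\<lambda>(m, xs, ys). real (length m))"
    proof (rule expected_length_ge_cmi[OF prefix_free_words[OF \<pi>] _ _ intL])
      show "fst ` set_pmf L \<subseteq> words \<pi>"
        unfolding L_def using length_law(4)[OF \<pi> out] by fastforce
      show "map_pmf snd L = iid n p"
      proof -
        have "map_pmf snd L = map_pmf (\<lambda>(x, y, m, z). (x, y)) ?P"
          unfolding L_def pmf.map_comp by (intro map_pmf_cong refl) (simp add: case_prod_unfold)
        then show ?thesis by (simp only: map_law_inputs[OF \<pi>])
      qed
    qed
    also have "(\<lambda>i. map_pmf (\<lambda>(m, xs, ys). (S i (m, take i xs, drop (Suc i) ys), xs ! i, ys ! i)) L) =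
        (\<lambda>i. map_pmf (\<lambda>(u, x, v). (S i u, x, fst v)) (?R i))"
      unfolding L_def letter_law_def[OF \<pi> out] pmf.map_comp by (simp add: o_def case_prod_unfold)
    finally have rate: "(\<Sum>i<n. cmi (map_pmf (\<lambda>(u, x, v). (S i u, x, fst v)) (?R i)))
        \<le> measure_pmf.expectation L (\<lambda>(m, xs, ys). real (length m))" .
    have dev: "\<tau> * (\<Sum>i<n. ?dev (g i) i) \<le>
      ln 2 * leakage (iid n p) \<pi> + real n * \<tau>\<^sup>2 + 2 * real n * avg_L1_error n p K \<pi> * \<tau>"
    proof -
      let ?Z = "zip_law n p \<pi>"
      \<comment> \<open>The auxiliary variable is recovered from the arguments of the leakage bound:
        the past of \<open>xs\<close> from \<open>mk\<close>, the future of \<open>ys\<close> as the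
        first components of the later pairs.\<close>
      let ?G = "\<lambda>i mk s a. g i (fst mk, take i (snd mk), map fst s) (snd mk ! i) a"
      let ?e = "\<lambda>x v. pmf p (x, fst v) * pmf (K x (fst v)) (snd v)"
      let ?r = "\<lambda>x. pmf (map_pmf fst p) x"
      have e: "?e x v = ?r x * channel p K x v" for x v
      proof -
        have "?r x \<noteq> 0" using full by (metis UNIV_I set_pmf_iff)
        then show ?thesis by (simp add: channel_def)
      qed
      have c1: "(\<Sum>v\<in>UNIV. channel p K x v) = 1" for x using sum_channel[of x p K] full by simp
      have r: "?r x = (\<Sum>v\<in>UNIV. ?e x v)" for x
        unfolding e sum_distrib_left[symmetric] c1 by simp
      have lenZ: "length xs = n \<and> length vs = n" if "((m, xs), vs) \<in> set_pmf ?Z" for m xs vs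
        using that length_law[OF \<pi> out] unfolding zip_law_def[OF \<pi> out] by fastforce
      have "\<tau> * (\<Sum>i<n. measure_pmf.expectation ?Z (\<lambda>(mk, vs). ?G i mk (drop (Suc i) vs) (vs ! i) -
          (\<Sum>a\<in>UNIV. channel p K (snd mk ! i) a * ?G i mk (drop (Suc i) vs) a)))
        \<le> ln 2 * cmi (map_pmf (\<lambda>((m, k), vs). (m, vs, k)) ?Z) + real n * \<tau>\<^sup>2 + 2 * real n * avg_L1_error n p K \<pi> * \<tau>"
        by (rule leakage_ge_channel_deviation[where e = ?e and r = ?r, OF _ r e channel_nonneg _ g])
          (use lenZ c1 \<tau> avg_L1_error_zip_law[OF \<pi> out, of K] in auto)
      moreover have "measure_pmf.expectation ?Z (\<lambda>(mk, vs). ?G i mk (drop (Suc i) vs) (vs ! i) -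
          (\<Sum>a\<in>UNIV. channel p K (snd mk ! i) a * ?G i mk (drop (Suc i) vs) a)) = ?dev (g i) i" if i: "i < n" for i
        unfolding zip_law_def[OF \<pi> out] letter_law_def[OF \<pi> out] integral_map_pmf
      proof (rule integral_cong_AE, simp, simp, rule AE_pmfI)
        fix w assume w: "w \<in> set_pmf ?P"
        obtain xs ys m zs where ww: "w = (xs, ys, m, zs)" by (metis surj_pair)
        have l: "length ys = n" "length zs = n" using length_law[OF \<pi> out] w unfolding ww by auto
        have z: "map fst (drop (Suc i) (zip ys zs)) = drop (Suc i) ys" "zip ys zs ! i = (ys ! i, zs ! i)"
          using l i by (simp_all add: drop_map[symmetric])
        show "(case case w of (xs, ys, m, zs) \<Rightarrow> ((m, xs), zip ys zs) of (mk, vs) \<Rightarrow> ?G i mk (drop (Suc i) vs) (vs ! i) -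
            (\<Sum>a\<in>UNIV. channel p K (snd mk ! i) a * ?G i mk (drop (Suc i) vs) a)) =
          (case case w of (xs, ys, m, zs) \<Rightarrow> ((m, take i xs, drop (Suc i) ys), xs ! i, ys ! i, zs ! i) of
            (u, x, v) \<Rightarrow> g i u x v - (\<Sum>a\<in>UNIV. channel p K x a * g i u x a))"
          unfolding ww prod.case fst_conv snd_conv z ..
      qed
      ultimately show ?thesis unfolding leakage_zip_law[OF \<pi> out] by simp
    qed
    have "real n * H \<le> (\<Sum>i<n. cmi (map_pmf (\<lambda>(u, x, v). (S i u, x, fst v)) (?R i)) + \<delta> + C * ?dev (g i) i)"
      using sum_mono[of "{..<n}" "\<lambda>_. H", OF HS] by simp
    also have "\<dots> = (\<Sum>i<n. cmi (map_pmf (\<lambda>(u, x, v). (S i u, x, fst v)) (?R i))) + real n * \<delta> + C * (\<Sum>i<n. ?dev (g i) i)"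
      by (simp only: sum.distrib sum_distrib_left) simp
    finally have 1: "real n * (H - \<delta>) - C * (\<Sum>i<n. ?dev (g i) i) \<le> measure_pmf.expectation L (\<lambda>(m, xs, ys). real (length m))"
      using rate by (simp add: right_diff_distrib)
    have "(\<Sum>i<n. ?dev (g i) i) \<le> (ln 2 * leakage (iid n p) \<pi> + real n * \<tau>\<^sup>2 + 2 * real n * avg_L1_error n p K \<pi> * \<tau>) / \<tau>"
      using dev \<tau> by (simp only: pos_le_divide_eq mult.commute)
    also have "\<dots> = ln 2 * leakage (iid n p) \<pi> / \<tau> + real n * \<tau> + 2 * real n * avg_L1_error n p K \<pi>"
      using \<tau> by (simp add: field_simps power2_eq_square)
    finally have 2: "C * (\<Sum>i<n. ?dev (g i) i) \<le> C * (ln 2 * leakage (iid n p) \<pi> / \<tau> + real n * \<tau> + 2 * real n * avg_L1_error n p K \<pi>)"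
      by (rule mult_left_mono[OF _ C])
    show ?thesis unfolding EL' by (rule ennreal_leI) (use 1 2 in linarith)
  qed
  then show ?thesis using C unfolding H_def by blast
qed

lemma achievable_lower_bound:
  fixes p :: "('x::finite \<times> 'y::finite) pmf" and K :: "'x \<Rightarrow> 'y \<Rightarrow> 'z::finite pmf"
  assumes full: "set_pmf (map_pmf fst p) = UNIV" and R: "achievable p K R"
  shows "ennreal (cond_graph_entropy UNIV (adj p K) p) \<le> R"
proof -
  define H where "H = cond_graph_entropy UNIV (adj p K) p"
  have approx: "ennreal (H - \<eta>) \<le> R" if \<eta>: "0 < \<eta>" for \<eta>
  proof (rule ccontr)
    assume "\<not> ennreal (H - \<eta>) \<le> R"
    then have lt: "R < ennreal (H - \<eta>)" by simp
    obtain C where C: "0 \<le> C" and bound: "\<And>n (\<pi> :: ('x list, 'y list, 'z list) protocol) \<tau>.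
        protocol_for (iid n p) \<pi> \<Longrightarrow> \<forall>ys s m. length (bob_output \<pi> ys s m) = n \<Longrightarrow> 0 < \<tau> \<Longrightarrow> \<tau> \<le> 1 \<Longrightarrow>
        ennreal (real n * (H - \<eta> / 2) -
          C * (ln 2 * leakage (iid n p) \<pi> / \<tau> + real n * \<tau> + 2 * real n * avg_L1_error n p K \<pi>))
        \<le> expected_length (iid n p) \<pi>"
      using expected_length_lower_bound[OF full, of "\<eta> / 2" K] \<eta> unfolding H_def by auto
    obtain \<pi> :: "nat \<Rightarrow> ('x list, 'y list, 'z list) protocol" where
      \<pi>: "\<And>n. 1 \<le> n \<Longrightarrow> protocol_for (iid n p) (\<pi> n) \<and> (\<forall>ys s m. length (bob_output (\<pi> n) ys s m) = n)"
      and lim: "(\<lambda>n. rate_n n p (\<pi> n)) \<longlonglongrightarrow> R"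
      and good: "\<And>\<epsilon> N. 0 < \<epsilon> \<Longrightarrow> \<exists>n\<ge>N. n \<ge> 1 \<and> avg_L1_error n p K (\<pi> n) \<le> \<epsilon> \<and> leakage (iid n p) (\<pi> n) \<le> real n * \<epsilon>"
      using R unfolding achievable_def by blast
    \<comment> \<open>The three error terms will be at most \<open>n * \<tau>\<close>,
      \<open>n * \<tau>\<close> and \<open>2 * n * \<tau>\<close>; \<open>C\<close> times their sum
      has to stay below \<open>n * \<eta> / 2\<close>, which explains the \<open>8\<close>. The
      summand in \<open>C + 1\<close> prevents a division by zero.\<close>
    define \<tau> where "\<tau> = min 1 (\<eta> / (8 * (C + 1)))"
    have \<tau>: "0 < \<tau>" "\<tau> \<le> 1" using \<eta> C by (auto simp: \<tau>_def)
    have "\<tau> \<le> \<eta> / (8 * (C + 1))" by (simp add: \<tau>_def)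
    then have "(C + 1) * (8 * \<tau>) \<le> \<eta>" using C by (simp add: field_simps)
    moreover have "C * (8 * \<tau>) \<le> (C + 1) * (8 * \<tau>)" using \<tau> by (intro mult_right_mono) auto
    ultimately have C\<tau>: "C * (4 * \<tau>) \<le> \<eta> / 2" by simp
    \<comment> \<open>The leakage gets divided by \<tau>, so it is required to be of the order of
      the square.\<close>
    define \<epsilon> where "\<epsilon> = \<tau> * \<tau>"
    have \<epsilon>: "0 < \<epsilon>" using \<tau> by (simp add: \<epsilon>_def)
    have "eventually (\<lambda>n. rate_n n p (\<pi> n) < ennreal (H - \<eta>)) sequentially"
      using order_tendstoD(2)[OF lim lt] .
    then obtain N where N: "\<And>n. N \<le> n \<Longrightarrow> rate_n n p (\<pi> n) < ennreal (H - \<eta>)"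
      unfolding eventually_sequentially by blast
    obtain n where n: "N \<le> n" "1 \<le> n" and err: "avg_L1_error n p K (\<pi> n) \<le> \<epsilon>" and leak: "leakage (iid n p) (\<pi> n) \<le> real n * \<epsilon>"
      using good[OF \<epsilon>, of N] by blast
    have "ln 2 * leakage (iid n p) (\<pi> n) / \<tau> \<le> real n * \<tau>"
    proof -
      have "ln 2 * leakage (iid n p) (\<pi> n) \<le> ln 2 * (real n * \<epsilon>)" by (intro mult_left_mono leak) simp
      also have "\<dots> \<le> 1 * (real n * \<epsilon>)" using \<epsilon> ln_2_less_1 by (intro mult_right_mono) auto
      finally show ?thesis using \<tau> by (simp add: divide_le_eq \<epsilon>_def mult.assoc)
    qed
    moreover have "2 * real n * avg_L1_error n p K (\<pi> n) \<le> 2 * real n * \<tau>"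
    proof (intro mult_left_mono)
      have "\<tau> * \<tau> \<le> \<tau>" using \<tau> by (intro mult_left_le) auto
      then show "avg_L1_error n p K (\<pi> n) \<le> \<tau>" using err by (simp add: \<epsilon>_def)
    qed simp
    moreover have "real n * (4 * \<tau>) = real n * \<tau> + real n * \<tau> + 2 * real n * \<tau>" by simp
    ultimately have "C * (ln 2 * leakage (iid n p) (\<pi> n) / \<tau> + real n * \<tau> + 2 * real n * avg_L1_error n p K (\<pi> n))
        \<le> C * (real n * (4 * \<tau>))"
      using C by (intro mult_left_mono) linarith+
    also have "\<dots> = real n * (C * (4 * \<tau>))" by simp
    also have "\<dots> \<le> real n * (\<eta> / 2)" by (intro mult_left_mono C\<tau>) simp
    finally have "real n * (H - \<eta>) \<le> real n * (H - \<eta> / 2) -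
        C * (ln 2 * leakage (iid n p) (\<pi> n) / \<tau> + real n * \<tau> + 2 * real n * avg_L1_error n p K (\<pi> n))"
      by (simp add: algebra_simps)
    from ennreal_leI[OF this] have "ennreal (real n * (H - \<eta>)) \<le> expected_length (iid n p) (\<pi> n)"
      using bound[of n "\<pi> n" \<tau>] \<pi>[OF n(2)] \<tau> by (meson order.trans)
    then have "ennreal (real n * (H - \<eta>)) / of_nat n \<le> rate_n n p (\<pi> n)"
      unfolding rate_n_def by (rule divide_right_mono_ennreal)
    moreover have "ennreal (real n * (H - \<eta>)) / of_nat n = ennreal (H - \<eta>)"
    proof -
      have "0 \<le> H - \<eta>" by (rule ccontr) (use lt in \<open>simp add: ennreal_neg\<close>)
      then have "ennreal (real n * (H - \<eta>)) / ennreal (real n) = ennreal (real n * (H - \<eta>) / real n)"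
        using n by (intro divide_ennreal) auto
      then show ?thesis using n by (simp add: ennreal_of_nat_eq_real_of_nat)
    qed
    ultimately show False using N[OF n(1)] by simp
  qed
  show ?thesis
  proof (cases R)
    case (real r)
    have "H \<le> r + \<eta>" if "0 < \<eta>" for \<eta>
      using approx[OF that] real by (simp add: ennreal_le_iff)
    then have "H \<le> r" by (rule field_le_epsilon)
    then show ?thesis using real by (simp add: H_def ennreal_leI)
  qed simp
qed

lemma AS2_rate_eq:
  fixes p :: "('x::finite \<times> 'y::finite) pmf" and K :: "'x \<Rightarrow> 'y \<Rightarrow> 'z::finite pmf"
  assumes fullX: "set_pmf (map_pmf fst p) = UNIV" and fullY: "set_pmf (map_pmf snd p) = UNIV"
  shows "AS2_rate p K = ennreal (cond_graph_entropy UNIV (adj p K) p)"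
proof (rule antisym)
  define H where "H = cond_graph_entropy UNIV (adj p K) p"
  let ?Q = "{cmi (extend_by p q) | q. \<forall>x\<in>UNIV. set_pmf (q x) \<subseteq> {w \<in> independent_sets UNIV (adj p K). x \<in> w}}"
  have H: "H = Inf ?Q" unfolding H_def by (rule cond_graph_entropy_eq)
  \<comment> \<open>Revealing \<open>x\<close> itself is always admissible, so the infimum is over a
    nonempty set.\<close>
  have "\<forall>x\<in>UNIV. set_pmf (return_pmf {x}) \<subseteq> {w \<in> independent_sets UNIV (adj p K). x \<in> w}"
    by (auto simp: independent_sets_def adj_def)
  then have "cmi (extend_by p (\<lambda>x. return_pmf {x})) \<in> ?Q"
    by (intro CollectI exI[of _ "\<lambda>x. return_pmf {x}"] conjI refl)
  then have ne: "?Q \<noteq> {}" by (metis empty_iff)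
  have "0 \<le> H" unfolding H
  proof (rule cInf_greatest[OF ne])
    show "0 \<le> h" if h: "h \<in> ?Q" for h
    proof -
      obtain q :: "'x \<Rightarrow> 'x set pmf" where "h = cmi (extend_by p q)" using h by (elim CollectE exE conjE) (rule that)
      then show ?thesis by (simp only: cmi_nonneg_finite)
    qed
  qed
  show "AS2_rate p K \<le> ennreal (cond_graph_entropy UNIV (adj p K) p)"
    unfolding H_def[symmetric]
  proof (rule ennreal_le_epsilon)
    fix \<eta> :: real assume \<eta>: "0 < \<eta>"
    \<comment> \<open>Half of \<eta> goes into approximating the infimum, the other half is the
      slack of the code.\<close>
    have "Inf ?Q < H + \<eta> / 2" using H \<eta> by simp
    from cInf_lessD[OF ne this] obtain q where
      q: "\<forall>x\<in>UNIV. set_pmf (q x) \<subseteq> {w \<in> independent_sets UNIV (adj p K). x \<in> w}" and lt: "cmi (extend_by p q) < H + \<eta> / 2"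
      by (elim bexE CollectE exE conjE) simp
    have "achievable p K (ennreal (cmi (extend_by p q) + \<eta> / 2))"
    proof (rule achievable_extend_by)
      show "snd ` set_pmf p = UNIV" using fullY by simp
      show "set_pmf (q x) \<subseteq> {w \<in> independent_sets UNIV (adj p K). x \<in> w}" for x using q by (rule bspec) simp
    qed (use \<eta> in simp)
    then have "AS2_rate p K \<le> ennreal (cmi (extend_by p q) + \<eta> / 2)"
      unfolding AS2_rate_def by (intro Inf_lower) simp
    also have "\<dots> \<le> ennreal (H + \<eta>)" using lt by (intro ennreal_leI) simp
    also have "\<dots> = ennreal H + ennreal \<eta>" using \<open>0 \<le> H\<close> \<eta> by (simp add: ennreal_plus)
    finally show "AS2_rate p K \<le> ennreal H + ennreal \<eta>" .
  qed
  show "ennreal (cond_graph_entropy UNIV (adj p K) p) \<le> AS2_rate p K"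
    unfolding AS2_rate_def using achievable_lower_bound[OF fullX] by (intro Inf_greatest) simp
qed

lemma fst_set_iid:
  fixes p :: "('x \<times> 'y) pmf"
  assumes "fst ` set_pmf p = UNIV"
  shows "fst ` set_pmf (iid n p) = {xs. length xs = n}"
proof (intro equalityI subsetI)
  fix xs :: "'x list" assume "xs \<in> {xs. length xs = n}"
  then have l: "length xs = n" by simp
  have "\<forall>x. \<exists>y. (x, y) \<in> set_pmf p"
  proof
    fix x :: 'x
    have "x \<in> fst ` set_pmf p" using assms by simp
    then show "\<exists>y. (x, y) \<in> set_pmf p" by force
  qed
  from choice[OF this] obtain f where f: "\<forall>x. (x, f x) \<in> set_pmf p" by (rule exE)
  have "(xs, map f xs) \<in> set_pmf (iid n p)" using l f by (simp add: set_iid)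
  then show "xs \<in> fst ` set_pmf (iid n p)" by force
qed (auto simp: set_iid)

theorem theorem6:
  fixes p :: "('x::finite \<times> 'y::finite) pmf"
    and K :: "'x \<Rightarrow> 'y \<Rightarrow> 'z::finite pmf"
  assumes "set_pmf (map_pmf fst p) = UNIV"
    and "set_pmf (map_pmf snd p) = UNIV"
    and "set_pmf (bind_pmf p (\<lambda>(x, y). K x y)) = UNIV"
  shows
    "(let H = chromatic_entropy UNIV (adj p K) (map_pmf fst p) in
      (\<forall>\<pi>. perfectly_secure p K \<pi> \<longrightarrow> ennreal H \<le> expected_length p \<pi>) \<and>
      (\<exists>\<pi>. perfectly_secure p K \<pi> \<and> expected_length p \<pi> < ennreal (H + 1))) \<and>
     (\<forall>n\<ge>1.
      let p\<^sub>n = iid n p; K\<^sub>n = memoryless K;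
          H\<^sub>n = chromatic_entropy {xs. length xs = n} (adj p\<^sub>n K\<^sub>n) (map_pmf fst p\<^sub>n) in
      (\<forall>\<pi>. perfectly_secure p\<^sub>n K\<^sub>n \<pi> \<longrightarrow> ennreal (1 / real n * H\<^sub>n) \<le> rate_n n p \<pi>) \<and>
      (\<exists>\<pi>. perfectly_secure p\<^sub>n K\<^sub>n \<pi> \<and> rate_n n p \<pi> \<le> ennreal (1 / real n * (H\<^sub>n + 1)))) \<and>
     AS2_rate p K = ennreal (cond_graph_entropy UNIV (adj p K) p)"
proof (intro conjI allI impI)
  have full: "fst ` set_pmf p = UNIV" using assms(1) by simp
  show "let H = chromatic_entropy UNIV (adj p K) (map_pmf fst p) in
      (\<forall>\<pi>. perfectly_secure p K \<pi> \<longrightarrow> ennreal H \<le> expected_length p \<pi>) \<and>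
      (\<exists>\<pi>. perfectly_secure p K \<pi> \<and> expected_length p \<pi> < ennreal (H + 1))"
    unfolding Let_def
  proof (intro conjI allI impI)
    show "ennreal (chromatic_entropy UNIV (adj p K) (map_pmf fst p)) \<le> expected_length p \<pi>"
      if "perfectly_secure p K \<pi>" for \<pi>
      using perfectly_secure_lower[OF that] unfolding full by simp
    show "\<exists>\<pi>. perfectly_secure p K \<pi> \<and>
        expected_length p \<pi> < ennreal (chromatic_entropy UNIV (adj p K) (map_pmf fst p) + 1)"
      using perfectly_secure_upper[of p K] unfolding full by simp
  qed
  show "AS2_rate p K = ennreal (cond_graph_entropy UNIV (adj p K) p)"
    by (rule AS2_rate_eq[OF assms(1,2)])
  fix n :: nat assume n: "1 \<le> n"
  \<comment> \<open>For negative \<open>a\<close> both sides are \<open>0\<close>, as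
    \<open>ennreal\<close> truncates.\<close>
  have div: "ennreal a / of_nat n = ennreal (1 / real n * a)" for a
  proof (cases "0 \<le> a")
    case True
    then show ?thesis using n divide_ennreal[of a "real n"] by (simp add: ennreal_of_nat_eq_real_of_nat)
  next
    case False
    then have "a / real n \<le> 0" by (simp add: divide_nonpos_nonneg)
    then show ?thesis using False by (simp add: ennreal_neg)
  qed
  define H where "H = chromatic_entropy {xs. length xs = n} (adj (iid n p) (memoryless K)) (map_pmf fst (iid n p))"
  have "\<forall>\<pi>. perfectly_secure (iid n p) (memoryless K) \<pi> \<longrightarrow> ennreal (1 / real n * H) \<le> rate_n n p \<pi>"
  proof (intro allI impI)
    fix \<pi> :: "('x list, 'y list, 'z list) protocol" assume sec: "perfectly_secure (iid n p) (memoryless K) \<pi>"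
    have "ennreal H \<le> expected_length (iid n p) \<pi>"
      using perfectly_secure_lower[OF sec finite_set_iid] unfolding H_def fst_set_iid[OF full] .
    then show "ennreal (1 / real n * H) \<le> rate_n n p \<pi>"
      unfolding rate_n_def div[symmetric] by (rule divide_right_mono_ennreal)
  qed
  moreover have "\<exists>\<pi>. perfectly_secure (iid n p) (memoryless K) \<pi> \<and> rate_n n p \<pi> \<le> ennreal (1 / real n * (H + 1))"
  proof -
    obtain \<pi> where \<pi>: "perfectly_secure (iid n p) (memoryless K) \<pi>" and lt: "expected_length (iid n p) \<pi> < ennreal (H + 1)"
      using perfectly_secure_upper[OF finite_set_iid[of n p], of "memoryless K"] unfolding H_def fst_set_iid[OF full] by blast
    have "rate_n n p \<pi> \<le> ennreal (1 / real n * (H + 1))"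
      unfolding rate_n_def div[symmetric] using lt by (intro divide_right_mono_ennreal) simp
    with \<pi> show ?thesis by blast
  qed
  ultimately show "let p\<^sub>n = iid n p; K\<^sub>n = memoryless K;
          H\<^sub>n = chromatic_entropy {xs. length xs = n} (adj p\<^sub>n K\<^sub>n) (map_pmf fst p\<^sub>n) in
      (\<forall>\<pi>. perfectly_secure p\<^sub>n K\<^sub>n \<pi> \<longrightarrow> ennreal (1 / real n * H\<^sub>n) \<le> rate_n n p \<pi>) \<and>
      (\<exists>\<pi>. perfectly_secure p\<^sub>n K\<^sub>n \<pi> \<and> rate_n n p \<pi> \<le> ennreal (1 / real n * (H\<^sub>n + 1)))"
    unfolding Let_def H_def[symmetric] by (rule conjI)
qed

end
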